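(* Suppose $g_0\ge2$, and let $\nu_0\in(0,1)$ be a constant determined only by the data $\{g_0,g_1,N,C_0,C_1\}$ and having property (P) of the context. There are constants $\theta_0>1$ and $\delta_2\in(0,1)$, determined only by the data (including the fixed choice of $\nu_0$), such that the following holds. Let $\omega,R>0$, put $\Delta=\omega^2G\left(\frac{\omega}{2R}\right)^{-1}$, and let $u$ be a nonnegative weak supersolution of $u_t-\operatorname{div}\mathbf A(x,t,u,Du)=0$ in $Q=K_{2R}\times(-\theta_0\Delta,0)$. If $$\left|\left(K_{2R}\times(T_0,T_0+\Delta)\right)\cap\left\{u<\frac\omega2\right\}\right|\le(1-\nu_0)|K_{2R}|\Delta$$ for all $T_0\in[-\theta_0\Delta,-\Delta]$, then $$\operatorname*{ess\,inf}_{\mathcal Q}u\ge\delta_2\omega,\qquad\text{where }\mathcal Q=Q_{\omega/2,R/2}\left(\tfrac12\right).$$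
   Context: Setting. $N\ge1$ is an integer, $1<g_0\le g_1<\infty$ and $C_0,C_1>0$ are constants. $g:[0,\infty)\to[0,\infty)$ is continuous and increasing, $G(\sigma)=\int_0^\sigma g(s)\,ds$, and $g_0G(\sigma)\le\sigma g(\sigma)\le g_1G(\sigma)$ for all $\sigma>0$. $\mathbf A(x,t,u,\xi)\in\mathbb R^N$ satisfies $\mathbf A(x,t,u,\xi)\cdot\xi\ge C_0G(|\xi|)$ and $|\mathbf A(x,t,u,\xi)|\le C_1g(|\xi|)$ for all arguments; $(x,t)\mapsto\mathbf A(x,t,u(x,t),Du(x,t))$ is understood to be measurable. $Du$ is the weak gradient in $x$. Constants depending only on the data depend on $g_0,g_1,N,C_0,C_1$ but not otherwise on $g,\mathbf A,u$ or the geometric parameters. Weak supersolutions. For open $\Omega\subset\mathbb R^{N+1}$, a function $u\in C_{\rm loc}(\Omega)$ (continuous in $\Omega$) with $\iint_\Omega G(|Du|)\,dx\,dt<\infty$ is a weak supersolution in $\Omega$ if $-\iint_\Omega u\varphi_t\,dx\,dt+\iint_\Omega\mathbf A(x,t,u,Du)\cdot D\varphi\,dx\,dt\ge0$ for all nonnegative $C^1$ functions $\varphi$ with compact support in $\Omega$. "In a cylinder" means in its interior. Notation. $K_\rho=\{x\in\mathbb R^N:\max_i|x_i|<\rho\}$. For positive $k,\rho,\theta$: $T_{k,\rho}(\theta)=\theta k^2G(k/\rho)^{-1}$, $Q_{k,\rho}(\theta)=K_\rho\times[-T_{k,\rho}(\theta),0]$, $Q_{k,\rho}=Q_{k,\rho}(1)$.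 Property (P) of $\nu_0$: for all $k,\rho>0$ and every nonnegative weak supersolution $u$ in $Q_{k,2\rho}$ with $|\{(x,t)\in Q_{k,2\rho}:u(x,t)<k\}|<\nu_0|Q_{k,2\rho}|$, one has $\operatorname{ess\,inf}_{Q_{k,\rho}}u\ge k/2$. (Such a constant exists.) *)

theory Defs
  imports "HOL-Analysis.Analysis" "HOL-Probability.Essential_Supremum"
begin

text \<open>
  Space-time is \<open>(real ^ 'n) \<times> real\<close> with \<open>N = CARD('n)\<close>; a point is \<open>(x, t)\<close>.
  The function \<open>g\<close> lives on \<open>[0, \<infinity>)\<close>; its values at negative arguments are never used.
\<close>

definition G_of :: "(real \<Rightarrow> real) \<Rightarrow> real \<Rightarrow> real" where
  "G_of g \<sigma> = integral {0..\<sigma>} g"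

text \<open>``Increasing'' means strictly increasing, so that \<open>G\<close> is positive on \<open>(0, \<infinity>)\<close>.\<close>

definition growth_function :: "real \<Rightarrow> real \<Rightarrow> (real \<Rightarrow> real) \<Rightarrow> bool" where
  "growth_function g\<^sub>0 g\<^sub>1 g \<longleftrightarrow>
     continuous_on {0..} g \<and> strict_mono_on {0..} g \<and> (\<forall>\<sigma>\<ge>0. 0 \<le> g \<sigma>) \<and>
     (\<forall>\<sigma>>0. g\<^sub>0 * G_of g \<sigma> \<le> \<sigma> * g \<sigma> \<and> \<sigma> * g \<sigma> \<le> g\<^sub>1 * G_of g \<sigma>)"

type_synonym 'n vector_field = "real ^ 'n \<Rightarrow> real \<Rightarrow> real \<Rightarrow> real ^ 'n \<Rightarrow> real ^ 'n"

definition structure_conditions ::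
    "real \<Rightarrow> real \<Rightarrow> (real \<Rightarrow> real) \<Rightarrow> 'n::finite vector_field \<Rightarrow> bool" where
  "structure_conditions C\<^sub>0 C\<^sub>1 g A \<longleftrightarrow>
     (\<forall>x t v \<xi>. A x t v \<xi> \<bullet> \<xi> \<ge> C\<^sub>0 * G_of g (norm \<xi>) \<and>
                norm (A x t v \<xi>) \<le> C\<^sub>1 * g (norm \<xi>))"

text \<open>
  Test functions are \<open>C\<^sup>1\<close> on the whole space-time (extended by zero). In finite dimensions,
  continuity of all directional derivatives is continuity of the derivative.
\<close>

definition test_function ::
    "((real ^ 'n::finite) \<times> real) set \<Rightarrow> ((real ^ 'n) \<times> real \<Rightarrow> real) \<Rightarrow> bool" where
  "test_function \<Omega> \<phi> \<longleftrightarrow>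
     (\<forall>z. \<phi> differentiable at z) \<and>
     (\<forall>h. continuous_on UNIV (\<lambda>z. frechet_derivative \<phi> (at z) h)) \<and>
     compact (closure {z. \<phi> z \<noteq> 0}) \<and> closure {z. \<phi> z \<noteq> 0} \<subseteq> \<Omega>"

definition time_deriv ::
    "((real ^ 'n::finite) \<times> real \<Rightarrow> real) \<Rightarrow> (real ^ 'n) \<times> real \<Rightarrow> real" where
  "time_deriv \<phi> z = frechet_derivative \<phi> (at z) (0, 1)"

definition space_grad ::
    "((real ^ 'n::finite) \<times> real \<Rightarrow> real) \<Rightarrow> (real ^ 'n) \<times> real \<Rightarrow> real ^ 'n" where
  "space_grad \<phi> z = (\<chi> i. frechet_derivative \<phi> (at z) (axis i 1, 0))"

definition weak_space_grad ::
    "((real ^ 'n::finite) \<times> real) set \<Rightarrow> ((real ^ 'n) \<times> real \<Rightarrow> real) \<Rightarrow>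
     ((real ^ 'n) \<times> real \<Rightarrow> real ^ 'n) \<Rightarrow> bool" where
  "weak_space_grad \<Omega> u Du \<longleftrightarrow>
     (\<forall>K. compact K \<and> K \<subseteq> \<Omega> \<longrightarrow> set_integrable lebesgue K Du) \<and>
     (\<forall>\<phi>. test_function \<Omega> \<phi> \<longrightarrow>
        (LINT z:\<Omega>|lebesgue. u z *\<^sub>R space_grad \<phi> z) = - (LINT z:\<Omega>|lebesgue. \<phi> z *\<^sub>R Du z))"

text \<open>
  The weak gradient is unique up to null sets and \<open>lebesgue\<close> is complete, so none of the
  conditions on \<open>Du\<close> depends on the representative. The measurability of
  \<open>A(x,t,u,Du)\<close> together with the structure conditions makes all integrands integrable.
\<close>

definition weak_supersolution ::
    "(real \<Rightarrow> real) \<Rightarrow> 'n::finite vector_field \<Rightarrow> ((real ^ 'n) \<times> real) set \<Rightarrow>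
     ((real ^ 'n) \<times> real \<Rightarrow> real) \<Rightarrow> bool" where
  "weak_supersolution g A \<Omega> u \<longleftrightarrow>
     open \<Omega> \<and> continuous_on \<Omega> u \<and>
     (\<exists>Du. weak_space_grad \<Omega> u Du \<and>
        set_integrable lebesgue \<Omega> (\<lambda>z. G_of g (norm (Du z))) \<and>
        set_borel_measurable lebesgue \<Omega> (\<lambda>z. A (fst z) (snd z) (u z) (Du z)) \<and>
        (\<forall>\<phi>. test_function \<Omega> \<phi> \<and> (\<forall>z. 0 \<le> \<phi> z) \<longrightarrow>
           - (LINT z:\<Omega>|lebesgue. u z * time_deriv \<phi> z)
           + (LINT z:\<Omega>|lebesgue. A (fst z) (snd z) (u z) (Du z) \<bullet> space_grad \<phi> z) \<ge> 0))"

definition cube :: "real \<Rightarrow> (real ^ 'n::finite) set" where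
  "cube \<rho> = {x. \<forall>i. \<bar>x $ i\<bar> < \<rho>}"

text \<open>In \<open>T\<^sub>k\<^sub>,\<^sub>\<rho>(\<theta>) = \<theta> k\<^sup>2 G(k/\<rho>)\<^sup>-\<^sup>1\<close> the exponent denotes the reciprocal, not the inverse function.\<close>

definition T_len :: "(real \<Rightarrow> real) \<Rightarrow> real \<Rightarrow> real \<Rightarrow> real \<Rightarrow> real" where
  "T_len g k \<rho> \<theta> = \<theta> * k\<^sup>2 * inverse (G_of g (k / \<rho>))"

definition Q_cyl ::
    "(real \<Rightarrow> real) \<Rightarrow> real \<Rightarrow> real \<Rightarrow> real \<Rightarrow> ((real ^ 'n::finite) \<times> real) set" where
  "Q_cyl g k \<rho> \<theta> = cube \<rho> \<times> {- T_len g k \<rho> \<theta>..0}"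

definition ess_inf_on ::
    "((real ^ 'n::finite) \<times> real) set \<Rightarrow> ((real ^ 'n) \<times> real \<Rightarrow> real) \<Rightarrow> ereal" where
  "ess_inf_on S u = - esssup (restrict_space lebesgue S) (\<lambda>z. - ereal (u z))"

text \<open>
  Property (P). Since \<open>\<nu>\<close> is a constant determined by the data alone, it serves all
  \<open>g\<close> and \<open>A\<close> with these data. The type argument fixes the dimension.
\<close>

definition property_P ::
    "'n::finite itself \<Rightarrow> real \<Rightarrow> real \<Rightarrow> real \<Rightarrow> real \<Rightarrow> real \<Rightarrow> bool" where
  "property_P _ g\<^sub>0 g\<^sub>1 C\<^sub>0 C\<^sub>1 \<nu> \<longleftrightarrow>
     (\<forall>g (A :: 'n vector_field) k \<rho> u.
        growth_function g\<^sub>0 g\<^sub>1 g \<and> structure_conditions C\<^sub>0 C\<^sub>1 g A \<and> k > 0 \<and> \<rho> > 0 \<and>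
        weak_supersolution g A (interior (Q_cyl g k (2 * \<rho>) 1)) u \<and>
        (\<forall>z \<in> interior (Q_cyl g k (2 * \<rho>) 1). 0 \<le> u z) \<and>
        measure lebesgue {z \<in> Q_cyl g k (2 * \<rho>) 1. u z < k}
          < \<nu> * measure lebesgue (Q_cyl g k (2 * \<rho>) 1 :: ((real ^ 'n) \<times> real) set) \<longrightarrow>
        ess_inf_on (Q_cyl g k \<rho> 1) u \<ge> ereal (k / 2))"

end

theory Submission
  imports Defs "HOL-Real_Asymp.Real_Asymp"
begin

text \<open>
  A supersolution is approximated by mollified functions \<open>w\<close> which solve a mollified inequality and
  obey the structure conditions up to an error tending to \<open>0\<close> in \<open>L\<^sup>1\<close>, so that all estimates are made on
  \<open>C\<^sup>1\<close> functions. Testing with \<open>p(w + c) \<zeta>\<^sup>Q\<close>, where \<open>P'' = - p' = f\<close>, gives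
  \<open>\<partial>\<^sub>t \<integral> P(w + c) \<zeta>\<^sup>Q + \<integral> f(w + c) G(|Dw|) \<zeta>\<^sup>Q \<lesssim> \<integral> f(w + c) G((w + c) L)\<close>.

  With \<open>f(y) \<approx> y\<^sup>-\<^sup>2\<close> the function \<open>P\<close> is a logarithm, and the bound \<open>u \<ge> \<omega>/2\<close> on a fixed fraction of
  the cube at one time of every window of length \<open>\<Delta>\<close> becomes \<open>u \<ge> k\<close> on a fixed fraction at all times.
  With \<open>f(y) \<approx> 1 / G(y L)\<close> the gradient term controls \<open>|D ln (w + c)|\<^sup>2\<close>, because \<open>G(\<sigma>) / \<sigma>\<^sup>2\<close> is
  nondecreasing for \<open>g\<^sub>0 \<ge> 2\<close>. Poincare's inequality on time slices then bounds the mean of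
  \<open>ln (k / (u + c))\<close> by a multiple of \<open>ln (k / c)\<^sup>1\<^sup>/\<^sup>2\<close>, uniformly on cylinders of the intrinsic length at
  level \<open>c\<close>. So \<open>{u < c}\<close> has small density once \<open>k / c\<close> is large, and property (P) applies.
\<close>

section \<open>The growth function\<close>

text \<open>The hypothesis speaks of averages over time windows, whereas Poincare's inequality
  needs, on every single time slice, a set of fixed proportion on which the truncated logarithm
  vanishes; the first estimate supplies it. In the second one, put
  \<open>y\<^sup>2 = ln (k / c)\<close>. With the weight \<open>1 / G (y L)\<close> the initial term
  is at most \<open>T\<close> times a logarithm and the error term at most \<open>T\<close> times a
  constant, where \<open>T = c\<^sup>2 / G (c / R)\<close>, so the bound on the density does not see
  how long the cylinder is. Poincare's inequality uses the first power of the logarithmic gradient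
  while the energy controls its square: the mean of the logarithm is of order \<open>y\<close>, but
  each point of \<open>{u < c}\<close> contributes about \<open>y\<^sup>2\<close>. The density is of
  order \<open>1 / y\<close>, and \<open>y\<close> is fixed last. As \<open>c\<close> decreases
  \<open>T\<close> can only grow, so the cylinder for property (P) may reach far back in time; this
  forces a large \<theta>0, which is still a data constant because \<open>c / \<omega>\<close> is
  one. Nothing is known of \<open>u\<close> at time 0. The estimates stop short of it, and the slab
  left over is charged to a quarter of \<nu>0.\<close>

locale growth =
  fixes g :: "real \<Rightarrow> real" and g0 g1 :: real and Q :: nat
  assumes growth: "growth_function g0 g1 g" and g0: "2 \<le> g0" and Q: "g1 \<le> real Q"
begin

abbreviation "G \<equiv> G_of g"

lemma g_cont: "continuous_on {0..} g"
  and g_strict: "0 \<le> s \<Longrightarrow> s < t \<Longrightarrow> g s < g t"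
  and g_nonneg: "0 \<le> s \<Longrightarrow> 0 \<le> g s"
  and g_mono: "0 \<le> s \<Longrightarrow> s \<le> t \<Longrightarrow> g s \<le> g t"
  using growth unfolding growth_function_def strict_mono_on_def by (auto simp: le_less)

lemma G_0 [simp]: "G 0 = 0"
  by (simp add: G_of_def)

lemma g_integrable: "0 \<le> a \<Longrightarrow> g integrable_on {a..b}"
  by (intro integrable_continuous_interval continuous_on_subset[OF g_cont]) auto

lemma G_diff: "0 \<le> a \<Longrightarrow> a \<le> b \<Longrightarrow> G b - G a = integral {a..b} g"
  using Henstock_Kurzweil_Integration.integral_combine[of 0 a b g] g_integrable[of 0 b]
  by (simp add: G_of_def)

text \<open>Convexity of \<open>G\<close>, read off from its increasing derivative \<open>g\<close>.
  Monotonicity and positivity of \<open>G\<close>, and later Jensen's inequality for mollifications,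
  all come from this inequality.\<close>

lemma G_tangent:
  assumes "0 \<le> s" "0 \<le> x"
  shows "G s + g s * (x - s) \<le> G x"
proof (cases "s \<le> x")
  case True
  have "integral {s..x} (\<lambda>_. g s) \<le> integral {s..x} g"
    using assms by (intro integral_le g_integrable) (auto intro: g_mono)
  then show ?thesis using G_diff[OF assms(1) True] True by (simp add: mult.commute)
next
  case False
  have "integral {x..s} g \<le> integral {x..s} (\<lambda>_. g s)"
    using assms by (intro integral_le g_integrable) (auto intro: g_mono)
  then show ?thesis using G_diff[of x s] False assms by (simp add: algebra_simps)
qed

lemma G_nonneg: "0 \<le> s \<Longrightarrow> 0 \<le> G s"
  using G_tangent[of 0 s] mult_nonneg_nonneg[OF g_nonneg[of 0], of s] by simp

lemma G_mono: "0 \<le> s \<Longrightarrow> s \<le> t \<Longrightarrow> G s \<le> G t"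
  using G_tangent[of s t] mult_nonneg_nonneg[OF g_nonneg[of s], of "t - s"] by simp

lemma g_pos: "0 < s \<Longrightarrow> 0 < g s"
  using g_strict[of 0 s] g_nonneg[of 0] by simp

lemma G_pos:
  assumes "0 < s" shows "0 < G s"
proof -
  have "0 < g (s/2) * (s/2)" using g_pos[of "s/2"] assms by simp
  then show ?thesis using G_tangent[of "s/2" s] G_nonneg[of "s/2"] assms by simp
qed

lemma two_G_le: "0 \<le> s \<Longrightarrow> 2 * G s \<le> s * g s"
proof (cases "s = 0")
  case False
  assume "0 \<le> s"
  then have "g0 * G s \<le> s * g s" using False growth by (auto simp: growth_function_def)
  moreover have "2 * G s \<le> g0 * G s" using g0 G_nonneg[of s] \<open>0 \<le> s\<close> by (intro mult_right_mono) auto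
  ultimately show ?thesis by simp
qed simp

lemma mult_g_le: "0 \<le> s \<Longrightarrow> s * g s \<le> Q * G s"
proof (cases "s = 0")
  case False
  assume "0 \<le> s"
  then have "s * g s \<le> g1 * G s" using False growth by (auto simp: growth_function_def)
  moreover have "g1 * G s \<le> Q * G s" using Q G_nonneg[of s] \<open>0 \<le> s\<close> by (intro mult_right_mono) auto
  ultimately show ?thesis by simp
qed simp

text \<open>Keeps the exponent \<open>Q - 1\<close> in the derivative of \<open>\<zeta> ^ Q\<close>
  positive, so that this derivative vanishes wherever \<zeta> does.\<close>

lemma Q_ge2: "2 \<le> Q"
proof -
  have "2 * G 1 \<le> Q * G 1" using two_G_le[of 1] mult_g_le[of 1] by simp
  then show ?thesis using G_pos[of 1] by simp
qed

lemma G_deriv: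
  assumes "0 < s"
  shows "(G has_real_derivative g s) (at s)"
proof -
  have "continuous_on {0..s+1} g"
    using g_cont by (rule continuous_on_subset) auto
  from integral_has_real_derivative[OF this, of s]
  have "(G has_real_derivative g s) (at s within {0..s+1})"
    using assms by (simp add: G_of_def[abs_def])
  then show ?thesis
    using assms by (simp add: at_within_Icc_at)
qed

lemma G_cont: "continuous_on {0..} G"
proof -
  have "continuous_on {0..x} G" for x
    unfolding G_of_def[abs_def]
    by (rule indefinite_integral_continuous_1) (simp add: g_integrable)
  then have "continuous (at y within {0..}) G" if "0 \<le> y" for y
  proof -
    have "continuous (at y within {0..y+1}) G"
      using \<open>\<And>x. continuous_on {0..x} G\<close>[of "y+1"] that by (auto simp: continuous_on_eq_continuous_within)
    moreover have "at y within {0..y+1} = at y within {0..}"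
      by (rule at_within_nhd[of _ "{..<y+1}"]) auto
    ultimately show ?thesis by simp
  qed
  then show ?thesis by (auto simp: continuous_on_eq_continuous_within)
qed

text \<open>The derivative has the sign of \<open>x * g x - 2 * G x\<close>. This is the form in
  which \<open>2 \<le> g0\<close> enters the estimates: \<open>G\<close> grows at least
  quadratically.\<close>

lemma G_ratio2:
  assumes "0 < s" "s \<le> t"
  shows "G s / s\<^sup>2 \<le> G t / t\<^sup>2"
proof (rule DERIV_nonneg_imp_nondecreasing[OF assms(2)])
  fix x assume x: "s \<le> x" "x \<le> t"
  then have "x > 0" using assms by simp
  have "((\<lambda>x. G x / x\<^sup>2) has_real_derivative (g x * x\<^sup>2 - G x * (2 * x)) / (x\<^sup>2 * x\<^sup>2)) (at x)"
    using \<open>x > 0\<close> by (auto intro!: derivative_eq_intros G_deriv simp: power2_eq_square)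
  moreover have "g x * x\<^sup>2 - G x * (2 * x) = x * (x * g x - 2 * G x)"
    by (simp add: power2_eq_square algebra_simps)
  then have "g x * x\<^sup>2 - G x * (2 * x) \<ge> 0"
    using two_G_le[of x] \<open>x > 0\<close> by simp
  ultimately show "\<exists>y. ((\<lambda>x. G x / x\<^sup>2) has_real_derivative y) (at x) \<and> 0 \<le> y"
    by (meson divide_nonneg_nonneg mult_nonneg_nonneg zero_le_power2)
qed

text \<open>The opposite comparison, with an integer exponent in place of \<open>g1\<close> so that
  the powers of \<zeta> and of scaling factors stay polynomial.\<close>

lemma G_ratioQ:
  assumes "0 < s" "s \<le> t"
  shows "G t / t ^ Q \<le> G s / s ^ Q"
proof (rule DERIV_nonpos_imp_nonincreasing[OF assms(2)])
  fix x assume x: "s \<le> x" "x \<le> t"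
  then have "x > 0" using assms by simp
  have "((\<lambda>x. G x / x ^ Q) has_real_derivative (g x * x ^ Q - G x * (Q * x ^ (Q - 1))) / (x ^ Q * x ^ Q)) (at x)"
    using \<open>x > 0\<close> by (auto intro!: derivative_eq_intros G_deriv)
  moreover have "g x * x ^ Q - G x * (Q * x ^ (Q - 1)) = x ^ (Q - 1) * (x * g x - Q * G x)"
    using Q_ge2 by (cases Q) (auto simp: algebra_simps)
  then have "g x * x ^ Q - G x * (Q * x ^ (Q - 1)) \<le> 0"
    using mult_g_le[of x] \<open>x > 0\<close> by (simp add: mult_nonneg_nonpos)
  ultimately show "\<exists>y. ((\<lambda>x. G x / x ^ Q) has_real_derivative y) (at x) \<and> y \<le> 0"
    by (intro exI[of _ "(g x * x ^ Q - G x * (Q * x ^ (Q - 1))) / (x ^ Q * x ^ Q)"])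
      (use \<open>x > 0\<close> in \<open>auto intro!: divide_nonpos_pos\<close>)
qed

lemma G_scale_ge:
  assumes "1 \<le> c" "0 \<le> s"
  shows "c\<^sup>2 * G s \<le> G (c * s)"
proof (cases "s = 0")
  case False
  then show ?thesis using G_ratio2[of s "c * s"] assms
    by (simp add: field_simps power_mult_distrib)
qed simp

lemma G_scale_le:
  assumes "1 \<le> c" "0 \<le> s"
  shows "G (c * s) \<le> c ^ Q * G s"
proof (cases "s = 0")
  case False
  then show ?thesis using G_ratioQ[of s "c * s"] assms
    by (simp add: field_simps power_mult_distrib)
qed simp

text \<open>If \<open>s\<close> is the larger of \<open>a\<close> and \<open>b / \<epsilon>\<close>,
  then \<open>g a * (b / \<epsilon>) \<le> s * g s \<le> Q * G s\<close>; adding the term of the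
  other argument makes the bound symmetric.\<close>

lemma young:
  assumes "0 \<le> a" "0 \<le> b" "0 < \<epsilon>"
  shows "g a * b \<le> \<epsilon> * (Q * G a) + \<epsilon> * (Q * G (b / \<epsilon>))"
proof -
  have *: "g a * (b / \<epsilon>) \<le> Q * G a + Q * G (b / \<epsilon>)"
  proof (cases "b / \<epsilon> \<le> a")
    case True
    then have "g a * (b / \<epsilon>) \<le> g a * a" using g_nonneg[of a] assms by (intro mult_left_mono) auto
    also have "\<dots> \<le> Q * G a" using mult_g_le[of a] assms by (simp add: mult.commute)
    finally show ?thesis using G_nonneg[of "b/\<epsilon>"] assms by (simp add: add_increasing2)
  next
    case False
    then have "g a * (b / \<epsilon>) \<le> g (b / \<epsilon>) * (b / \<epsilon>)"
      using assms by (intro mult_right_mono g_mono) auto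
    also have "\<dots> \<le> Q * G (b / \<epsilon>)" using mult_g_le[of "b/\<epsilon>"] assms by (simp add: mult.commute)
    finally show ?thesis using G_nonneg[of a] assms by (simp add: add_increasing)
  qed
  have "\<epsilon> * (g a * (b / \<epsilon>)) \<le> \<epsilon> * (Q * G a + Q * G (b / \<epsilon>))"
    using * assms by (intro mult_left_mono) auto
  then show ?thesis using assms by (simp add: algebra_simps)
qed

text \<open>For the test function \<open>F(u) \<zeta>\<^sup>Q\<close>, the exponent \<open>Q \<ge> g\<^sub>1\<close> of the cut-off
  compensates the factor \<open>\<zeta>\<^sup>-\<^sup>1\<close> inside \<open>G\<close> produced by Young's inequality.\<close>

lemma energy_density:
  fixes a d z :: "'v::real_inner" and C0 C1 f F y L e \<zeta> \<epsilon> :: real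
  assumes C: "0 < C0" "0 < C1" and "0 \<le> f" "0 \<le> F" "F \<le> y * f" "0 < y" "0 < L" "0 \<le> e"
    and "0 \<le> \<zeta>" "\<zeta> \<le> 1" "norm z \<le> L"
    and coer: "C0 * G (norm d) - e \<le> a \<bullet> d" and bd: "norm a \<le> C1 * g (norm d) + e"
    and \<epsilon>: "0 < \<epsilon>" "\<epsilon> \<le> 1" "2 * Q * C1 * \<epsilon> * Q \<le> C0"
  shows "- f * \<zeta> ^ Q * (a \<bullet> d) + F * (a \<bullet> ((Q * \<zeta> ^ (Q - 1)) *\<^sub>R z))
     \<le> - (C0 / 2) * (f * G (norm d) * \<zeta> ^ Q) + C0 / 2 * inverse \<epsilon> ^ Q * (f * G (y * L)) + (f + Q * L * F) * e"
proof -
  have \<zeta>p: "0 \<le> \<zeta> ^ (Q - 1)" "\<zeta> ^ (Q - 1) \<le> 1" "0 \<le> \<zeta> ^ Q" "\<zeta> ^ Q \<le> 1"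
    using assms by (auto simp: power_le_one)
  have 1: "- f * \<zeta> ^ Q * (a \<bullet> d) \<le> - f * \<zeta> ^ Q * (C0 * G (norm d)) + f * e"
  proof -
    have "f * \<zeta> ^ Q * (C0 * G (norm d) - e) \<le> f * \<zeta> ^ Q * (a \<bullet> d)"
      using coer \<zeta>p assms by (intro mult_left_mono) auto
    moreover have "f * \<zeta> ^ Q * e \<le> f * e"
      using \<zeta>p assms by (intro mult_right_mono mult_right_le_one_le) auto
    ultimately show ?thesis by (simp add: algebra_simps)
  qed
  have "a \<bullet> z \<le> (C1 * g (norm d) + e) * L"
    using norm_cauchy_schwarz[of a z] mult_mono[OF bd \<open>norm z \<le> L\<close>] bd norm_ge_zero[of a]
    by (smt (verit) norm_ge_zero)
  then have "F * (a \<bullet> ((Q * \<zeta> ^ (Q - 1)) *\<^sub>R z)) \<le> F * (Q * \<zeta> ^ (Q - 1) * ((C1 * g (norm d) + e) * L))"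
    using \<zeta>p assms by (auto intro!: mult_left_mono)
  also have "\<dots> = Q * C1 * (F * \<zeta> ^ (Q - 1) * L * g (norm d)) + \<zeta> ^ (Q - 1) * (Q * L * F * e)"
    by (simp add: algebra_simps)
  also have "\<zeta> ^ (Q - 1) * (Q * L * F * e) \<le> Q * L * F * e"
    using \<zeta>p assms by (intro mult_left_le_one_le) auto
  finally have 2: "F * (a \<bullet> ((Q * \<zeta> ^ (Q - 1)) *\<^sub>R z))
     \<le> Q * C1 * (F * \<zeta> ^ (Q - 1) * L * g (norm d)) + Q * L * F * e" by simp
  have 3: "F * \<zeta> ^ (Q - 1) * L * g (norm d) \<le> \<epsilon> * Q * (f * G (norm d) * \<zeta> ^ Q) + \<epsilon> * Q * (inverse \<epsilon> ^ Q * (f * G (y * L)))"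
  proof (cases "\<zeta> = 0")
    case True
    then have "\<zeta> ^ (Q - 1) = 0" using Q_ge2 by simp
    then show ?thesis using True assms Q_ge2 G_nonneg[of "y*L"]
      by (auto simp: zero_power intro!: mult_nonneg_nonneg)
  next
    case False
    then have z0: "\<zeta> > 0" using assms by simp
    have zQ: "\<zeta> ^ Q = \<zeta> ^ (Q - 1) * \<zeta>" using Q_ge2 by (cases Q) auto
    have "F * \<zeta> ^ (Q - 1) * L * g (norm d) \<le> (y * f) * \<zeta> ^ (Q - 1) * L * g (norm d)"
      using \<zeta>p assms g_nonneg[of "norm d"] by (intro mult_right_mono) auto
    also have "\<dots> = f * \<zeta> ^ Q * (g (norm d) * (y * L / \<zeta>))"
      using z0 zQ by (simp add: field_simps)
    also have "\<dots> \<le> f * \<zeta> ^ Q * (\<epsilon> * (Q * G (norm d)) + \<epsilon> * (Q * G (y * L / \<zeta> / \<epsilon>)))"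
      using \<zeta>p assms z0 by (intro mult_left_mono young) auto
    also have "G (y * L / \<zeta> / \<epsilon>) \<le> inverse (\<zeta> * \<epsilon>) ^ Q * G (y * L)"
      using G_scale_le[of "inverse (\<zeta> * \<epsilon>)" "y * L"] z0 assms
      by (simp add: field_simps mult_le_one one_le_inverse_iff)
    finally have "F * \<zeta> ^ (Q - 1) * L * g (norm d) \<le> f * \<zeta> ^ Q * (\<epsilon> * (Q * G (norm d)) + \<epsilon> * (Q * (inverse (\<zeta> * \<epsilon>) ^ Q * G (y * L))))"
      using \<zeta>p assms z0 by (simp add: mult_left_mono)
    also have "\<dots> = \<epsilon> * Q * (f * G (norm d) * \<zeta> ^ Q) + \<epsilon> * Q * (inverse \<epsilon> ^ Q * (f * G (y * L)))"
      using z0 assms by (simp add: field_simps power_mult_distrib power_inverse)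
    finally show ?thesis .
  qed
  define X where "X = f * G (norm d) * \<zeta> ^ Q + inverse \<epsilon> ^ Q * (f * G (y * L))"
  have X: "X \<ge> 0" unfolding X_def using assms \<zeta>p G_nonneg[of "norm d"] G_nonneg[of "y*L"] by simp
  \<comment> \<open>The upper bound on \<epsilon> is made for this line: the flux term consumes at
    most half of the coercive term.\<close>
  have "Q * C1 * (F * \<zeta> ^ (Q - 1) * L * g (norm d)) \<le> Q * C1 * (\<epsilon> * Q * X)"
    using 3 C by (intro mult_left_mono) (auto simp: X_def algebra_simps)
  also have "\<dots> = (2 * Q * C1 * \<epsilon> * Q) / 2 * X" by (simp add: algebra_simps)
  also have "\<dots> \<le> C0 / 2 * X" using \<epsilon> X by (intro mult_right_mono) auto
  finally have 4: "Q * C1 * (F * \<zeta> ^ (Q - 1) * L * g (norm d)) \<le> C0 / 2 * X" .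
  show ?thesis using 1 2 4 unfolding X_def by (simp add: algebra_simps)
qed

end

section \<open>Mollification\<close>

lemma nn_integral_lborel_affine:
  fixes f :: "'a::euclidean_space \<Rightarrow> ennreal"
  assumes [measurable]: "f \<in> borel_measurable borel" and c: "c \<noteq> 0"
  shows "(\<integral>\<^sup>+x. f x \<partial>lborel) = \<bar>c\<bar> ^ DIM('a) * (\<integral>\<^sup>+x. f (t + c *\<^sub>R x) \<partial>lborel)"
proof -
  have "(\<integral>\<^sup>+x. f x \<partial>lborel) = (\<integral>\<^sup>+x. f x \<partial>density (distr lborel borel (\<lambda>x. t + c *\<^sub>R x)) (\<lambda>_. ennreal (\<bar>c\<bar>^DIM('a))))"
    by (subst lborel_affine[OF c, of t]) simp
  also have "\<dots> = ennreal (\<bar>c\<bar>^DIM('a)) * (\<integral>\<^sup>+x. f (t + c *\<^sub>R x) \<partial>lborel)"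
    by (simp add: nn_integral_density nn_integral_distr nn_integral_cmult)
  finally show ?thesis by (simp add: ennreal_power)
qed

lemma integrable_lborel_affine:
  fixes f :: "'a::euclidean_space \<Rightarrow> 'b::{banach, second_countable_topology}"
  assumes f: "integrable lborel f" and c: "c \<noteq> 0"
  shows "integrable lborel (\<lambda>x. f (t + c *\<^sub>R x))"
proof -
  have [measurable]: "f \<in> borel_measurable borel" using borel_measurable_integrable[OF f] by simp
  have "(\<integral>\<^sup>+x. ennreal (norm (f x)) \<partial>lborel) < \<infinity>" using f by (simp add: integrable_iff_bounded)
  then show ?thesis
    using c nn_integral_lborel_affine[of "\<lambda>x. ennreal (norm (f x))" c t]
    by (auto simp: integrable_iff_bounded ennreal_mult_less_top)
qed

lemma integral_lborel_affine:
  fixes f :: "'a::euclidean_space \<Rightarrow> 'b::{banach, second_countable_topology}"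
  assumes c: "c \<noteq> 0" and [measurable]: "f \<in> borel_measurable borel"
  shows "(\<integral>x. f x \<partial>lborel) = \<bar>c\<bar> ^ DIM('a) *\<^sub>R (\<integral>x. f (t + c *\<^sub>R x) \<partial>lborel)"
proof -
  have "(\<integral>x. f x \<partial>lborel) = (\<integral>x. f x \<partial>density (distr lborel borel (\<lambda>x. t + c *\<^sub>R x)) (\<lambda>_. ennreal (\<bar>c\<bar>^DIM('a))))"
    by (subst lborel_affine[OF c, of t]) simp
  also have "\<dots> = (\<integral>x. \<bar>c\<bar>^DIM('a) *\<^sub>R f x \<partial>distr lborel borel (\<lambda>x. t + c *\<^sub>R x))"
    by (subst integral_density) auto
  also have "\<dots> = (\<integral>x. \<bar>c\<bar>^DIM('a) *\<^sub>R f (t + c *\<^sub>R x) \<partial>lborel)"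
    by (subst integral_distr) auto
  finally show ?thesis by simp
qed

lemma nn_integral_lborel_translate:
  fixes f :: "'a::euclidean_space \<Rightarrow> ennreal"
  assumes "f \<in> borel_measurable borel"
  shows "(\<integral>\<^sup>+x. f (x - y) \<partial>lborel) = (\<integral>\<^sup>+x. f x \<partial>lborel)"
  using nn_integral_lborel_affine[OF assms, of 1 "-y"] by simp

lemma integrable_lborel_translate:
  fixes f :: "'a::euclidean_space \<Rightarrow> 'b::{banach, second_countable_topology}"
  assumes "integrable lborel f"
  shows "integrable lborel (\<lambda>x. f (x - y))"
  using integrable_lborel_affine[OF assms, of 1 "-y"] by simp

lemma integral_lborel_translate:
  fixes f :: "'a::euclidean_space \<Rightarrow> 'b::{banach, second_countable_topology}"
  assumes "f \<in> borel_measurable borel"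
  shows "(\<integral>x. f (x - y) \<partial>lborel) = (\<integral>x. f x \<partial>lborel)"
  using integral_lborel_affine[OF _ assms, of 1 "-y"] by simp

lemma integral_lborel_reflect:
  fixes f :: "'a::euclidean_space \<Rightarrow> 'b::{banach, second_countable_topology}"
  assumes "f \<in> borel_measurable borel"
  shows "(\<integral>x. f (y - x) \<partial>lborel) = (\<integral>x. f x \<partial>lborel)"
  using integral_lborel_affine[OF _ assms, of "-1" "y"] by simp

text \<open>Outer regularity of the complement yields a closed subset of \<open>A\<close> up to
  \<open>e/2\<close>; intersecting it with a large ball makes it compact at the cost of another
  \<open>e/2\<close>.\<close>

lemma inner_compact_lborel:
  fixes A :: "'a::euclidean_space set" and e :: real
  assumes A: "A \<in> sets borel" "emeasure lborel A < \<infinity>" and e: "0 < e"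
  obtains K where "compact K" "K \<subseteq> A" "emeasure lborel (A - K) < e"
proof -
  have "-A \<in> sets borel" using A by auto
  from outer_regular_lborel[OF this, of "e/2"] e
  obtain U where U: "open U" "-A \<subseteq> U" "emeasure lborel (U - -A) < e/2" by auto
  let ?T = "- U"
  have [measurable]: "A \<in> sets borel" "?T \<in> sets borel" using A U by auto
  have T: "?T \<subseteq> A" "closed ?T" using U by auto
  have "A - ?T = U - -A" by auto
  then have AT: "emeasure lborel (A - ?T) < e/2" using U by simp
  have "(\<lambda>n. emeasure lborel (A - cball 0 (real n))) \<longlonglongrightarrow> emeasure lborel (\<Inter>n. A - cball 0 (real n))"
  proof (rule Lim_emeasure_decseq)
    show "decseq (\<lambda>n. A - cball 0 (real n))" by (auto simp: decseq_def)
    show "emeasure lborel (A - cball 0 (real i)) \<noteq> \<infinity>" for i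
      using A(2) emeasure_mono[of "A - cball 0 (real i)" A lborel] by (auto simp: top_unique)
  qed auto
  moreover have "(\<Inter>n. A - cball 0 (real n)) = {}"
    using real_arch_simple by (auto simp: not_le)
  ultimately have "(\<lambda>n. emeasure lborel (A - cball 0 (real n))) \<longlonglongrightarrow> 0"
    by (simp only: emeasure_empty)
  then have "eventually (\<lambda>n. emeasure lborel (A - cball 0 (real n)) < ennreal (e/2)) sequentially"
    using e by (intro order_tendstoD) auto
  then obtain n where n: "emeasure lborel (A - cball 0 (real n)) < ennreal (e/2)"
    by (auto simp: eventually_sequentially)
  show ?thesis
  proof
    show "compact (?T \<inter> cball 0 (real n))"
      using T by (metis closed_Int_compact compact_cball)
    show "?T \<inter> cball 0 (real n) \<subseteq> A" using T by auto
    have "emeasure lborel (A - ?T \<inter> cball 0 (real n)) \<le> emeasure lborel ((A - ?T) \<union> (A - cball 0 (real n)))"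
      by (intro emeasure_mono sets.Un sets.Diff) auto
    also have "\<dots> \<le> emeasure lborel (A - ?T) + emeasure lborel (A - cball 0 (real n))"
      by (intro emeasure_subadditive sets.Diff) auto
    also have "\<dots> < ennreal (e/2) + ennreal (e/2)"
      using AT n by (intro add_strict_mono)
    finally show "emeasure lborel (A - ?T \<inter> cball 0 (real n)) < e"
      using e by (simp flip: ennreal_plus)
  qed
qed

text \<open>Continuity of translations in the mean, by approximation. For an indicator take
  \<open>K \<subseteq> A \<subseteq> U\<close> with \<open>U - K\<close> small: a shift too short to
  carry points of \<open>K\<close> out of \<open>U\<close> changes the indicator only at points
  which, before or after the shift, lie in \<open>U - K\<close>. Sums and dominated limits inherit
  the property.\<close>

lemma L1_translation:
  fixes f :: "'a::euclidean_space \<Rightarrow> 'b::{banach, second_countable_topology}"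
  assumes "integrable lborel f" "0 < \<epsilon>"
  shows "\<exists>\<delta>>0. \<forall>y. norm y < \<delta> \<longrightarrow> (\<integral>z. norm (f (z - y) - f z) \<partial>lborel) \<le> \<epsilon>"
  using assms
proof (induction arbitrary: \<epsilon> rule: integrable_induct)
  case (base A c)
  have [measurable]: "A \<in> sets borel" using base by simp
  \<comment> \<open>The added 1 permits division by \<open>N\<close> also when
    \<open>c = 0\<close>.\<close>
  define N where "N = norm c + 1"
  define e where "e = \<epsilon> / (4 * N)"
  have nc: "N > 0" "norm c \<le> N" using norm_ge_zero[of c] unfolding N_def by linarith+
  have e: "e > 0" using base nc by (simp add: e_def)
  obtain K where K: "compact K" "K \<subseteq> A" "emeasure lborel (A - K) < e"
    using inner_compact_lborel[of A e] base e by auto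
  obtain U where U: "open U" "A \<subseteq> U" "emeasure lborel (U - A) < e"
    using outer_regular_lborel[of A e] e by auto
  have [measurable]: "K \<in> sets borel" "U \<in> sets borel" using K U by (auto intro: borel_compact)
  obtain \<delta> where \<delta>: "\<delta> > 0" "(\<Union>x\<in>K. ball x \<delta>) \<subseteq> U"
    using compact_subset_open_imp_ball_epsilon_subset[of K U] K U by blast
  have fin: "emeasure lborel (U - K) < \<infinity>" "measure lborel (U - K) \<le> 2 * e"
  proof -
    have "emeasure lborel (U - K) \<le> emeasure lborel ((U - A) \<union> (A - K))"
      by (intro emeasure_mono) auto
    also have "\<dots> \<le> emeasure lborel (U - A) + emeasure lborel (A - K)"
      by (intro emeasure_subadditive) auto
    also have "\<dots> \<le> ennreal e + ennreal e" using U K by (intro add_mono) auto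
    also have "\<dots> = ennreal (2 * e)" using e by (simp flip: ennreal_plus)
    finally have *: "emeasure lborel (U - K) \<le> ennreal (2 * e)" .
    then show "emeasure lborel (U - K) < \<infinity>" using le_less_trans by fastforce
    show "measure lborel (U - K) \<le> 2 * e" using * e by (simp add: measure_def enn2real_leI)
  qed
  let ?i = "indicator (U - K) :: 'a \<Rightarrow> real"
  have ii: "integrable lborel ?i" using fin by (intro integrable_real_indicator) auto
  show ?case
  proof (intro exI[of _ \<delta>] conjI allI impI)
    fix y :: 'a assume y: "norm y < \<delta>"
    have pw: "norm (indicat_real A (z - y) *\<^sub>R c - indicat_real A z *\<^sub>R c) \<le> (?i z + ?i (z - y)) * norm c" for z
    proof -
      have "z \<in> U" if "z - y \<in> K" using \<delta> that y by (force simp: dist_norm)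
      moreover have "z - y \<in> U" if "z \<in> K" using \<delta> that y by (force simp: dist_norm)
      ultimately have "\<bar>indicat_real A (z - y) - indicat_real A z\<bar> \<le> ?i z + ?i (z - y)"
        using K U by (auto simp: indicator_def)
      then show ?thesis by (simp flip: scaleR_diff_left add: mult_right_mono)
    qed
    have "(\<integral>z. norm (indicat_real A (z - y) *\<^sub>R c - indicat_real A z *\<^sub>R c) \<partial>lborel) \<le> (\<integral>z. (?i z + ?i (z - y)) * norm c \<partial>lborel)"
      by (rule integral_mono'[OF _ pw]) (auto intro!: ii integrable_lborel_translate)
    also have "\<dots> = (measure lborel (U - K) + measure lborel (U - K)) * norm c"
      using ii integrable_lborel_translate[OF ii, of y] by (simp add: integral_lborel_translate)
    also have "\<dots> \<le> (2 * e + 2 * e) * N" using fin(2) e nc by (intro mult_mono) auto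
    also have "\<dots> = \<epsilon>" using nc by (simp add: e_def)
    finally show "(\<integral>z. norm (indicat_real A (z - y) *\<^sub>R c - indicat_real A z *\<^sub>R c) \<partial>lborel) \<le> \<epsilon>" .
  qed (use \<delta>(1) in simp)
next
  case (add f g)
  obtain d1 where d1: "d1 > 0" "\<And>y. norm y < d1 \<Longrightarrow> (\<integral>z. norm (f (z - y) - f z) \<partial>lborel) \<le> \<epsilon>/2"
    using add(3)[of "\<epsilon>/2"] add(5) by auto
  obtain d2 where d2: "d2 > 0" "\<And>y. norm y < d2 \<Longrightarrow> (\<integral>z. norm (g (z - y) - g z) \<partial>lborel) \<le> \<epsilon>/2"
    using add(4)[of "\<epsilon>/2"] add(5) by auto
  note [simp] = add(1,2) integrable_lborel_translate[OF add(1)] integrable_lborel_translate[OF add(2)]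
  show ?case
  proof (intro exI[of _ "min d1 d2"] conjI allI impI)
    fix y :: 'a assume y: "norm y < min d1 d2"
    have "(\<integral>z. norm (f (z - y) + g (z - y) - (f z + g z)) \<partial>lborel)
        \<le> (\<integral>z. norm (f (z - y) - f z) + norm (g (z - y) - g z) \<partial>lborel)"
    proof (rule integral_mono)
      show "norm (f (z - y) + g (z - y) - (f z + g z)) \<le> norm (f (z - y) - f z) + norm (g (z - y) - g z)" for z
        using norm_triangle_ineq[of "f (z - y) - f z" "g (z - y) - g z"] by (simp add: algebra_simps)
    qed auto
    also have "\<dots> = (\<integral>z. norm (f (z - y) - f z) \<partial>lborel) + (\<integral>z. norm (g (z - y) - g z) \<partial>lborel)"
      by (rule Bochner_Integration.integral_add) auto
    also have "\<dots> \<le> \<epsilon>" using d1(2)[of y] d2(2)[of y] y by auto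
    finally show "(\<integral>z. norm (f (z - y) + g (z - y) - (f z + g z)) \<partial>lborel) \<le> \<epsilon>" .
  qed (use d1(1) d2(1) in simp)
next
  case (lim f s)
  have [simp]: "integrable lborel f" "integrable lborel (s i)" for i using lim by auto
  have [measurable]: "f \<in> borel_measurable borel" "s i \<in> borel_measurable borel" for i
    using borel_measurable_integrable[of lborel f] borel_measurable_integrable[of lborel "s i"] by auto
  have conv: "(\<lambda>i. \<integral>z. norm (s i z - f z) \<partial>lborel) \<longlonglongrightarrow> (\<integral>z. 0 \<partial>(lborel::'a measure))"
  proof (rule integral_dominated_convergence)
    show "integrable lborel (\<lambda>z. 3 * norm (f z))" by simp
    show "AE z in lborel. (\<lambda>i. norm (s i z - f z)) \<longlonglongrightarrow> 0"
      using lim(2) by (intro AE_I2) (auto intro!: tendsto_norm_zero simp: LIM_zero_iff)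
    show "AE z in lborel. norm (norm (s i z - f z)) \<le> 3 * norm (f z)" for i
    proof (intro AE_I2)
      fix z :: 'a
      show "norm (norm (s i z - f z)) \<le> 3 * norm (f z)"
        using lim(3)[of z i] norm_triangle_ineq4[of "s i z" "f z"] by simp
    qed
  qed simp_all
  have "eventually (\<lambda>i. (\<integral>z. norm (s i z - f z) \<partial>lborel) < \<epsilon>/3) sequentially"
    using conv lim(6) by (intro order_tendstoD) auto
  then obtain i where i: "(\<integral>z. norm (s i z - f z) \<partial>lborel) < \<epsilon>/3"
    by (auto simp: eventually_sequentially)
  obtain d where d: "d > 0" "\<And>y. norm y < d \<Longrightarrow> (\<integral>z. norm (s i (z - y) - s i z) \<partial>lborel) \<le> \<epsilon>/3"
    using lim(5)[of "\<epsilon>/3" i] lim(6) by auto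
  note [simp] = integrable_lborel_translate[OF \<open>integrable lborel f\<close>] integrable_lborel_translate[OF \<open>integrable lborel (s i)\<close>]
  show ?case
  proof (intro exI[of _ d] conjI allI impI)
    fix y :: 'a assume y: "norm y < d"
    have "(\<integral>z. norm (f (z - y) - f z) \<partial>lborel)
        \<le> (\<integral>z. norm (s i (z - y) - f (z - y)) + norm (s i (z - y) - s i z) + norm (s i z - f z) \<partial>lborel)"
    proof (rule integral_mono)
      show "norm (f (z - y) - f z) \<le> norm (s i (z - y) - f (z - y)) + norm (s i (z - y) - s i z) + norm (s i z - f z)" for z
        using norm_triangle_ineq[of "- (s i (z - y) - f (z - y)) + (s i (z - y) - s i z)" "s i z - f z"]
          norm_triangle_ineq[of "- (s i (z - y) - f (z - y))" "s i (z - y) - s i z"]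
        by (simp add: norm_minus_commute)
    qed auto
    also have "\<dots> = (\<integral>z. norm (s i (z - y) - f (z - y)) \<partial>lborel) + (\<integral>z. norm (s i (z - y) - s i z) \<partial>lborel) + (\<integral>z. norm (s i z - f z) \<partial>lborel)"
      by simp
    also have "(\<integral>z. norm (s i (z - y) - f (z - y)) \<partial>lborel) = (\<integral>z. norm (s i z - f z) \<partial>lborel)"
      by (rule integral_lborel_translate[of "\<lambda>z. norm (s i z - f z)"]) auto
    finally show "(\<integral>z. norm (f (z - y) - f z) \<partial>lborel) \<le> \<epsilon>" using d(2)[OF y] i by linarith
  qed (use d(1) in simp)
qed

text \<open>Differentiability is left out on purpose: most convolution estimates use only mass and
  support, and \<open>mollifier_exists\<close> supplies the gradient where it is wanted.\<close>

definition mollifier :: "real \<Rightarrow> ('a::euclidean_space \<Rightarrow> real) \<Rightarrow> bool" where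
  "mollifier h \<eta> \<longleftrightarrow> continuous_on UNIV \<eta> \<and> (\<forall>z. 0 \<le> \<eta> z) \<and> (\<forall>z. h \<le> norm z \<longrightarrow> \<eta> z = 0) \<and>
     (\<forall>z. \<eta> (- z) = \<eta> z) \<and> integrable lborel \<eta> \<and> (\<integral>z. \<eta> z \<partial>lborel) = 1"

definition conv :: "('a::euclidean_space \<Rightarrow> real) \<Rightarrow> ('a \<Rightarrow> 'b::{banach, second_countable_topology}) \<Rightarrow> 'a \<Rightarrow> 'b" where
  "conv \<eta> f z = (\<integral>y. \<eta> (z - y) *\<^sub>R f y \<partial>lborel)"

lemma mollifierD:
  assumes "mollifier h \<eta>"
  shows "continuous_on UNIV \<eta>" "\<And>z. 0 \<le> \<eta> z" "\<And>z. h \<le> norm z \<Longrightarrow> \<eta> z = 0" "\<And>z. \<eta> (- z) = \<eta> z"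
    "integrable lborel \<eta>" "(\<integral>z. \<eta> z \<partial>lborel) = 1"
  using assms unfolding mollifier_def by blast+

lemma mollifier_bounded:
  assumes "mollifier h \<eta>"
  obtains M where "\<And>z. \<eta> z \<le> M" "0 \<le> M"
proof -
  have "compact (\<eta> ` cball 0 h)"
    by (intro compact_continuous_image continuous_on_subset[OF mollifierD(1)[OF assms]]) simp_all
  then obtain M where M: "\<And>x. x \<in> cball 0 h \<Longrightarrow> norm (\<eta> x) \<le> M"
    by (meson compact_imp_bounded bounded_iff imageI)
  have "\<eta> z \<le> max M 0" for z
  proof (cases "h \<le> norm z")
    case True then show ?thesis using mollifierD(3)[OF assms True] by simp
  next
    case False then show ?thesis using M[of z] by auto
  qed
  then show ?thesis using that[of "max M 0"] by auto
qed

lemma mollifier_measurable: "mollifier h \<eta> \<Longrightarrow> \<eta> \<in> borel_measurable borel"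
  by (intro borel_measurable_continuous_onI mollifierD(1))

lemma conv_integrable:
  fixes f :: "'a::euclidean_space \<Rightarrow> 'b::{banach, second_countable_topology}"
  assumes \<eta>: "mollifier h \<eta>" and f: "integrable lborel f"
  shows "integrable lborel (\<lambda>y. \<eta> (z - y) *\<^sub>R f y)"
proof -
  obtain M where M: "\<And>z. \<eta> z \<le> M" "0 \<le> M" using mollifier_bounded[OF \<eta>] by blast
  have [measurable]: "\<eta> \<in> borel_measurable borel" "f \<in> borel_measurable borel"
    using mollifier_measurable[OF \<eta>] borel_measurable_integrable[OF f] by auto
  show ?thesis
  proof (rule Bochner_Integration.integrable_bound)
    show "integrable lborel (\<lambda>y. M *\<^sub>R f y)" using f by auto
    show "AE y in lborel. norm (\<eta> (z - y) *\<^sub>R f y) \<le> norm (M *\<^sub>R f y)"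
      using M mollifierD(2)[OF \<eta>] by (intro AE_I2) (simp add: mult_right_mono)
  qed measurable
qed

lemma conv_alt:
  fixes f :: "'a::euclidean_space \<Rightarrow> 'b::{banach, second_countable_topology}"
  assumes \<eta>: "mollifier h \<eta>" and f: "f \<in> borel_measurable borel"
  shows "conv \<eta> f z = (\<integral>y. \<eta> y *\<^sub>R f (z - y) \<partial>lborel)"
proof -
  have [measurable]: "\<eta> \<in> borel_measurable borel" "f \<in> borel_measurable borel"
    using mollifier_measurable[OF \<eta>] f by auto
  show ?thesis unfolding conv_def
    by (subst integral_lborel_reflect[of "\<lambda>y. \<eta> y *\<^sub>R f (z - y)" z, symmetric]) simp_all
qed

lemma conv_measurable:
  fixes f :: "'a::euclidean_space \<Rightarrow> 'b::{banach, second_countable_topology}"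
  assumes \<eta>: "mollifier h \<eta>" and f: "f \<in> borel_measurable borel"
  shows "conv \<eta> f \<in> borel_measurable borel"
proof -
  have [measurable]: "\<eta> \<in> borel_measurable borel" "f \<in> borel_measurable borel"
    using mollifier_measurable[OF \<eta>] f by auto
  have "(\<lambda>z. \<integral>y. \<eta> (z - y) *\<^sub>R f y \<partial>lborel) \<in> borel_measurable borel"
    by (rule lborel.borel_measurable_lebesgue_integral) measurable
  then show ?thesis by (simp add: conv_def[abs_def])
qed

text \<open>The difference \<open>conv \<eta> f z - f z\<close> is the average of
  \<open>f (z - y) - f z\<close> with weight \<open>\<eta> y\<close>. Taking norms inside and
  exchanging the integrals leaves translation differences with \<open>norm y < h\<close>. Since
  \<epsilon> is arbitrary, a crude bound already gives integrability of the convolution.\<close>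

lemma conv_L1_diff:
  fixes f :: "'a::euclidean_space \<Rightarrow> 'b::{banach, second_countable_topology}"
  assumes \<eta>: "mollifier h \<eta>" and f: "integrable lborel f"
    and d: "\<And>y. norm y < h \<Longrightarrow> (\<integral>z. norm (f (z - y) - f z) \<partial>lborel) \<le> \<epsilon>" and "0 \<le> \<epsilon>"
  shows "integrable lborel (conv \<eta> f)" "(\<integral>z. norm (conv \<eta> f z - f z) \<partial>lborel) \<le> \<epsilon>"
proof -
  have [measurable]: "\<eta> \<in> borel_measurable borel" "f \<in> borel_measurable borel"
    using mollifier_measurable[OF \<eta>] borel_measurable_integrable[OF f] by auto
  have [measurable]: "conv \<eta> f \<in> borel_measurable borel" by (rule conv_measurable[OF \<eta>]) auto
  have i\<eta>: "integrable lborel \<eta>" "(\<integral>z. \<eta> z \<partial>lborel) = 1" "\<And>z. 0 \<le> \<eta> z" "\<And>z. h \<le> norm z \<Longrightarrow> \<eta> z = 0"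
    using mollifierD[OF \<eta>] by blast+
  have int2: "integrable lborel (\<lambda>y. \<eta> y *\<^sub>R f (z - y))" for z
  proof -
    have "integrable lborel (\<lambda>y. \<eta> (z - (z + (-1) *\<^sub>R y)) *\<^sub>R f (z + (-1) *\<^sub>R y))"
      by (rule integrable_lborel_affine[of "\<lambda>y. \<eta> (z - y) *\<^sub>R f y"]) (auto intro: conv_integrable[OF \<eta> f])
    then show ?thesis by simp
  qed
  have pw: "ennreal (norm (conv \<eta> f z - f z)) \<le> (\<integral>\<^sup>+y. ennreal (\<eta> y * norm (f (z - y) - f z)) \<partial>lborel)" for z
  proof -
    have "conv \<eta> f z - f z = (\<integral>y. \<eta> y *\<^sub>R f (z - y) \<partial>lborel) - (\<integral>y. \<eta> y *\<^sub>R f z \<partial>lborel)"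
      using i\<eta> by (simp add: conv_alt[OF \<eta>])
    also have "\<dots> = (\<integral>y. \<eta> y *\<^sub>R (f (z - y) - f z) \<partial>lborel)"
      using int2[of z] i\<eta> by (simp add: scaleR_diff_right)
    finally have eq: "conv \<eta> f z - f z = (\<integral>y. \<eta> y *\<^sub>R (f (z - y) - f z) \<partial>lborel)" .
    have "ennreal (norm (conv \<eta> f z - f z)) \<le> (\<integral>\<^sup>+y. norm (\<eta> y *\<^sub>R (f (z - y) - f z)) \<partial>lborel)"
      unfolding eq using int2[of z] i\<eta> by (intro integral_norm_bound_ennreal) (simp add: scaleR_diff_right)
    then show ?thesis using i\<eta> by simp
  qed
  have "(\<integral>\<^sup>+z. ennreal (norm (conv \<eta> f z - f z)) \<partial>lborel) \<le> (\<integral>\<^sup>+z. (\<integral>\<^sup>+y. ennreal (\<eta> y * norm (f (z - y) - f z)) \<partial>lborel) \<partial>lborel)"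
    by (intro nn_integral_mono pw)
  also have "\<dots> = (\<integral>\<^sup>+y. (\<integral>\<^sup>+z. ennreal (\<eta> y * norm (f (z - y) - f z)) \<partial>lborel) \<partial>lborel)"
    by (rule lborel_pair.Fubini') measurable
  also have "\<dots> \<le> (\<integral>\<^sup>+y. ennreal (\<epsilon> * \<eta> y) \<partial>lborel)"
  proof (rule nn_integral_mono)
    fix y :: 'a
    have ii: "integrable lborel (\<lambda>z. norm (f (z - y) - f z))" using f integrable_lborel_translate[OF f] by auto
    have "(\<integral>\<^sup>+z. ennreal (\<eta> y * norm (f (z - y) - f z)) \<partial>lborel) = ennreal (\<eta> y * (\<integral>z. norm (f (z - y) - f z) \<partial>lborel))"
      using ii i\<eta> by (subst nn_integral_eq_integral) auto
    also have "\<dots> \<le> ennreal (\<epsilon> * \<eta> y)"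
    proof (cases "norm y < h")
      case True then show ?thesis using mult_left_mono[OF d[OF True] i\<eta>(3)[of y]] by (intro ennreal_leI) (simp add: mult.commute)
    next
      case False then show ?thesis using i\<eta>(4)[of y] by auto
    qed
    finally show "(\<integral>\<^sup>+z. ennreal (\<eta> y * norm (f (z - y) - f z)) \<partial>lborel) \<le> ennreal (\<epsilon> * \<eta> y)" .
  qed
  also have "\<dots> = ennreal \<epsilon>" using i\<eta> \<open>0 \<le> \<epsilon>\<close> by (subst nn_integral_eq_integral) auto
  finally have fin: "(\<integral>\<^sup>+z. ennreal (norm (conv \<eta> f z - f z)) \<partial>lborel) \<le> ennreal \<epsilon>" .
  then have int: "integrable lborel (\<lambda>z. conv \<eta> f z - f z)"
    by (intro integrableI_bounded) (auto intro: le_less_trans)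
  from Bochner_Integration.integrable_add[OF this f] show "integrable lborel (conv \<eta> f)" by simp
  have "ennreal (\<integral>z. norm (conv \<eta> f z - f z) \<partial>lborel) \<le> ennreal \<epsilon>"
    using fin int by (subst (asm) nn_integral_eq_integral) auto
  then show "(\<integral>z. norm (conv \<eta> f z - f z) \<partial>lborel) \<le> \<epsilon>" using \<open>0 \<le> \<epsilon>\<close> by simp
qed

lemma conv_tendsto_L1:
  fixes f :: "'a::euclidean_space \<Rightarrow> 'b::{banach, second_countable_topology}"
  assumes \<eta>: "\<And>n. mollifier (h n) (\<eta> n)" and h: "h \<longlonglongrightarrow> 0" and f: "integrable lborel f"
  shows "(\<lambda>n. \<integral>z. norm (conv (\<eta> n) f z - f z) \<partial>lborel) \<longlonglongrightarrow> 0"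
proof (rule LIMSEQ_I)
  fix r :: real assume "0 < r"
  then obtain \<delta> where \<delta>: "\<delta> > 0" "\<And>y. norm y < \<delta> \<Longrightarrow> (\<integral>z. norm (f (z - y) - f z) \<partial>lborel) \<le> r/2"
    using L1_translation[OF f, of "r/2"] by auto
  obtain N where "\<And>n. n \<ge> N \<Longrightarrow> h n < \<delta>"
    using order_tendstoD(2)[OF h \<delta>(1)] by (auto simp: eventually_sequentially)
  then have "norm (\<integral>z. norm (conv (\<eta> n) f z - f z) \<partial>lborel) < r" if "n \<ge> N" for n
    using conv_L1_diff(2)[OF \<eta> f, of n "r/2"] \<delta>(2) \<open>0 < r\<close> that by (fastforce simp: integral_nonneg_AE)
  then show "\<exists>no. \<forall>n\<ge>no. norm ((\<integral>z. norm (conv (\<eta> n) f z - f z) \<partial>lborel) - 0) < r"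
    by (metis diff_zero)
qed

text \<open>The hypothesis of \<open>conv_L1_diff\<close> is met with the trivial bound, twice the
  integral of \<open>norm (f z)\<close>.\<close>

lemma conv_integrable':
  fixes f :: "'a::euclidean_space \<Rightarrow> 'b::{banach, second_countable_topology}"
  assumes \<eta>: "mollifier h \<eta>" and f: "integrable lborel f"
  shows "integrable lborel (conv \<eta> f)"
proof (rule conv_L1_diff(1)[OF \<eta> f])
  fix y :: 'a
  have [measurable]: "f \<in> borel_measurable borel" using borel_measurable_integrable[OF f] by auto
  note i = integrable_lborel_translate[OF f, of y]
  have "(\<integral>z. norm (f (z - y) - f z) \<partial>lborel) \<le> (\<integral>z. norm (f (z - y)) + norm (f z) \<partial>lborel)"
    using f i by (intro integral_mono) (auto intro: norm_triangle_ineq4)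
  also have "\<dots> = 2 * (\<integral>z. norm (f z) \<partial>lborel)"
    using f i integral_lborel_translate[of "\<lambda>z. norm (f z)" y] by simp
  finally show "(\<integral>z. norm (f (z - y) - f z) \<partial>lborel) \<le> 2 * (\<integral>z. norm (f z) \<partial>lborel)" .
qed simp

text \<open>Moves the mollification from the solution to the test function: testing
  \<open>conv \<eta> f\<close> means averaging over translates of \<phi>. This is how the weak
  inequality passes to mollified functions.\<close>

lemma conv_inner_swap:
  fixes f \<phi> :: "'a::euclidean_space \<Rightarrow> 'b::euclidean_space"
  assumes \<eta>: "mollifier h \<eta>" and f: "integrable lborel f"
    and \<phi>: "\<phi> \<in> borel_measurable borel" and bd: "\<And>z. norm (\<phi> z) \<le> M"
  shows "(\<integral>z. conv \<eta> f z \<bullet> \<phi> z \<partial>lborel) = (\<integral>y. \<eta> y * (\<integral>z. f z \<bullet> \<phi> (z + y) \<partial>lborel) \<partial>lborel)"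
    and "integrable lborel (\<lambda>y. \<eta> y * (\<integral>z. f z \<bullet> \<phi> (z + y) \<partial>lborel))"
proof -
  have [measurable]: "\<eta> \<in> borel_measurable borel" "f \<in> borel_measurable borel" "\<phi> \<in> borel_measurable borel"
    using mollifier_measurable[OF \<eta>] borel_measurable_integrable[OF f] \<phi> by auto
  have i\<eta>: "integrable lborel \<eta>" "(\<integral>z. \<eta> z \<partial>lborel) = 1" "\<And>z. 0 \<le> \<eta> z"
    using mollifierD[OF \<eta>] by blast+
  have M: "0 \<le> M" using bd norm_ge_zero order_trans by blast
  have int2: "integrable lborel (\<lambda>y. \<eta> y *\<^sub>R f (z - y))" for z
  proof -
    have "integrable lborel (\<lambda>y. \<eta> (z - (z + (-1) *\<^sub>R y)) *\<^sub>R f (z + (-1) *\<^sub>R y))"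
      by (rule integrable_lborel_affine[of "\<lambda>y. \<eta> (z - y) *\<^sub>R f y"]) (auto intro: conv_integrable[OF \<eta> f])
    then show ?thesis by simp
  qed
  have ip: "integrable (lborel \<Otimes>\<^sub>M lborel) (\<lambda>(y, z). \<eta> y * (f (z - y) \<bullet> \<phi> z))"
  proof (rule integrableI_bounded)
    have "(\<integral>\<^sup>+p. ennreal (norm (case p of (y, z) \<Rightarrow> \<eta> y * (f (z - y) \<bullet> \<phi> z))) \<partial>(lborel \<Otimes>\<^sub>M lborel))
       = (\<integral>\<^sup>+y. (\<integral>\<^sup>+z. ennreal (norm (\<eta> y * (f (z - y) \<bullet> \<phi> z))) \<partial>lborel) \<partial>lborel)"
      by (subst lborel.nn_integral_fst[symmetric]) auto
    also have "\<dots> \<le> (\<integral>\<^sup>+y. ennreal (\<eta> y) * ennreal ((\<integral>z. norm (f z) \<partial>lborel) * M) \<partial>lborel)"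
    proof (rule nn_integral_mono)
      fix y :: 'a
      have "(\<integral>\<^sup>+z. ennreal (norm (\<eta> y * (f (z - y) \<bullet> \<phi> z))) \<partial>lborel) \<le> (\<integral>\<^sup>+z. ennreal (\<eta> y) * (ennreal (norm (f (z - y))) * ennreal M) \<partial>lborel)"
      proof (rule nn_integral_mono)
        fix z
        have "\<bar>f (z - y) \<bullet> \<phi> z\<bar> \<le> norm (f (z - y)) * M"
          using Cauchy_Schwarz_ineq2[of "f (z - y)" "\<phi> z"] mult_left_mono[OF bd[of z], of "norm (f (z - y))"] by simp
        then show "ennreal (norm (\<eta> y * (f (z - y) \<bullet> \<phi> z))) \<le> ennreal (\<eta> y) * (ennreal (norm (f (z - y))) * ennreal M)"
          using i\<eta>(3)[of y] M by (auto simp: abs_mult simp flip: ennreal_mult intro!: ennreal_leI mult_left_mono)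
      qed
      also have "\<dots> = ennreal (\<eta> y) * ((\<integral>\<^sup>+z. ennreal (norm (f (z - y))) \<partial>lborel) * ennreal M)"
        by (simp add: nn_integral_cmult nn_integral_multc)
      also have "(\<integral>\<^sup>+z. ennreal (norm (f (z - y))) \<partial>lborel) = ennreal (\<integral>z. norm (f z) \<partial>lborel)"
        using f by (subst nn_integral_lborel_translate[of "\<lambda>z. ennreal (norm (f z))"]) (auto simp: nn_integral_eq_integral)
      finally show "(\<integral>\<^sup>+z. ennreal (norm (\<eta> y * (f (z - y) \<bullet> \<phi> z))) \<partial>lborel) \<le> ennreal (\<eta> y) * ennreal ((\<integral>z. norm (f z) \<partial>lborel) * M)"
        using M by (simp add: ennreal_mult)
    qed
    also have "\<dots> < \<infinity>"
      using i\<eta> by (simp add: nn_integral_multc nn_integral_eq_integral)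
    finally show "(\<integral>\<^sup>+p. ennreal (norm (case p of (y, z) \<Rightarrow> \<eta> y * (f (z - y) \<bullet> \<phi> z))) \<partial>(lborel \<Otimes>\<^sub>M lborel)) < \<infinity>" .
  qed auto
  have *: "(\<integral>z. \<eta> y * (f (z - y) \<bullet> \<phi> z) \<partial>lborel) = \<eta> y * (\<integral>z. f z \<bullet> \<phi> (z + y) \<partial>lborel)" for y
    using integral_lborel_translate[of "\<lambda>z. f z \<bullet> \<phi> (z + y)" y] by simp
  have "(\<integral>z. conv \<eta> f z \<bullet> \<phi> z \<partial>lborel) = (\<integral>z. (\<integral>y. \<eta> y * (f (z - y) \<bullet> \<phi> z) \<partial>lborel) \<partial>lborel)"
  proof (rule Bochner_Integration.integral_cong)
    fix z
    show "conv \<eta> f z \<bullet> \<phi> z = (\<integral>y. \<eta> y * (f (z - y) \<bullet> \<phi> z) \<partial>lborel)"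
      using int2[of z] by (simp add: conv_alt[OF \<eta>] flip: integral_inner_left)
  qed simp
  also have "\<dots> = (\<integral>y. (\<integral>z. \<eta> y * (f (z - y) \<bullet> \<phi> z) \<partial>lborel) \<partial>lborel)"
    using lborel_pair.Fubini_integral[OF ip] by (simp only: split_conv)
  finally show "(\<integral>z. conv \<eta> f z \<bullet> \<phi> z \<partial>lborel) = (\<integral>y. \<eta> y * (\<integral>z. f z \<bullet> \<phi> (z + y) \<partial>lborel) \<partial>lborel)"
    unfolding * .
  show "integrable lborel (\<lambda>y. \<eta> y * (\<integral>z. f z \<bullet> \<phi> (z + y) \<partial>lborel))"
    using lborel_pair.integrable_fst'[OF ip] unfolding split_conv * .
qed

section \<open>Continuously differentiable functions\<close>

text \<open>The regularity half of \<open>test_function\<close>, separated from the support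
  condition so that mollified solutions, cut-offs and compositions share one calculus.\<close>

definition C1_fun :: "('a::real_normed_vector \<Rightarrow> real) \<Rightarrow> bool" where
  "C1_fun f \<longleftrightarrow> (\<forall>z. f differentiable at z) \<and> (\<forall>h. continuous_on UNIV (\<lambda>z. frechet_derivative f (at z) h))"

abbreviation FD :: "('a::real_normed_vector \<Rightarrow> real) \<Rightarrow> 'a \<Rightarrow> 'a \<Rightarrow> real" where
  "FD f z \<equiv> frechet_derivative f (at z)"

lemma C1_funD:
  assumes "C1_fun f"
  shows "(f has_derivative FD f z) (at z)" "continuous_on UNIV (\<lambda>z. FD f z h)"
  using assms by (auto simp: C1_fun_def frechet_derivative_works)

lemma C1_funI:
  assumes "\<And>z. (f has_derivative f' z) (at z)" "\<And>h. continuous_on UNIV (\<lambda>z. f' z h)"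
  shows "C1_fun f" "FD f z = f' z"
proof -
  show *: "FD f z = f' z" for z using frechet_derivative_at[OF assms(1)] by simp
  show "C1_fun f" using assms unfolding C1_fun_def * by (auto simp: differentiable_def)
qed

lemma C1_fun_continuous: "C1_fun f \<Longrightarrow> continuous_on UNIV f"
  by (meson C1_funD(1) continuous_at_imp_continuous_on has_derivative_continuous)

lemma C1_fun_mult:
  assumes "C1_fun f" "C1_fun g"
  shows "C1_fun (\<lambda>z. f z * g z)" "FD (\<lambda>z. f z * g z) z h = f z * FD g z h + FD f z h * g z"
proof -
  have d: "((\<lambda>z. f z * g z) has_derivative (\<lambda>h. f z * FD g z h + FD f z h * g z)) (at z)" for z
    by (intro has_derivative_mult C1_funD assms)
  have c: "continuous_on UNIV (\<lambda>z. f z * FD g z h + FD f z h * g z)" for h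
    by (intro continuous_intros C1_funD assms C1_fun_continuous)
  show "C1_fun (\<lambda>z. f z * g z)" by (rule C1_funI(1)[OF d c])
  show "FD (\<lambda>z. f z * g z) z h = f z * FD g z h + FD f z h * g z" unfolding C1_funI(2)[OF d c] ..
qed

lemma C1_fun_add:
  assumes "C1_fun f" "C1_fun g"
  shows "C1_fun (\<lambda>z. f z + g z)" "FD (\<lambda>z. f z + g z) z h = FD f z h + FD g z h"
proof -
  have d: "((\<lambda>z. f z + g z) has_derivative (\<lambda>h. FD f z h + FD g z h)) (at z)" for z
    by (intro has_derivative_add C1_funD assms)
  have c: "continuous_on UNIV (\<lambda>z. FD f z h + FD g z h)" for h
    by (intro continuous_intros C1_funD assms)
  show "C1_fun (\<lambda>z. f z + g z)" by (rule C1_funI(1)[OF d c])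
  show "FD (\<lambda>z. f z + g z) z h = FD f z h + FD g z h" unfolding C1_funI(2)[OF d c] ..
qed

lemma C1_fun_chain:
  assumes f: "C1_fun f" and F: "\<And>z. (F has_real_derivative F' (f z)) (at (f z))"
    and cF: "continuous_on UNIV (\<lambda>z. F' (f z))"
  shows "C1_fun (\<lambda>z. F (f z))" "FD (\<lambda>z. F (f z)) z h = F' (f z) * FD f z h"
proof -
  have d: "((\<lambda>z. F (f z)) has_derivative (\<lambda>h. F' (f z) * FD f z h)) (at z)" for z
    using has_derivative_compose[OF C1_funD(1)[OF f] F[unfolded has_field_derivative_def]] by simp
  have c: "continuous_on UNIV (\<lambda>z. F' (f z) * FD f z h)" for h
    by (intro continuous_intros C1_funD f cF)
  show "C1_fun (\<lambda>z. F (f z))" by (rule C1_funI(1)[OF d c])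
  show "FD (\<lambda>z. F (f z)) z h = F' (f z) * FD f z h" unfolding C1_funI(2)[OF d c] ..
qed

lemma C1_fun_linear:
  assumes f: "C1_fun f" and L: "bounded_linear L"
  shows "C1_fun (\<lambda>z. f (L z + c))" "FD (\<lambda>z. f (L z + c)) z h = FD f (L z + c) (L h)"
proof -
  interpret L: bounded_linear L by fact
  have dL: "((\<lambda>z. L z + c) has_derivative L) (at z)" for z
    by (rule has_derivative_add_const) (rule L.has_derivative, rule has_derivative_ident)
  have d: "((\<lambda>z. f (L z + c)) has_derivative (\<lambda>h. FD f (L z + c) (L h))) (at z)" for z
    using has_derivative_compose[OF dL C1_funD(1)[OF f]] by simp
  have cL: "continuous_on UNIV (\<lambda>z. L z + c)"
    by (intro continuous_intros L.continuous_on)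
  have c: "continuous_on UNIV (\<lambda>z. FD f (L z + c) (L h))" for h
    by (rule continuous_on_compose2[OF C1_funD(2)[OF f] cL]) auto
  show "C1_fun (\<lambda>z. f (L z + c))" by (rule C1_funI(1)[OF d c])
  show "FD (\<lambda>z. f (L z + c)) z h = FD f (L z + c) (L h)" unfolding C1_funI(2)[OF d c] ..
qed

lemma frechet_derivative_zero_outside:
  assumes "z \<notin> closure {z. \<phi> z \<noteq> (0::real)}"
  shows "FD \<phi> z = (\<lambda>_. 0)"
proof -
  have "((\<lambda>_. 0) has_derivative (\<lambda>_. 0)) (at z)" by simp
  then have "(\<phi> has_derivative (\<lambda>_. 0)) (at z)"
  proof (rule has_derivative_transform_within_open)
    show "open (- closure {z. \<phi> z \<noteq> 0})" by auto
    show "\<And>x. x \<in> - closure {z. \<phi> z \<noteq> 0} \<Longrightarrow> 0 = \<phi> x"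
      using closure_subset[of "{z. \<phi> z \<noteq> 0}"] by auto
  qed (use assms in auto)
  then show ?thesis using frechet_derivative_at by metis
qed

text \<open>Building block of the mollifier and of both cut-offs. Test functions need only one
  continuous derivative, so squared positive parts can replace smooth bump functions.\<close>

lemma pos_square_deriv: "((\<lambda>r::real. (max 0 r)\<^sup>2) has_real_derivative 2 * max 0 r) (at r)"
proof -
  consider "r < 0" | "r = 0" | "r > 0" by linarith
  then show ?thesis
  proof cases
    case 1
    have "((\<lambda>r::real. 0) has_real_derivative 0) (at r)" by simp
    then have "((\<lambda>r::real. (max 0 r)\<^sup>2) has_real_derivative 0) (at r)"
      by (rule has_field_derivative_transform_within_open[of _ _ _ "{..<0}"]) (use 1 in auto)
    then show ?thesis using 1 by simp
  next
    case 2
    have "((\<lambda>h::real. (max 0 h)\<^sup>2 / h) \<longlongrightarrow> 0) (at 0)"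
    proof (rule Lim_null_comparison)
      have *: "norm ((max 0 h)\<^sup>2 / h) \<le> \<bar>h\<bar>" for h :: real
        by (cases "h \<ge> 0") (auto simp: power2_eq_square)
      show "\<forall>\<^sub>F h in at 0. norm ((max 0 h)\<^sup>2 / h) \<le> \<bar>h::real\<bar>"
        using * by (intro always_eventually allI)
      show "((\<lambda>h::real. \<bar>h\<bar>) \<longlongrightarrow> 0) (at 0)"
        by (rule tendsto_rabs_zero) (rule tendsto_ident_at)
    qed
    then show ?thesis using 2 by (simp add: DERIV_def)
  next
    case 3
    have "((\<lambda>r::real. r\<^sup>2) has_real_derivative 2 * r) (at r)" by (auto intro!: derivative_eq_intros)
    then have "((\<lambda>r::real. (max 0 r)\<^sup>2) has_real_derivative 2 * r) (at r)"
      by (rule has_field_derivative_transform_within_open[of _ _ _ "{0<..}"]) (use 3 in auto)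
    then show ?thesis using 3 by simp
  qed
qed

lemma integrable_continuous_compact_support:
  fixes f :: "'a::euclidean_space \<Rightarrow> 'b::{banach, second_countable_topology}"
  assumes "continuous_on UNIV f" "compact K" "\<And>z. z \<notin> K \<Longrightarrow> f z = 0"
  shows "integrable lborel f"
proof -
  have "integrable lborel (\<lambda>x. indicator K x *\<^sub>R f x)"
    by (rule borel_integrable_compact[OF assms(2)]) (rule continuous_on_subset[OF assms(1)], simp)
  moreover have "(\<lambda>x. indicator K x *\<^sub>R f x) = f" using assms(3) by (auto simp: indicator_def)
  ultimately show ?thesis by simp
qed

lemma mollifier_exists:
  assumes h: "0 < h"
  obtains \<eta> :: "'a::euclidean_space \<Rightarrow> real" and \<eta>' where "mollifier h \<eta>"
    "\<And>z. (\<eta> has_derivative (\<lambda>v. \<eta>' z \<bullet> v)) (at z)" "continuous_on UNIV \<eta>'"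
proof -
  \<comment> \<open>The square makes the bump differentiable across the sphere of radius
    \<open>h\<close>, with gradient \<open>- 4 * max 0 (h\<^sup>2 - z \<bullet> z)\<close> times
    \<open>z\<close>.\<close>
  define b where "b z = (max 0 (h\<^sup>2 - z \<bullet> z))\<^sup>2" for z :: 'a
  define I where "I = (\<integral>z. b z \<partial>lborel)"
  have cb: "continuous_on UNIV b" unfolding b_def by (intro continuous_intros)
  have b0: "b z = 0" if "h \<le> norm z" for z
  proof -
    have "h\<^sup>2 \<le> z \<bullet> z" using that h by (simp add: dot_square_norm power_mono)
    then show ?thesis by (simp add: b_def)
  qed
  have ib: "integrable lborel b"
    by (rule integrable_continuous_compact_support[OF cb compact_cball[of 0 h]]) (use b0 in auto)
  have I: "I > 0"
  proof -
    \<comment> \<open>A lower bound for the bump on the ball of half the radius, which makes the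
      normalising integral positive.\<close>
    let ?c = "(h\<^sup>2 / 2)\<^sup>2"
    have low: "?c * indicator (ball 0 (h/2)) z \<le> b z" for z
    proof (cases "z \<in> ball 0 (h/2)")
      case True
      then have "(norm z)\<^sup>2 \<le> (h/2)\<^sup>2" by (intro power_mono) auto
      then have "4 * (norm z)\<^sup>2 \<le> h\<^sup>2" by (simp add: power_divide)
      moreover have "0 \<le> (norm z)\<^sup>2" by simp
      ultimately have "h\<^sup>2/2 \<le> h\<^sup>2 - z \<bullet> z" unfolding dot_square_norm by linarith
      then have "h\<^sup>2/2 \<le> max 0 (h\<^sup>2 - z \<bullet> z)" by linarith
      then have "(h\<^sup>2/2)\<^sup>2 \<le> b z" unfolding b_def by (intro power_mono) auto
      then show ?thesis using True by simp
    qed (auto simp: b_def)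
    have "0 < ?c * measure lborel (ball (0::'a) (h/2))"
      using h content_ball_pos[of "h/2" "0::'a"] by simp
    also have "\<dots> = (\<integral>z. ?c * indicator (ball (0::'a) (h/2)) z \<partial>lborel)" by simp
    also have "\<dots> \<le> I" unfolding I_def
      by (rule integral_mono[OF _ ib low]) (intro integrable_mult_right integrable_real_indicator;
          use emeasure_lborel_ball_finite in \<open>simp add: less_top\<close>)
    finally show ?thesis .
  qed
  define \<eta> where "\<eta> z = b z / I" for z
  define \<eta>' where "\<eta>' z = (- (4 * max 0 (h\<^sup>2 - z \<bullet> z)) / I) *\<^sub>R z" for z :: 'a
  show ?thesis
  proof (rule that)
    show "mollifier h \<eta>" unfolding mollifier_def
    proof (intro conjI allI impI)
      show "continuous_on UNIV \<eta>" unfolding \<eta>_def using I by (intro continuous_intros cb) auto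
      show "0 \<le> \<eta> z" for z using I by (simp add: \<eta>_def b_def)
      show "\<eta> z = 0" if "h \<le> norm z" for z using b0[OF that] by (simp add: \<eta>_def)
      show "\<eta> (- z) = \<eta> z" for z by (simp add: \<eta>_def b_def)
      show "integrable lborel \<eta>" using ib by (simp add: \<eta>_def[abs_def])
      show "(\<integral>z. \<eta> z \<partial>lborel) = 1" using I by (simp add: \<eta>_def[abs_def] I_def)
    qed
    show "continuous_on UNIV \<eta>'" unfolding \<eta>'_def using I by (intro continuous_intros) auto
    fix z :: 'a
    have "((\<lambda>z::'a. h\<^sup>2 - z \<bullet> z) has_derivative (\<lambda>v. - (2 * (z \<bullet> v)))) (at z)"
      by (auto intro!: derivative_eq_intros simp: inner_commute)
    from has_derivative_compose[OF this pos_square_deriv[unfolded has_field_derivative_def]]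
    have "(b has_derivative (\<lambda>v. 2 * max 0 (h\<^sup>2 - z \<bullet> z) * (- (2 * (z \<bullet> v))))) (at z)"
      by (simp add: b_def[abs_def])
    then have "((\<lambda>z. b z * inverse I) has_derivative (\<lambda>v. (2 * max 0 (h\<^sup>2 - z \<bullet> z) * (- (2 * (z \<bullet> v)))) * inverse I)) (at z)"
      by (rule has_derivative_mult_left)
    then show "(\<eta> has_derivative (\<lambda>v. \<eta>' z \<bullet> v)) (at z)"
      by (simp add: \<eta>_def[abs_def] \<eta>'_def divide_inverse mult_ac)
  qed
qed

text \<open>All derivatives fall on \<eta>, so continuity of \<open>u\<close> on the box suffices
  and the jump of the extension by zero at the boundary does no harm.\<close>

lemma conv_C1:
  fixes u :: "'a::euclidean_space \<Rightarrow> real"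
  assumes \<eta>: "mollifier h \<eta>" and d: "\<And>z. (\<eta> has_derivative (\<lambda>v. \<eta>' z \<bullet> v)) (at z)"
    and c: "continuous_on UNIV \<eta>'" and u: "continuous_on (cbox a b) u"
  defines "ubar \<equiv> \<lambda>z. indicator (cbox a b) z * u z"
  shows "C1_fun (conv \<eta> ubar)" "FD (conv \<eta> ubar) z v = (\<integral>y. ubar y * (\<eta>' (z - y) \<bullet> v) \<partial>lborel)"
proof -
  have set_int: "integral (cbox a b) f = (\<integral>y. indicator (cbox a b) y *\<^sub>R f y \<partial>lborel)"
    if "continuous_on (cbox a b) f" for f :: "'a \<Rightarrow> real"
  proof -
    have "set_integrable lborel (cbox a b) f"
      using borel_integrable_compact[OF compact_cbox that] by (simp add: set_integrable_def)
    from set_borel_integral_eq_integral(2)[OF this] show ?thesis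
      by (simp add: set_lebesgue_integral_def)
  qed
  have c\<eta>: "continuous_on S (\<lambda>z. \<eta> (f z))" if "continuous_on S f" for S :: "'c::topological_space set" and f
    by (rule continuous_on_compose2[OF mollifierD(1)[OF \<eta>] that]) auto
  have c\<eta>': "continuous_on S (\<lambda>z. \<eta>' (f z))" if "continuous_on S f" for S :: "'c::topological_space set" and f
    by (rule continuous_on_compose2[OF c that]) auto
  have eq: "conv \<eta> ubar = (\<lambda>z. integral (cbox a b) (\<lambda>y. \<eta> (z - y) * u y))"
  proof
    fix z
    have "continuous_on (cbox a b) (\<lambda>y. \<eta> (z - y) * u y)"
      by (intro continuous_intros c\<eta> u)
    from set_int[OF this] show "conv \<eta> ubar z = integral (cbox a b) (\<lambda>y. \<eta> (z - y) * u y)"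
      by (simp add: conv_def ubar_def mult.left_commute)
  qed
  have cu2: "continuous_on (UNIV \<times> cbox a b) (\<lambda>p::'a \<times> 'a. u (snd p))"
    by (rule continuous_on_compose2[OF u]) (auto intro: continuous_intros)
  have cD: "continuous_on (UNIV \<times> cbox a b) (\<lambda>(z, y). u y *\<^sub>R \<eta>' (z - y))"
    unfolding split_beta by (intro continuous_intros cu2 c\<eta>')
  \<comment> \<open>Leibniz's rule asks for the derivative as a bounded linear map depending
    continuously on both variables; \<open>B z y\<close> is the inner product with the gradient of
    the integrand.\<close>
  define B where "B z y = (blinfun_inner_right (u y *\<^sub>R \<eta>' (z - y)) :: 'a \<Rightarrow>\<^sub>L real)" for z y
  have cB: "continuous_on (UNIV \<times> cbox a b) (\<lambda>(z, y). B z y)"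
    using bounded_linear.continuous_on[OF bounded_linear_blinfun_inner_right cD]
    by (simp add: B_def split_beta)
  have der: "((\<lambda>z. integral (cbox a b) (\<lambda>y. \<eta> (z - y) * u y)) has_derivative blinfun_apply (integral (cbox a b) (B z))) (at z within UNIV)" for z
  proof (rule leibniz_rule[OF _ _ cB])
    fix z y assume "y \<in> cbox a b"
    have "((\<lambda>z. \<eta> (z - y)) has_derivative (\<lambda>v. \<eta>' (z - y) \<bullet> v)) (at z)"
    proof -
      have "((\<lambda>z. z - y) has_derivative (\<lambda>v. v)) (at z)" by (auto intro!: derivative_eq_intros)
      from has_derivative_compose[OF this d] show ?thesis .
    qed
    then have "((\<lambda>z. \<eta> (z - y) * u y) has_derivative (\<lambda>v. (\<eta>' (z - y) \<bullet> v) * u y)) (at z)"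
      by (rule has_derivative_mult_left)
    moreover have "blinfun_apply (B z y) = (\<lambda>v. (\<eta>' (z - y) \<bullet> v) * u y)" by (auto simp: B_def)
    ultimately show "((\<lambda>z. \<eta> (z - y) * u y) has_derivative blinfun_apply (B z y)) (at z within UNIV)"
      by simp
  next
    fix z show "(\<lambda>y. \<eta> (z - y) * u y) integrable_on cbox a b"
      by (intro integrable_continuous continuous_intros c\<eta> u)
  qed auto
  have app: "blinfun_apply (integral (cbox a b) (B z)) v = (\<integral>y. ubar y * (\<eta>' (z - y) \<bullet> v) \<partial>lborel)" for z v
  proof -
    have cBz: "continuous_on (cbox a b) (B z)"
      unfolding B_def by (intro bounded_linear.continuous_on[OF bounded_linear_blinfun_inner_right] continuous_intros u c\<eta>')
    have "blinfun_apply (integral (cbox a b) (B z)) v = integral (cbox a b) (\<lambda>y. B z y v)"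
      by (rule blinfun_apply_integral) (rule integrable_continuous[OF cBz])
    also have "\<dots> = integral (cbox a b) (\<lambda>y. u y * (\<eta>' (z - y) \<bullet> v))" by (simp add: B_def)
    also have "\<dots> = (\<integral>y. indicator (cbox a b) y *\<^sub>R (u y * (\<eta>' (z - y) \<bullet> v)) \<partial>lborel)"
      by (intro set_int continuous_intros u c\<eta>')
    finally show ?thesis by (simp add: ubar_def mult.assoc)
  qed
  have "continuous_on UNIV (\<lambda>z. integral (cbox a b) (B z))"
    by (rule integral_continuous_on_param[OF cB])
  then have cc: "continuous_on UNIV (\<lambda>z. blinfun_apply (integral (cbox a b) (B z)) h)" for h
    by (intro continuous_intros)
  have der': "((\<lambda>z. integral (cbox a b) (\<lambda>y. \<eta> (z - y) * u y)) has_derivative blinfun_apply (integral (cbox a b) (B z))) (at z)" for z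
    using der by simp
  show "C1_fun (conv \<eta> ubar)" unfolding eq by (rule C1_funI(1)[OF der' cc])
  show "FD (conv \<eta> ubar) z v = (\<integral>y. ubar y * (\<eta>' (z - y) \<bullet> v) \<partial>lborel)"
    unfolding eq app[symmetric] C1_funI(2)[OF der' cc] ..
qed

section \<open>Weak supersolutions on boxes\<close>

text \<open>Each coordinate can be altered on a null set to become Borel. Borel versions are wanted
  because all exchanges of integrals take place on products of \<open>lborel\<close>.\<close>

lemma ex_borel_representative:
  fixes f :: "'a::euclidean_space \<Rightarrow> 'b::euclidean_space"
  assumes "f \<in> borel_measurable lebesgue"
  obtains f' where "f' \<in> borel_measurable borel" "AE x in lborel. f x = f' x"
proof -
  have "\<exists>F. F \<in> borel_measurable borel \<and> (AE x in lborel. f x \<bullet> b = F x)" for b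
    using completion_ex_borel_measurable_real[of "\<lambda>x. f x \<bullet> b" lborel] assms by auto
  then obtain F where F: "\<And>b. F b \<in> borel_measurable borel" "\<And>b. AE x in lborel. f x \<bullet> b = F b x"
    by metis
  show ?thesis
  proof
    show "(\<lambda>x. \<Sum>b\<in>Basis. F b x *\<^sub>R b) \<in> borel_measurable borel"
      using F(1) by (intro borel_measurable_sum borel_measurable_scaleR) auto
    have "AE x in lborel. \<forall>b\<in>(Basis::'b set). f x \<bullet> b = F b x"
      using F(2) by (intro AE_finite_allI) auto
    then show "AE x in lborel. f x = (\<Sum>b\<in>Basis. F b x *\<^sub>R b)"
    proof eventually_elim
      case (elim x)
      then show ?case using euclidean_representation[of "f x"] by (metis (no_types, lifting) sum.cong)
    qed
  qed
qed

lemma integral_lebesgue_eq_lborel: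
  fixes f f' :: "'a::euclidean_space \<Rightarrow> 'b::{banach, second_countable_topology}"
  assumes "AE z in lborel. f z = f' z" "f \<in> borel_measurable lebesgue" "f' \<in> borel_measurable borel"
  shows "(\<integral>z. f z \<partial>lebesgue) = (\<integral>z. f' z \<partial>lborel)"
proof -
  have "(\<integral>z. f z \<partial>lebesgue) = (\<integral>z. f' z \<partial>lebesgue)"
    using assms by (intro integral_cong_AE AE_completion) (auto intro: measurable_completion)
  also have "\<dots> = (\<integral>z. f' z \<partial>lborel)" using assms(3) by (intro integral_completion) simp
  finally show ?thesis .
qed

lemma C1_fun_space_grad_continuous:
  "C1_fun \<phi> \<Longrightarrow> continuous_on UNIV (space_grad \<phi>)"
  unfolding space_grad_def[abs_def] by (intro continuous_intros C1_funD)

lemma C1_fun_time_deriv_continuous: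
  "C1_fun \<phi> \<Longrightarrow> continuous_on UNIV (time_deriv \<phi>)"
  unfolding time_deriv_def[abs_def] by (intro C1_funD)

lemma test_function_cbox:
  assumes "C1_fun \<phi>" "closure {z. \<phi> z \<noteq> 0} \<subseteq> cbox a b" "cbox a b \<subseteq> \<Omega>"
  shows "test_function \<Omega> \<phi>"
proof -
  have "bounded (closure {z. \<phi> z \<noteq> 0})" using bounded_subset[OF bounded_cbox assms(2)] .
  then have "compact (closure {z. \<phi> z \<noteq> 0})" by (simp add: compact_eq_bounded_closed)
  then show ?thesis using assms unfolding test_function_def C1_fun_def by auto
qed

context growth
begin

lemma G_norm_continuous: "continuous_on UNIV (\<lambda>x::'v::real_normed_vector. G (norm x))"
  by (rule continuous_on_compose2[OF G_cont]) (auto intro: continuous_intros)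

lemma g_norm_continuous: "continuous_on UNIV (\<lambda>x::'v::real_normed_vector. g (norm x))"
  by (rule continuous_on_compose2[OF g_cont]) (auto intro: continuous_intros)

lemma g_le_G: "0 \<le> s \<Longrightarrow> g s \<le> g 1 + Q * G s"
proof (cases "s \<le> 1")
  case True
  assume "0 \<le> s"
  then show ?thesis using True g_mono[of s 1] G_nonneg[of s] by (simp add: add_increasing2)
next
  case False
  then have "g s \<le> s * g s" using g_nonneg[of s] mult_right_mono[of 1 s "g s"] by simp
  then show ?thesis using mult_g_le[of s] g_nonneg[of 1] False by simp
qed

text \<open>Freezes the nonlinearity: on a box the field along the solution becomes a fixed Borel
  field \<open>F\<close>, paired with a Borel version \<open>D\<close> of the weak gradient. From
  here on neither \<open>A\<close> nor the representative of the gradient matters.\<close>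

lemma weak_supersolution_borel:
  fixes A :: "'n::finite vector_field" and u :: "(real ^ 'n) \<times> real \<Rightarrow> real"
  assumes struct: "structure_conditions C0 C1 g A" and C1: "0 < C1"
    and ws: "weak_supersolution g A \<Omega> u" and B: "cbox a b \<subseteq> \<Omega>"
  obtains D F :: "(real ^ 'n) \<times> real \<Rightarrow> real ^ 'n" where
    "integrable lborel D" "integrable lborel F" "integrable lborel (\<lambda>z. G (norm (D z)))"
    "\<And>z. C0 * G (norm (D z)) \<le> F z \<bullet> D z" "\<And>z. norm (F z) \<le> C1 * g (norm (D z))"
    "\<And>z. z \<notin> cbox a b \<Longrightarrow> D z = 0 \<and> F z = 0"
    "\<And>\<phi>. C1_fun \<phi> \<Longrightarrow> closure {z. \<phi> z \<noteq> 0} \<subseteq> cbox a b \<Longrightarrow>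
        (\<integral>z. (indicator (cbox a b) z * u z) *\<^sub>R space_grad \<phi> z \<partial>lborel) = - (\<integral>z. \<phi> z *\<^sub>R D z \<partial>lborel)"
    "\<And>\<phi>. C1_fun \<phi> \<Longrightarrow> closure {z. \<phi> z \<noteq> 0} \<subseteq> cbox a b \<Longrightarrow> (\<And>z. 0 \<le> \<phi> z) \<Longrightarrow>
        0 \<le> - (\<integral>z. (indicator (cbox a b) z * u z) * time_deriv \<phi> z \<partial>lborel) + (\<integral>z. F z \<bullet> space_grad \<phi> z \<partial>lborel)"
proof -
  let ?B = "cbox a b" and ?i = "indicator (cbox a b) :: _ \<Rightarrow> real"
  from ws obtain Du where Du: "weak_space_grad \<Omega> u Du" "set_integrable lebesgue \<Omega> (\<lambda>z. G (norm (Du z)))"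
     and mA: "set_borel_measurable lebesgue \<Omega> (\<lambda>z. A (fst z) (snd z) (u z) (Du z))"
     and ineq: "\<And>\<phi>. test_function \<Omega> \<phi> \<Longrightarrow> (\<And>z. 0 \<le> \<phi> z) \<Longrightarrow>
           - (LINT z:\<Omega>|lebesgue. u z * time_deriv \<phi> z)
           + (LINT z:\<Omega>|lebesgue. A (fst z) (snd z) (u z) (Du z) \<bullet> space_grad \<phi> z) \<ge> 0"
     and cu: "continuous_on \<Omega> u"
    unfolding weak_supersolution_def by blast
  define A' where "A' z = A (fst z) (snd z) (u z) (Du z)" for z
  have Bm: "?B \<in> sets lebesgue" "?B \<in> sets borel" by auto
  have iD: "integrable lebesgue (\<lambda>z. ?i z *\<^sub>R Du z)"
    using Du(1) B unfolding weak_space_grad_def set_integrable_def by auto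
  have mD: "(\<lambda>z. ?i z *\<^sub>R Du z) \<in> borel_measurable lebesgue" using borel_measurable_integrable[OF iD] .
  have mF: "(\<lambda>z. ?i z *\<^sub>R A' z) \<in> borel_measurable lebesgue"
  proof -
    have "(\<lambda>z. ?i z *\<^sub>R (indicator \<Omega> z *\<^sub>R A' z)) \<in> borel_measurable lebesgue"
      using mA unfolding set_borel_measurable_def A'_def
      by (rule borel_measurable_scaleR[OF borel_measurable_indicator[OF Bm(1)]])
    moreover have "(\<lambda>z. ?i z *\<^sub>R (indicator \<Omega> z *\<^sub>R A' z)) = (\<lambda>z. ?i z *\<^sub>R A' z)"
      using B by (auto simp: indicator_def fun_eq_iff)
    ultimately show ?thesis by simp
  qed
  obtain D0 where D0: "D0 \<in> borel_measurable borel" "AE z in lborel. ?i z *\<^sub>R Du z = D0 z"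
    using ex_borel_representative[OF mD] .
  obtain F0 where F0: "F0 \<in> borel_measurable borel" "AE z in lborel. ?i z *\<^sub>R A' z = F0 z"
    using ex_borel_representative[OF mF] .
  have "AE z in lborel. ?i z *\<^sub>R Du z = D0 z \<and> ?i z *\<^sub>R A' z = F0 z" using D0(2) F0(2) by eventually_elim simp
  then obtain N where N: "N \<in> null_sets lborel" "{z \<in> space lborel. \<not> (?i z *\<^sub>R Du z = D0 z \<and> ?i z *\<^sub>R A' z = F0 z)} \<subseteq> N"
    unfolding eventually_ae_filter by blast
  \<comment> \<open>Dropping the exceptional null set changes no integral, and at the discarded
    points \<open>D = F = 0\<close> satisfies the structure conditions because
    \<open>G 0 = 0\<close> and \<open>0 \<le> g 0\<close>. They thus hold at every point.\<close>
  define S where "S = ?B - N"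
  have Sm[measurable]: "S \<in> sets borel" unfolding S_def using N(1) Bm by (auto intro: sets.Diff simp: null_sets_def)
  define D where "D z = indicator S z *\<^sub>R D0 z" for z
  define F where "F z = indicator S z *\<^sub>R F0 z" for z
  have inS: "D z = Du z" "F z = A' z" if "z \<in> S" for z
  proof -
    have "z \<in> ?B" "z \<notin> N" using that by (auto simp: S_def)
    then have "?i z *\<^sub>R Du z = D0 z \<and> ?i z *\<^sub>R A' z = F0 z" using N(2)[unfolded space_lborel space_borel] by blast
    then show "D z = Du z" "F z = A' z" using that \<open>z \<in> ?B\<close> by (auto simp: D_def F_def)
  qed
  have outS: "D z = 0" "F z = 0" if "z \<notin> S" for z using that by (auto simp: D_def F_def)
  have mDF[measurable]: "D \<in> borel_measurable borel" "F \<in> borel_measurable borel"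
    unfolding D_def F_def using D0(1) F0(1) by measurable
  have "AE z in lborel. z \<notin> N" using N(1) by (rule AE_not_in)
  then have AED: "AE z in lborel. ?i z *\<^sub>R Du z = D z" and AEF: "AE z in lborel. ?i z *\<^sub>R A' z = F z"
    using inS outS by (auto elim!: eventually_mono simp: S_def indicator_def)
  have C: "C0 * G (norm (D z)) \<le> F z \<bullet> D z" "norm (F z) \<le> C1 * g (norm (D z))" for z
  proof -
    have "C0 * G (norm (D z)) \<le> F z \<bullet> D z \<and> norm (F z) \<le> C1 * g (norm (D z))"
    proof (cases "z \<in> S")
      case True
      then show ?thesis using struct inS[OF True] unfolding structure_conditions_def A'_def by simp
    next
      case False
      then show ?thesis using outS[OF False] C1 g_nonneg[of 0] by simp
    qed
    then show "C0 * G (norm (D z)) \<le> F z \<bullet> D z" "norm (F z) \<le> C1 * g (norm (D z))" by auto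
  qed
  have out: "z \<notin> ?B \<Longrightarrow> D z = 0 \<and> F z = 0" for z using outS[of z] by (auto simp: S_def)
  have intD: "integrable lborel D"
  proof -
    have "integrable lebesgue D"
      by (rule integrable_cong_AE_imp[OF iD]) (auto intro!: measurable_completion AE_completion eventually_mono[OF AED])
    then show ?thesis by (simp add: integrable_completion)
  qed
  have intG: "integrable lborel (\<lambda>z. G (norm (D z)))"
  proof -
    have mG[measurable]: "(\<lambda>z. G (norm (D z))) \<in> borel_measurable borel"
      by (rule borel_measurable_continuous_on[OF G_norm_continuous]) simp
    have "integrable lebesgue (\<lambda>z. ?i z *\<^sub>R (indicator \<Omega> z *\<^sub>R G (norm (Du z))))"
      using Du(2) unfolding set_integrable_def by (rule integrable_mult_indicator[OF Bm(1)])
    then have 1: "integrable lebesgue (\<lambda>z. ?i z *\<^sub>R G (norm (Du z)))"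
      by (rule Bochner_Integration.integrable_cong[THEN iffD1, rotated -1]) (use B in \<open>auto simp: indicator_def\<close>)
    have "integrable lebesgue (\<lambda>z. G (norm (D z)))"
    proof (rule integrable_cong_AE_imp[OF 1])
      show "(\<lambda>z. G (norm (D z))) \<in> borel_measurable lebesgue" by (rule measurable_completion) simp
      have "AE z in lborel. ?i z *\<^sub>R G (norm (Du z)) = G (norm (D z))"
        using AED by eventually_elim (auto simp: indicator_def split: if_splits)
      then show "AE z in lebesgue. ?i z *\<^sub>R G (norm (Du z)) = G (norm (D z))" by (rule AE_completion)
    qed
    then show ?thesis using mG by (subst (asm) integrable_completion) auto
  qed
  \<comment> \<open>Only \<open>G (norm (D z))\<close> is known to be integrable;
    \<open>g s \<le> g 1 + Q * G s\<close> and the finite measure of the box give the rest.\<close>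
  have intF: "integrable lborel F"
  proof (rule Bochner_Integration.integrable_bound)
    show "integrable lborel (\<lambda>z. C1 * (g 1 * ?i z + Q * G (norm (D z))))"
      by (intro integrable_mult_right Bochner_Integration.integrable_add integrable_real_indicator intG)
        (use emeasure_lborel_cbox_finite in \<open>auto simp: less_top\<close>)
    show "AE z in lborel. norm (F z) \<le> norm (C1 * (g 1 * ?i z + Q * G (norm (D z))))"
    proof (rule AE_I2)
      fix z
      have "norm (F z) \<le> C1 * (g 1 * ?i z + Q * G (norm (D z)))"
      proof (cases "z \<in> ?B")
        case True
        have "norm (F z) \<le> C1 * (g 1 + Q * G (norm (D z)))"
          by (rule order_trans[OF C(2)]) (use C1 in \<open>intro mult_left_mono g_le_G; simp\<close>)
        then show ?thesis using True by simp
      next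
        case False then show ?thesis using out[of z] C1 by simp
      qed
      then show "norm (F z) \<le> norm (C1 * (g 1 * ?i z + Q * G (norm (D z))))" by simp
    qed
  qed simp
  have mu: "(\<lambda>z. ?i z * u z) \<in> borel_measurable borel"
    using borel_measurable_continuous_on_indicator[of ?B u] continuous_on_subset[OF cu B] by simp
  have zero: "FD \<phi> z = (\<lambda>_. 0)" "\<phi> z = 0" if "closure {z. \<phi> z \<noteq> 0} \<subseteq> ?B" "z \<notin> ?B" for \<phi> :: "(real ^ 'n) \<times> real \<Rightarrow> real" and z
  proof -
    have "z \<notin> closure {z. \<phi> z \<noteq> 0}" using that by auto
    then show "FD \<phi> z = (\<lambda>_. 0)" "\<phi> z = 0"
      using closure_subset[of "{z. \<phi> z \<noteq> 0}"] by (auto intro: frechet_derivative_zero_outside)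
  qed
  show ?thesis
  proof (rule that[OF intD intF intG C out])
    fix \<phi> :: "(real ^ 'n) \<times> real \<Rightarrow> real"
    assume \<phi>: "C1_fun \<phi>" "closure {z. \<phi> z \<noteq> 0} \<subseteq> cbox a b"
    have t: "test_function \<Omega> \<phi>" by (rule test_function_cbox[OF \<phi> B])
    note [measurable] = borel_measurable_continuous_onI[OF C1_fun_continuous[OF \<phi>(1)]]
      borel_measurable_continuous_onI[OF C1_fun_space_grad_continuous[OF \<phi>(1)]]
      borel_measurable_continuous_onI[OF C1_fun_time_deriv_continuous[OF \<phi>(1)]] mu
    have z: "space_grad \<phi> z = 0" "time_deriv \<phi> z = 0" "\<phi> z = 0" if "z \<notin> ?B" for z
      using zero[OF \<phi>(2) that] by (auto simp: space_grad_def time_deriv_def vec_eq_iff)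
    have e1: "(LINT z:\<Omega>|lebesgue. u z *\<^sub>R space_grad \<phi> z) = (\<integral>z. (?i z * u z) *\<^sub>R space_grad \<phi> z \<partial>lborel)"
      unfolding set_lebesgue_integral_def
    proof -
      have "(\<integral>z. indicator \<Omega> z *\<^sub>R u z *\<^sub>R space_grad \<phi> z \<partial>lebesgue) = (\<integral>z. (?i z * u z) *\<^sub>R space_grad \<phi> z \<partial>lebesgue)"
        using z B by (intro Bochner_Integration.integral_cong) (auto simp: indicator_def)
      then show "(\<integral>z. indicator \<Omega> z *\<^sub>R u z *\<^sub>R space_grad \<phi> z \<partial>lebesgue) = (\<integral>z. (?i z * u z) *\<^sub>R space_grad \<phi> z \<partial>lborel)"
        by (simp add: integral_completion)
    qed
    have e2: "(LINT z:\<Omega>|lebesgue. \<phi> z *\<^sub>R Du z) = (\<integral>z. \<phi> z *\<^sub>R D z \<partial>lborel)"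
      unfolding set_lebesgue_integral_def
    proof (rule integral_lebesgue_eq_lborel)
      have *: "(\<lambda>z. indicator \<Omega> z *\<^sub>R \<phi> z *\<^sub>R Du z) = (\<lambda>z. \<phi> z *\<^sub>R (?i z *\<^sub>R Du z))"
        using z B by (auto simp: indicator_def fun_eq_iff)
      show "(\<lambda>z. indicator \<Omega> z *\<^sub>R \<phi> z *\<^sub>R Du z) \<in> borel_measurable lebesgue"
        unfolding * by (intro borel_measurable_scaleR mD measurable_completion) simp
      show "AE z in lborel. indicator \<Omega> z *\<^sub>R \<phi> z *\<^sub>R Du z = \<phi> z *\<^sub>R D z"
        using AED by eventually_elim (use * in \<open>metis (no_types)\<close>)
    qed simp
    show "(\<integral>z. (?i z * u z) *\<^sub>R space_grad \<phi> z \<partial>lborel) = - (\<integral>z. \<phi> z *\<^sub>R D z \<partial>lborel)"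
      using Du(1) t unfolding weak_space_grad_def e1[symmetric] e2[symmetric] by blast
    assume nn: "\<And>z. 0 \<le> \<phi> z"
    have e3: "(LINT z:\<Omega>|lebesgue. u z * time_deriv \<phi> z) = (\<integral>z. (?i z * u z) * time_deriv \<phi> z \<partial>lborel)"
      unfolding set_lebesgue_integral_def
    proof -
      have "(\<integral>z. indicator \<Omega> z *\<^sub>R (u z * time_deriv \<phi> z) \<partial>lebesgue) = (\<integral>z. (?i z * u z) * time_deriv \<phi> z \<partial>lebesgue)"
        using z B by (intro Bochner_Integration.integral_cong) (auto simp: indicator_def)
      then show "(\<integral>z. indicator \<Omega> z *\<^sub>R (u z * time_deriv \<phi> z) \<partial>lebesgue) = (\<integral>z. (?i z * u z) * time_deriv \<phi> z \<partial>lborel)"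
        by (simp add: integral_completion)
    qed
    have e4: "(LINT z:\<Omega>|lebesgue. A' z \<bullet> space_grad \<phi> z) = (\<integral>z. F z \<bullet> space_grad \<phi> z \<partial>lborel)"
      unfolding set_lebesgue_integral_def
    proof (rule integral_lebesgue_eq_lborel)
      have *: "(\<lambda>z. indicator \<Omega> z *\<^sub>R (A' z \<bullet> space_grad \<phi> z)) = (\<lambda>z. (?i z *\<^sub>R A' z) \<bullet> space_grad \<phi> z)"
        using z B by (auto simp: indicator_def fun_eq_iff)
      show "(\<lambda>z. indicator \<Omega> z *\<^sub>R (A' z \<bullet> space_grad \<phi> z)) \<in> borel_measurable lebesgue"
        unfolding * by (intro borel_measurable_inner mF measurable_completion) simp
      show "AE z in lborel. indicator \<Omega> z *\<^sub>R (A' z \<bullet> space_grad \<phi> z) = F z \<bullet> space_grad \<phi> z"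
        using AEF by eventually_elim (use * in \<open>metis (no_types)\<close>)
    qed simp
    show "0 \<le> - (\<integral>z. (?i z * u z) * time_deriv \<phi> z \<partial>lborel) + (\<integral>z. F z \<bullet> space_grad \<phi> z \<partial>lborel)"
      using ineq[OF t nn] unfolding e3 A'_def[symmetric] e4 .
  qed
qed

end

lemma mollifier_mass:
  fixes \<eta> :: "'a::euclidean_space \<Rightarrow> real"
  assumes "mollifier h \<eta>"
  shows "integrable lborel (\<lambda>y. \<eta> (z - y))" "(\<integral>y. \<eta> (z - y) \<partial>lborel) = 1"
proof -
  have m: "\<eta> \<in> borel_measurable borel" using mollifier_measurable[OF assms] .
  show "(\<integral>y. \<eta> (z - y) \<partial>lborel) = 1"
    unfolding integral_lborel_reflect[OF m] by (rule mollifierD(6)[OF assms])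
  show "integrable lborel (\<lambda>y. \<eta> (z - y))"
    using integrable_lborel_affine[OF mollifierD(5)[OF assms], of "-1" z] by simp
qed

lemma conv_norm_le:
  fixes f :: "'a::euclidean_space \<Rightarrow> 'b::{banach, second_countable_topology}"
  assumes "mollifier h \<eta>"
  shows "norm (conv \<eta> f z) \<le> conv \<eta> (\<lambda>y. norm (f y)) z"
  unfolding conv_def using integral_norm_bound[of lborel "\<lambda>y. \<eta> (z - y) *\<^sub>R f y"] mollifierD(2)[OF assms] by simp

lemma conv_add:
  fixes f g :: "'a::euclidean_space \<Rightarrow> real"
  assumes "mollifier h \<eta>" "integrable lborel f" "integrable lborel g"
  shows "conv \<eta> (\<lambda>y. f y + g y) z = conv \<eta> f z + conv \<eta> g z"
  unfolding conv_def using conv_integrable[OF assms(1,2), of z] conv_integrable[OF assms(1,3), of z]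
  by (simp add: distrib_left)

lemma conv_cmult:
  fixes f :: "'a::euclidean_space \<Rightarrow> real"
  shows "conv \<eta> (\<lambda>y. c * f y) z = c * conv \<eta> f z"
  unfolding conv_def by (simp add: mult.left_commute)

lemma conv_near:
  fixes f :: "'a::euclidean_space \<Rightarrow> real"
  assumes \<eta>: "mollifier h \<eta>" and f: "integrable lborel f" and c: "\<And>y. norm (z - y) < h \<Longrightarrow> \<bar>f y - c\<bar> \<le> d"
  shows "\<bar>conv \<eta> f z - c\<bar> \<le> d"
proof -
  have "\<eta> (z - y) * f y \<le> (c + d) * \<eta> (z - y)" "(c - d) * \<eta> (z - y) \<le> \<eta> (z - y) * f y" for y
  proof -
    have "\<eta> (z - y) * f y \<le> (c + d) * \<eta> (z - y) \<and> (c - d) * \<eta> (z - y) \<le> \<eta> (z - y) * f y"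
    proof (cases "norm (z - y) < h")
      case True
      have "f y \<le> c + d" "c - d \<le> f y" using c[OF True] by linarith+
      from mult_left_mono[OF this(1) mollifierD(2)[OF \<eta>, of "z - y"]] mult_left_mono[OF this(2) mollifierD(2)[OF \<eta>, of "z - y"]]
      show ?thesis by (simp add: mult.commute)
    next
      case False
      then show ?thesis using mollifierD(3)[OF \<eta>, of "z - y"] by simp
    qed
    then show "\<eta> (z - y) * f y \<le> (c + d) * \<eta> (z - y)" "(c - d) * \<eta> (z - y) \<le> \<eta> (z - y) * f y" by auto
  qed
  then have "conv \<eta> f z \<le> (\<integral>y. (c + d) * \<eta> (z - y) \<partial>lborel)" "(\<integral>y. (c - d) * \<eta> (z - y) \<partial>lborel) \<le> conv \<eta> f z"
    unfolding conv_def real_scaleR_def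
    by (intro integral_mono conv_integrable[OF \<eta> f, of z, unfolded real_scaleR_def] integrable_mult_right
        mollifier_mass(1)[OF \<eta>, of z]; blast)+
  then show ?thesis using mollifier_mass[OF \<eta>, of z] by (simp add: abs_le_iff)
qed

lemma continuous_compact_support_bounded:
  fixes f :: "'a::euclidean_space \<Rightarrow> 'b::real_normed_vector"
  assumes "continuous_on UNIV f" "compact K" "\<And>z. z \<notin> K \<Longrightarrow> f z = 0"
  obtains M where "\<And>z. norm (f z) \<le> M"
proof -
  have "bounded (f ` K)" using assms by (intro compact_imp_bounded compact_continuous_image continuous_on_subset[OF assms(1)]) auto
  then obtain M where M: "\<And>z. z \<in> K \<Longrightarrow> norm (f z) \<le> M" unfolding bounded_iff by blast
  have "norm (f z) \<le> max 0 M" for z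
    using M[of z] assms(3)[of z] by (cases "z \<in> K") auto
  then show ?thesis using that by blast
qed

context growth
begin

text \<open>Integrate the tangent line of \<open>G\<close> at the averaged value \<open>s\<close>
  against the kernel: the terms containing \<open>g s\<close> cancel because the kernel has mass one
  and \<open>s\<close> is the mean.\<close>

lemma conv_jensen:
  fixes D :: "'a::euclidean_space \<Rightarrow> 'b::{banach, second_countable_topology}"
  assumes \<eta>: "mollifier h \<eta>" and D: "integrable lborel D" and GD: "integrable lborel (\<lambda>y. G (norm (D y)))"
  shows "G (conv \<eta> (\<lambda>y. norm (D y)) z) \<le> conv \<eta> (\<lambda>y. G (norm (D y))) z"
proof -
  define s where "s = conv \<eta> (\<lambda>y. norm (D y)) z"
  have s: "0 \<le> s" using conv_norm_le[OF \<eta>, of D z] norm_ge_zero order_trans unfolding s_def by blast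
  have nD: "integrable lborel (\<lambda>y. norm (D y))" using D by simp
  note i1 = conv_integrable[OF \<eta> nD, of z] and i2 = conv_integrable[OF \<eta> GD, of z] and i3 = mollifier_mass(1)[OF \<eta>, of z]
  have "(\<integral>y. (G s - g s * s) * \<eta> (z - y) + g s * (\<eta> (z - y) *\<^sub>R norm (D y)) \<partial>lborel) \<le> conv \<eta> (\<lambda>y. G (norm (D y))) z"
    unfolding conv_def
  proof (rule integral_mono[OF _ i2])
    fix y
    show "(G s - g s * s) * \<eta> (z - y) + g s * (\<eta> (z - y) *\<^sub>R norm (D y)) \<le> \<eta> (z - y) *\<^sub>R G (norm (D y))"
      using mult_left_mono[OF G_tangent[OF s norm_ge_zero[of "D y"]] mollifierD(2)[OF \<eta>, of "z - y"]]
      by (simp add: algebra_simps)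
  qed (use i1 i3 in auto)
  also have "(\<integral>y. (G s - g s * s) * \<eta> (z - y) + g s * (\<eta> (z - y) *\<^sub>R norm (D y)) \<partial>lborel)
     = (G s - g s * s) * (\<integral>y. \<eta> (z - y) \<partial>lborel) + g s * s"
    using i1 i3 by (subst Bochner_Integration.integral_add) (auto simp: s_def conv_def)
  also have "\<dots> = G s" using mollifier_mass(2)[OF \<eta>, of z] by simp
  finally show ?thesis by (simp add: s_def)
qed

text \<open>No Young conjugate of \<open>G\<close> is needed: monotonicity of \<open>g\<close> gives
  \<open>g(a) s \<le> g(a) a + g(s) s\<close>, which is averaged with the frozen value \<open>s\<close> of the mollified gradient.\<close>

lemma conv_flux_bound:
  fixes D F :: "'a::euclidean_space \<Rightarrow> 'b::{banach, second_countable_topology}"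
  assumes \<eta>: "mollifier h \<eta>" and D: "integrable lborel D" and F: "integrable lborel F"
    and GD: "integrable lborel (\<lambda>y. G (norm (D y)))" and C1: "0 \<le> C1"
    and FD: "\<And>y. norm (F y) \<le> C1 * g (norm (D y))"
  shows "norm (conv \<eta> F z) * norm (conv \<eta> D z) \<le> 2 * C1 * Q * conv \<eta> (\<lambda>y. G (norm (D y))) z"
proof -
  define s where "s = conv \<eta> (\<lambda>y. norm (D y)) z"
  have sD: "norm (conv \<eta> D z) \<le> s" using conv_norm_le[OF \<eta>, of D z] by (simp add: s_def)
  then have s: "0 \<le> s" using norm_ge_zero order_trans by blast
  have nF: "integrable lborel (\<lambda>y. norm (F y))" using F by simp
  note i1 = conv_integrable[OF \<eta> nF, of z] and i2 = conv_integrable[OF \<eta> GD, of z] and i3 = mollifier_mass(1)[OF \<eta>, of z]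
  have pw: "norm (F y) * s \<le> C1 * Q * G (norm (D y)) + C1 * Q * G s" for y
  proof -
    have "norm (F y) * s \<le> C1 * g (norm (D y)) * s" using FD s by (intro mult_right_mono)
    also have "\<dots> \<le> C1 * (Q * G (norm (D y)) + Q * G s)"
      using mult_left_mono[OF young[of "norm (D y)" s 1] C1] s by (simp add: algebra_simps)
    finally show ?thesis by (simp add: algebra_simps)
  qed
  have "conv \<eta> (\<lambda>y. norm (F y)) z * s = (\<integral>y. s * (\<eta> (z - y) *\<^sub>R norm (F y)) \<partial>lborel)"
    by (simp add: conv_def mult.commute)
  also have "\<dots> \<le> (\<integral>y. C1 * Q * (\<eta> (z - y) *\<^sub>R G (norm (D y))) + C1 * Q * G s * \<eta> (z - y) \<partial>lborel)"
  proof (rule integral_mono)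
    fix y
    show "s * (\<eta> (z - y) *\<^sub>R norm (F y)) \<le> C1 * Q * (\<eta> (z - y) *\<^sub>R G (norm (D y))) + C1 * Q * G s * \<eta> (z - y)"
      using mult_left_mono[OF pw[of y] mollifierD(2)[OF \<eta>, of "z - y"]] by (simp add: algebra_simps)
  qed (use i1 i2 i3 in auto)
  also have "\<dots> = C1 * Q * conv \<eta> (\<lambda>y. G (norm (D y))) z + C1 * Q * G s * (\<integral>y. \<eta> (z - y) \<partial>lborel)"
    using i2 i3 by (subst Bochner_Integration.integral_add) (auto simp: conv_def)
  also have "\<dots> \<le> 2 * C1 * Q * conv \<eta> (\<lambda>y. G (norm (D y))) z"
    using mult_left_mono[OF conv_jensen[OF \<eta> D GD, of z], of "C1 * Q"] C1 mollifier_mass(2)[OF \<eta>, of z]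
    by (simp add: s_def)
  finally have "conv \<eta> (\<lambda>y. norm (F y)) z * s \<le> 2 * C1 * Q * conv \<eta> (\<lambda>y. G (norm (D y))) z" .
  moreover have "norm (conv \<eta> F z) * norm (conv \<eta> D z) \<le> conv \<eta> (\<lambda>y. norm (F y)) z * s"
    using conv_norm_le[OF \<eta>, of F z] sD order_trans[OF norm_ge_zero conv_norm_le[OF \<eta>, of F z]] by (intro mult_mono) auto
  ultimately show ?thesis by linarith
qed

text \<open>Convolution does not commute with a nonlinear field, so the mollified flux and gradient
  obey the structure conditions only up to an error. This measures the error; it is 0 exactly when
  both conditions hold.\<close>

definition defect :: "real \<Rightarrow> real \<Rightarrow> 'b::euclidean_space \<Rightarrow> 'b \<Rightarrow> real" where
  "defect C0 C1 F D = max 0 (C0 * G (norm D) - F \<bullet> D) + max 0 (norm F - C1 * g (norm D))"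

text \<open>By continuity the defect tends to 0 almost everywhere along a subsequence on which flux
  and gradient converge. The available majorant, a mollified function, varies with the index but
  converges in the mean, so a generalised dominated convergence applies. One good index is all that
  is used later.\<close>

lemma conv_defect_tendsto:
  fixes D F :: "'a::euclidean_space \<Rightarrow> 'b::euclidean_space"
  assumes \<eta>: "\<And>n. mollifier (h n) (\<eta> n)" and h: "h \<longlonglongrightarrow> 0"
    and D: "integrable lborel D" and F: "integrable lborel F"
    and GD: "integrable lborel (\<lambda>y. G (norm (D y)))" and C: "0 \<le> C0" "0 \<le> C1"
    and coer: "\<And>z. C0 * G (norm (D z)) \<le> F z \<bullet> D z" and bd: "\<And>z. norm (F z) \<le> C1 * g (norm (D z))"
    and \<epsilon>: "0 < \<epsilon>"
  obtains n where "integrable lborel (\<lambda>z. defect C0 C1 (conv (\<eta> n) F z) (conv (\<eta> n) D z))"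
    "(\<integral>z. defect C0 C1 (conv (\<eta> n) F z) (conv (\<eta> n) D z) \<partial>lborel) < \<epsilon>"
proof -
  \<comment> \<open>Jensen's inequality and \<open>conv_flux_bound\<close> control the coercivity
    part of the defect by the first summand; the growth part is at most the mollification of
    \<open>norm (F z)\<close>.\<close>
  define \<Theta> where "\<Theta> z = (C0 + 2 * C1 * Q) * G (norm (D z)) + norm (F z)" for z
  define e where "e n z = defect C0 C1 (conv (\<eta> n) F z) (conv (\<eta> n) D z)" for n z
  have i\<Theta>: "integrable lborel \<Theta>" unfolding \<Theta>_def using GD F by auto
  note mF = conv_measurable[OF \<eta> borel_measurable_integrable[OF F, simplified]]
    and mD = conv_measurable[OF \<eta> borel_measurable_integrable[OF D, simplified]]
    and m\<Theta> = conv_measurable[OF \<eta> borel_measurable_integrable[OF i\<Theta>, simplified]]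
  note [measurable] = mF mD m\<Theta> borel_measurable_continuous_on[OF G_norm_continuous mD] borel_measurable_continuous_on[OF g_norm_continuous mD]
  have me[measurable]: "e n \<in> borel_measurable borel" for n unfolding e_def defect_def by measurable
  have e0: "0 \<le> e n z" for n z by (simp add: e_def defect_def)
  have e1: "e n z \<le> conv (\<eta> n) \<Theta> z" for n z
  proof -
    define \<Gamma> where "\<Gamma> = conv (\<eta> n) (\<lambda>y. G (norm (D y))) z"
    have nF: "integrable lborel (\<lambda>y. norm (F y))" using F by simp
    have *: "conv (\<eta> n) \<Theta> z = (C0 + 2 * C1 * Q) * \<Gamma> + conv (\<eta> n) (\<lambda>y. norm (F y)) z"
      unfolding \<Theta>_def \<Gamma>_def using GD nF by (subst conv_add[OF \<eta>]) (auto simp: conv_cmult)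
    have "G (norm (conv (\<eta> n) D z)) \<le> \<Gamma>"
      using G_mono[OF norm_ge_zero conv_norm_le[OF \<eta>[of n], of D z]] conv_jensen[OF \<eta>[of n] D GD, of z] unfolding \<Gamma>_def by linarith
    then have "C0 * G (norm (conv (\<eta> n) D z)) \<le> C0 * \<Gamma>" using C by (intro mult_left_mono)
    moreover have "- (conv (\<eta> n) F z \<bullet> conv (\<eta> n) D z) \<le> 2 * C1 * Q * \<Gamma>"
      using Cauchy_Schwarz_ineq2[of "conv (\<eta> n) F z" "conv (\<eta> n) D z"] conv_flux_bound[OF \<eta>[of n] D F GD C(2) bd, of z] unfolding \<Gamma>_def by linarith
    moreover have "norm (conv (\<eta> n) F z) \<le> conv (\<eta> n) (\<lambda>y. norm (F y)) z" by (rule conv_norm_le[OF \<eta>])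
    moreover have "0 \<le> C1 * g (norm (conv (\<eta> n) D z))" using C g_nonneg by simp
    moreover have "0 \<le> \<Gamma>" using \<open>G (norm (conv (\<eta> n) D z)) \<le> \<Gamma>\<close> G_nonneg[of "norm (conv (\<eta> n) D z)"] by simp
    then have "0 \<le> (C0 + 2 * C1 * Q) * \<Gamma>" using C by simp
    moreover have "0 \<le> conv (\<eta> n) (\<lambda>y. norm (F y)) z" using conv_norm_le[OF \<eta>[of n], of F z] norm_ge_zero order_trans by blast
    ultimately show ?thesis unfolding * e_def defect_def by (simp add: distrib_right max_def)
  qed
  have ie: "integrable lborel (e n)" for n
    by (rule Bochner_Integration.integrable_bound[OF conv_integrable'[OF \<eta> i\<Theta>, of n]])
      (use e0 e1 in \<open>auto intro!: AE_I2 order_trans[OF e1] abs_ge_self\<close>)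
  have lD: "(\<lambda>n. \<integral>z. norm (conv (\<eta> n) D z - D z) \<partial>lborel) \<longlonglongrightarrow> 0" by (rule conv_tendsto_L1[OF \<eta> h D])
  obtain r1 where r1: "strict_mono r1" "AE z in lborel. (\<lambda>n. conv (\<eta> (r1 n)) D z - D z) \<longlonglongrightarrow> 0"
    using tendsto_L1_AE_subseq[OF _ lD] conv_integrable'[OF \<eta> D] D by auto
  have lF: "(\<lambda>n. \<integral>z. norm (conv (\<eta> n) F z - F z) \<partial>lborel) \<longlonglongrightarrow> 0" by (rule conv_tendsto_L1[OF \<eta> h F])
  have "(\<lambda>n. \<integral>z. norm (conv (\<eta> (r1 n)) F z - F z) \<partial>lborel) \<longlonglongrightarrow> 0"
    using LIMSEQ_subseq_LIMSEQ[OF lF r1(1)] by (simp add: o_def)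
  from tendsto_L1_AE_subseq[OF _ this] conv_integrable'[OF \<eta> F] F
  obtain r2 where r2: "strict_mono r2" "AE z in lborel. (\<lambda>n. conv (\<eta> (r1 (r2 n))) F z - F z) \<longlonglongrightarrow> 0" by auto
  define r where "r n = r1 (r2 n)" for n
  have r: "strict_mono r" using strict_mono_o[OF r1(1) r2(1)] by (simp add: r_def o_def[abs_def] strict_mono_def)
  have AEe: "AE z in lborel. (\<lambda>n. e (r n) z) \<longlonglongrightarrow> 0"
    using r1(2) r2(2)
  proof eventually_elim
    case (elim z)
    have l1: "(\<lambda>n. conv (\<eta> (r n)) D z) \<longlonglongrightarrow> D z"
      using LIMSEQ_subseq_LIMSEQ[OF elim(1) r2(1)] by (simp add: r_def o_def LIM_zero_iff)
    have l2: "(\<lambda>n. conv (\<eta> (r n)) F z) \<longlonglongrightarrow> F z"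
      using elim(2) by (simp add: r_def LIM_zero_iff)
    have lG: "(\<lambda>n. G (norm (conv (\<eta> (r n)) D z))) \<longlonglongrightarrow> G (norm (D z))"
      by (rule isCont_tendsto_compose[OF _ l1]) (use G_norm_continuous in \<open>auto simp: continuous_on_eq_continuous_at\<close>)
    have lg: "(\<lambda>n. g (norm (conv (\<eta> (r n)) D z))) \<longlonglongrightarrow> g (norm (D z))"
      by (rule isCont_tendsto_compose[OF _ l1]) (use g_norm_continuous in \<open>auto simp: continuous_on_eq_continuous_at\<close>)
    have "(\<lambda>n. e (r n) z) \<longlonglongrightarrow> defect C0 C1 (F z) (D z)"
      unfolding e_def defect_def by (intro tendsto_intros l1 l2 lG lg)
    also have "defect C0 C1 (F z) (D z) = 0" using coer[of z] bd[of z] by (simp add: defect_def)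
    finally show ?case .
  qed
  \<comment> \<open>Subtracting the error of the mollified majorant, which is small in the mean,
    leaves a part dominated by the fixed function \<Theta>.\<close>
  define v where "v n z = max 0 (e (r n) z - \<bar>conv (\<eta> (r n)) \<Theta> z - \<Theta> z\<bar>)" for n z
  have [measurable]: "\<Theta> \<in> borel_measurable borel" using borel_measurable_integrable[OF i\<Theta>] by simp
  have v\<Theta>: "v n z \<le> \<bar>\<Theta> z\<bar>" for n z using e1[of "r n" z] unfolding v_def by linarith
  have mv: "v n \<in> borel_measurable lborel" for n unfolding v_def by measurable
  have "(\<lambda>n. \<integral>z. v n z \<partial>lborel) \<longlonglongrightarrow> (\<integral>z. 0 \<partial>(lborel::'a measure))"
  proof (rule integral_dominated_convergence[where w = "\<lambda>z. \<bar>\<Theta> z\<bar>"])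
    show "AE z in lborel. (\<lambda>n. v n z) \<longlonglongrightarrow> 0"
      using AEe
    proof eventually_elim
      case (elim z)
      show ?case
        by (rule tendsto_sandwich[OF _ _ tendsto_const elim]) (use e0 in \<open>auto simp: v_def\<close>)
    qed
    show "AE z in lborel. norm (v n z) \<le> \<bar>\<Theta> z\<bar>" for n
      using v\<Theta> by (intro AE_I2) (simp add: v_def)
  qed (use i\<Theta> mv in auto)
  moreover have "(\<lambda>n. \<integral>z. norm (conv (\<eta> (r n)) \<Theta> z - \<Theta> z) \<partial>lborel) \<longlonglongrightarrow> 0"
    using LIMSEQ_subseq_LIMSEQ[OF conv_tendsto_L1[OF \<eta> h i\<Theta>] r] by (simp add: o_def)
  ultimately have "(\<lambda>n. (\<integral>z. v n z \<partial>lborel) + (\<integral>z. norm (conv (\<eta> (r n)) \<Theta> z - \<Theta> z) \<partial>lborel)) \<longlonglongrightarrow> 0 + 0"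
    by (intro tendsto_add) auto
  then have "\<forall>\<^sub>F n in sequentially. (\<integral>z. v n z \<partial>lborel) + (\<integral>z. norm (conv (\<eta> (r n)) \<Theta> z - \<Theta> z) \<partial>lborel) < \<epsilon>"
    using \<epsilon> by (intro order_tendstoD) auto
  then obtain n where n: "(\<integral>z. v n z \<partial>lborel) + (\<integral>z. norm (conv (\<eta> (r n)) \<Theta> z - \<Theta> z) \<partial>lborel) < \<epsilon>"
    by (auto simp: eventually_sequentially)
  have iv: "integrable lborel (v n)"
    by (rule Bochner_Integration.integrable_bound[OF i\<Theta> mv]) (use v\<Theta> in \<open>auto intro!: AE_I2 simp: v_def\<close>)
  have i2: "integrable lborel (\<lambda>z. norm (conv (\<eta> (r n)) \<Theta> z - \<Theta> z))" using conv_integrable'[OF \<eta> i\<Theta>] i\<Theta> by auto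
  have "(\<integral>z. e (r n) z \<partial>lborel) \<le> (\<integral>z. v n z + norm (conv (\<eta> (r n)) \<Theta> z - \<Theta> z) \<partial>lborel)"
    using ie iv i2 by (intro integral_mono) (auto simp: v_def)
  also have "\<dots> < \<epsilon>" using n iv i2 by (subst Bochner_Integration.integral_add) auto
  finally show ?thesis using that[of "r n"] ie[of "r n"] unfolding e_def by blast
qed

end

lemma derivs_zero_outside:
  assumes "closure {z. \<phi> z \<noteq> 0} \<subseteq> K" "z \<notin> K"
  shows "time_deriv \<phi> z = 0" "space_grad \<phi> z = 0"
proof -
  have "z \<notin> closure {z. \<phi> z \<noteq> 0}" using assms by auto
  from frechet_derivative_zero_outside[OF this] show "time_deriv \<phi> z = 0" "space_grad \<phi> z = 0"
    by (simp_all add: time_deriv_def space_grad_def vec_eq_iff)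
qed

context growth
begin

text \<open>Here \<open>w\<close> and \<open>F\<close> are the mollifications of the solution and of
  its frozen flux, both cut off to the box, and \<open>e\<close> is the defect. On \<open>K\<close>,
  whose points are farther from the boundary of the box than the mollification radius, the gradient
  of \<open>w\<close> is the mollified weak gradient, which is why the structure conditions can hold
  there with error \<open>e\<close>.\<close>

lemma weak_supersolution_approx:
  fixes A :: "'n::finite vector_field" and u :: "(real ^ 'n) \<times> real \<Rightarrow> real"
  assumes struct: "structure_conditions C0 C1 g A" and C: "0 \<le> C0" "0 < C1"
    and ws: "weak_supersolution g A \<Omega> u" and nn: "\<And>z. z \<in> \<Omega> \<Longrightarrow> 0 \<le> u z"
    and B: "cbox a b \<subseteq> \<Omega>" and K: "compact K" "K \<subseteq> box a b" and \<epsilon>: "0 < \<epsilon>"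
  obtains w :: "(real ^ 'n) \<times> real \<Rightarrow> real" and F and e where
    "C1_fun w" "\<And>z. 0 \<le> w z" "\<And>z. z \<in> K \<Longrightarrow> \<bar>w z - u z\<bar> \<le> \<epsilon>"
    "integrable lborel F" "integrable lborel e" "\<And>z. 0 \<le> e z" "(\<integral>z. e z \<partial>lborel) < \<epsilon>"
    "\<And>z. z \<in> K \<Longrightarrow> C0 * G (norm (space_grad w z)) - e z \<le> F z \<bullet> space_grad w z"
    "\<And>z. z \<in> K \<Longrightarrow> norm (F z) \<le> C1 * g (norm (space_grad w z)) + e z"
    "\<And>\<psi>. C1_fun \<psi> \<Longrightarrow> closure {z. \<psi> z \<noteq> 0} \<subseteq> K \<Longrightarrow> (\<And>z. 0 \<le> \<psi> z) \<Longrightarrow>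
       0 \<le> - (\<integral>z. w z * time_deriv \<psi> z \<partial>lborel) + (\<integral>z. F z \<bullet> space_grad \<psi> z \<partial>lborel)"
proof -
  let ?B = "cbox a b"
  define ub where "ub = (\<lambda>z. indicator ?B z * u z)"
  have cu: "continuous_on ?B u" using ws B unfolding weak_supersolution_def by (auto intro: continuous_on_subset)
  have ub0: "0 \<le> ub z" for z using nn[of z] subsetD[OF B, of z] by (cases "z \<in> ?B") (simp_all add: ub_def)
  have iub: "integrable lborel ub"
    using borel_integrable_compact[OF compact_cbox cu] by (simp add: ub_def)
  obtain D F where D: "integrable lborel D" and F: "integrable lborel F" and GD: "integrable lborel (\<lambda>z. G (norm (D z)))"
    and coer: "\<And>z. C0 * G (norm (D z)) \<le> F z \<bullet> D z" and bd: "\<And>z. norm (F z) \<le> C1 * g (norm (D z))"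
    and "\<And>z. z \<notin> ?B \<Longrightarrow> D z = 0 \<and> F z = 0"
    and grad: "\<And>\<phi>. C1_fun \<phi> \<Longrightarrow> closure {z. \<phi> z \<noteq> 0} \<subseteq> ?B \<Longrightarrow>
        (\<integral>z. ub z *\<^sub>R space_grad \<phi> z \<partial>lborel) = - (\<integral>z. \<phi> z *\<^sub>R D z \<partial>lborel)"
    and ineq: "\<And>\<phi>. C1_fun \<phi> \<Longrightarrow> closure {z. \<phi> z \<noteq> 0} \<subseteq> ?B \<Longrightarrow> (\<And>z. 0 \<le> \<phi> z) \<Longrightarrow>
        0 \<le> - (\<integral>z. ub z * time_deriv \<phi> z \<partial>lborel) + (\<integral>z. F z \<bullet> space_grad \<phi> z \<partial>lborel)"
    using weak_supersolution_borel[OF struct C(2) ws B] unfolding ub_def by blast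
  obtain h0 where h0: "h0 > 0" "(\<Union>z\<in>K. ball z h0) \<subseteq> box a b"
    using compact_subset_open_imp_ball_epsilon_subset[OF K(1) open_box K(2)] by blast
  have "uniformly_continuous_on ?B u" by (rule compact_uniformly_continuous[OF cu compact_cbox])
  then obtain d where d: "d > 0" "\<And>z z'. z \<in> ?B \<Longrightarrow> z' \<in> ?B \<Longrightarrow> dist z' z < d \<Longrightarrow> dist (u z') (u z) < \<epsilon>"
    unfolding uniformly_continuous_on_def using \<epsilon> by metis
  \<comment> \<open>Below \<open>h0\<close>, so that balls around points of \<open>K\<close> stay in
    the box; at most \<open>d\<close>, so that \<open>u\<close> varies by less than \<epsilon> on
    them; and tending to 0 for the defect.\<close>
  define h where "h n = min h0 d / (2 + real n)" for n
  have hpos: "0 < h n" and hlt: "h n < h0" "h n \<le> d" for n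
  proof -
    have m: "min h0 d > 0" using h0 d by simp
    then show "0 < h n" by (simp add: h_def)
    have "h n \<le> min h0 d / 2" unfolding h_def using m by (intro divide_left_mono) auto
    then show "h n < h0" "h n \<le> d" using m h0 d by (auto simp: min_def split: if_splits)
  qed
  have hlim: "h \<longlonglongrightarrow> 0" unfolding h_def[abs_def] by real_asymp
  have "\<exists>\<eta> \<eta>'. mollifier (h n) (\<eta> :: (real ^ 'n) \<times> real \<Rightarrow> real) \<and> (\<forall>z. (\<eta> has_derivative (\<lambda>v. \<eta>' z \<bullet> v)) (at z)) \<and> continuous_on UNIV \<eta>'" for n
    using mollifier_exists[OF hpos[of n]] by metis
  then obtain \<eta> and \<eta>' :: "nat \<Rightarrow> (real ^ 'n) \<times> real \<Rightarrow> (real ^ 'n) \<times> real" where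
    \<eta>: "\<And>n. mollifier (h n) (\<eta> n)" and \<eta>': "\<And>n z. (\<eta> n has_derivative (\<lambda>v. \<eta>' n z \<bullet> v)) (at z)" "\<And>n. continuous_on UNIV (\<eta>' n)"
    by metis
  obtain n where n: "integrable lborel (\<lambda>z. defect C0 C1 (conv (\<eta> n) F z) (conv (\<eta> n) D z))"
    "(\<integral>z. defect C0 C1 (conv (\<eta> n) F z) (conv (\<eta> n) D z) \<partial>lborel) < \<epsilon>"
    using conv_defect_tendsto[OF \<eta> hlim D F GD C(1) less_imp_le[OF C(2)] coer bd \<epsilon>] .
  define w where "w = conv (\<eta> n) ub"
  have w: "C1_fun w" "FD w z v = (\<integral>y. ub y * (\<eta>' n (z - y) \<bullet> v) \<partial>lborel)" for z v
    using conv_C1[OF \<eta> \<eta>' cu, of n] unfolding w_def ub_def by auto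
  have near: "y \<in> ?B" if "z \<in> K" "norm (z - y) \<le> h n" for z y
  proof -
    have "y \<in> ball z h0" using that hlt(1)[of n] by (simp add: dist_norm)
    then show ?thesis using h0(2) that(1) box_subset_cbox by blast
  qed
  \<comment> \<open>The weak gradient is tested with the reflected kernel centred at
    \<open>z\<close>. The sign from the reflection cancels the sign of the integration by
    parts.\<close>
  have sg: "space_grad w z = conv (\<eta> n) D z" if z: "z \<in> K" for z
  proof -
    define \<phi> where "\<phi> = (\<lambda>y. \<eta> n (- y + z))"
    have C1\<eta>: "C1_fun (\<eta> n)" and FD\<eta>: "FD (\<eta> n) x = (\<lambda>v. \<eta>' n x \<bullet> v)" for x
      by (rule C1_funI[OF \<eta>'(1)]; intro continuous_intros \<eta>'(2))+
    have C1\<phi>: "C1_fun \<phi>" and FD\<phi>: "FD \<phi> y v = - (\<eta>' n (z - y) \<bullet> v)" for y v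
      unfolding \<phi>_def using C1_fun_linear[OF C1\<eta> bounded_linear_minus[OF bounded_linear_ident], of z]
      by (auto simp: FD\<eta>)
    have "{y. \<phi> y \<noteq> 0} \<subseteq> cball z (h n)"
    proof
      fix y assume "y \<in> {y. \<phi> y \<noteq> 0}"
      then have "\<eta> n (z - y) \<noteq> 0" by (simp add: \<phi>_def)
      then have "\<not> h n \<le> norm (z - y)" using mollifierD(3)[OF \<eta>[of n], of "z - y"] by blast
      then show "y \<in> cball z (h n)" by (simp add: dist_norm)
    qed
    then have cl: "closure {y. \<phi> y \<noteq> 0} \<subseteq> cball z (h n)" by (rule closure_minimal) simp
    also have "\<dots> \<subseteq> ?B" using near[OF z] by (auto simp: dist_norm)
    finally have supp: "closure {y. \<phi> y \<noteq> 0} \<subseteq> ?B" .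
    obtain M where M: "\<And>y. norm (space_grad \<phi> y) \<le> M"
      by (rule continuous_compact_support_bounded[OF C1_fun_space_grad_continuous[OF C1\<phi>] compact_cball[of z "h n"]])
        (use derivs_zero_outside(2)[OF cl] in auto)
    have int1: "integrable lborel (\<lambda>y. ub y *\<^sub>R space_grad \<phi> y)"
    proof (rule Bochner_Integration.integrable_bound)
      show "integrable lborel (\<lambda>y. M * ub y)" using iub by simp
      show "(\<lambda>y. ub y *\<^sub>R space_grad \<phi> y) \<in> borel_measurable lborel"
        using borel_measurable_integrable[OF iub] borel_measurable_continuous_onI[OF C1_fun_space_grad_continuous[OF C1\<phi>]] by simp
      show "AE y in lborel. norm (ub y *\<^sub>R space_grad \<phi> y) \<le> norm (M * ub y)"
        using M ub0 order_trans[OF norm_ge_zero M] by (auto intro!: AE_I2 simp: abs_mult mult.commute[of M] mult_left_mono)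
    qed
    have eq\<phi>: "\<phi> y = \<eta> n (z - y)" for y by (simp add: \<phi>_def)
    show ?thesis
    proof (simp add: vec_eq_iff, intro allI)
      fix i
      have "space_grad w z $ i = (\<integral>y. ub y * (\<eta>' n (z - y) \<bullet> (axis i 1, 0)) \<partial>lborel)"
        by (simp add: space_grad_def w(2))
      also have "\<dots> = - (\<integral>y. (ub y *\<^sub>R space_grad \<phi> y) $ i \<partial>lborel)"
        by (simp add: space_grad_def FD\<phi>)
      also have "\<dots> = - ((\<integral>y. ub y *\<^sub>R space_grad \<phi> y \<partial>lborel) $ i)"
        using integral_bounded_linear[OF bounded_linear_vec_nth int1, of i] by simp
      also have "\<dots> = (\<integral>y. \<phi> y *\<^sub>R D y \<partial>lborel) $ i" using grad[OF C1\<phi> supp] by simp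
      finally show "space_grad w z $ i = conv (\<eta> n) D z $ i" by (simp add: conv_def eq\<phi>)
    qed
  qed
  show ?thesis
  proof (rule that[OF w(1) _ _ conv_integrable'[OF \<eta> F] n(1) _ n(2)])
    show "0 \<le> w z" for z unfolding w_def conv_def
      using ub0 mollifierD(2)[OF \<eta>] by (intro integral_nonneg_AE AE_I2) simp
    show "\<bar>w z - u z\<bar> \<le> \<epsilon>" if z: "z \<in> K" for z
      unfolding w_def
    proof (rule conv_near[OF \<eta> iub])
      fix y assume y: "norm (z - y) < h n"
      have "y \<in> ?B" using near[OF z] y by simp
      moreover have "z \<in> ?B" using z K(2) box_subset_cbox by blast
      moreover have "dist y z < d" using y hlt(2)[of n] by (simp add: dist_norm norm_minus_commute)
      ultimately have "dist (u y) (u z) < \<epsilon>" using d(2) by blast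
      then show "\<bar>ub y - u z\<bar> \<le> \<epsilon>" using \<open>y \<in> ?B\<close> by (simp add: ub_def dist_real_def)
    qed
    show "0 \<le> defect C0 C1 (conv (\<eta> n) F z) (conv (\<eta> n) D z)" for z by (simp add: defect_def)
    show "C0 * G (norm (space_grad w z)) - defect C0 C1 (conv (\<eta> n) F z) (conv (\<eta> n) D z) \<le> conv (\<eta> n) F z \<bullet> space_grad w z"
      if "z \<in> K" for z unfolding sg[OF that] by (auto simp: defect_def)
    show "norm (conv (\<eta> n) F z) \<le> C1 * g (norm (space_grad w z)) + defect C0 C1 (conv (\<eta> n) F z) (conv (\<eta> n) D z)"
      if "z \<in> K" for z unfolding sg[OF that] by (auto simp: defect_def)
    fix \<psi> :: "(real ^ 'n) \<times> real \<Rightarrow> real"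
    assume \<psi>: "C1_fun \<psi>" "closure {z. \<psi> z \<noteq> 0} \<subseteq> K" "\<And>z. 0 \<le> \<psi> z"
    obtain M1 where M1: "\<And>z. norm (time_deriv \<psi> z) \<le> M1"
      using continuous_compact_support_bounded[OF C1_fun_time_deriv_continuous[OF \<psi>(1)] K(1) derivs_zero_outside(1)[OF \<psi>(2)]] by blast
    obtain M2 where M2: "\<And>z. norm (space_grad \<psi> z) \<le> M2"
      using continuous_compact_support_bounded[OF C1_fun_space_grad_continuous[OF \<psi>(1)] K(1) derivs_zero_outside(2)[OF \<psi>(2)]] by blast
    note m1 = borel_measurable_continuous_onI[OF C1_fun_time_deriv_continuous[OF \<psi>(1)]]
      and m2 = borel_measurable_continuous_onI[OF C1_fun_space_grad_continuous[OF \<psi>(1)]]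
    note s1 = conv_inner_swap[OF \<eta>[of n] iub m1 M1] and s2 = conv_inner_swap[OF \<eta>[of n] F m2 M2]
    \<comment> \<open>A translate of \<psi> by less than \<open>h n\<close> still has support in the
      box and is admissible for the original solution. Averaging these inequalities with the
      nonnegative weight \<open>\<eta> n\<close> gives the one for \<open>w\<close>.\<close>
    have "0 \<le> (\<integral>y. \<eta> n y * (- (\<integral>z. ub z * time_deriv \<psi> (z + y) \<partial>lborel) + (\<integral>z. F z \<bullet> space_grad \<psi> (z + y) \<partial>lborel)) \<partial>lborel)"
    proof (rule integral_nonneg_AE, rule AE_I2)
      fix y
      show "0 \<le> \<eta> n y * (- (\<integral>z. ub z * time_deriv \<psi> (z + y) \<partial>lborel) + (\<integral>z. F z \<bullet> space_grad \<psi> (z + y) \<partial>lborel))"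
      proof (cases "norm y < h n")
        case False then show ?thesis using mollifierD(3)[OF \<eta>, of n y] by simp
      next
        case True
        note lin = C1_fun_linear[OF \<psi>(1) bounded_linear_ident, of y]
        have "{z. \<psi> (z + y) \<noteq> 0} \<subseteq> (\<lambda>x. x - y) ` K"
        proof
          fix z assume "z \<in> {z. \<psi> (z + y) \<noteq> 0}"
          then have "z + y \<in> K" using \<psi>(2) closure_subset[of "{z. \<psi> z \<noteq> 0}"] by auto
          then show "z \<in> (\<lambda>x. x - y) ` K" by (force intro: image_eqI[of _ _ "z + y"])
        qed
        moreover have "closed ((\<lambda>x. x - y) ` K)" using K(1) by (intro compact_imp_closed compact_continuous_image continuous_intros) auto
        ultimately have "closure {z. \<psi> (z + y) \<noteq> 0} \<subseteq> (\<lambda>x. x - y) ` K" by (rule closure_minimal)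
        also have "\<dots> \<subseteq> ?B"
        proof
          fix x assume "x \<in> (\<lambda>x. x - y) ` K"
          then obtain k where "k \<in> K" "x = k - y" by blast
          then show "x \<in> ?B" using near[of k x] True by simp
        qed
        finally have supp: "closure {z. \<psi> (z + y) \<noteq> 0} \<subseteq> ?B" .
        have "time_deriv (\<lambda>z. \<psi> (z + y)) = (\<lambda>z. time_deriv \<psi> (z + y))" "space_grad (\<lambda>z. \<psi> (z + y)) = (\<lambda>z. space_grad \<psi> (z + y))"
          using lin by (auto simp: time_deriv_def space_grad_def fun_eq_iff vec_eq_iff)
        with ineq[OF lin(1) supp] \<psi>(3) show ?thesis
          using mollifierD(2)[OF \<eta>, of n y] by (intro mult_nonneg_nonneg) auto
      qed
    qed
    also have "\<dots> = (\<integral>y. - (\<eta> n y * (\<integral>z. ub z \<bullet> time_deriv \<psi> (z + y) \<partial>lborel)) + \<eta> n y * (\<integral>z. F z \<bullet> space_grad \<psi> (z + y) \<partial>lborel) \<partial>lborel)"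
      by (simp add: right_diff_distrib)
    also have "\<dots> = - (\<integral>z. w z * time_deriv \<psi> z \<partial>lborel) + (\<integral>z. conv (\<eta> n) F z \<bullet> space_grad \<psi> z \<partial>lborel)"
      using s1(2) s2(2) unfolding s2(1) by (subst Bochner_Integration.integral_add) (auto simp: s1(1)[symmetric, simplified] w_def)
    finally show "0 \<le> - (\<integral>z. w z * time_deriv \<psi> z \<partial>lborel) + (\<integral>z. conv (\<eta> n) F z \<bullet> space_grad \<psi> z \<partial>lborel)" .
  qed
qed

end

section \<open>The energy estimate\<close>

text \<open>Fubini, and for each fixed \<open>x\<close> the fundamental theorem of calculus in
  time.\<close>

lemma integral_time_deriv_zero:
  fixes \<Upsilon> :: "(real ^ 'n::finite) \<times> real \<Rightarrow> real"
  assumes C1: "C1_fun \<Upsilon>" and supp: "\<And>z. z \<notin> X \<times> {s..t} \<Longrightarrow> \<Upsilon> z = 0" and X: "compact X"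
  shows "(\<integral>z. time_deriv \<Upsilon> z \<partial>lborel) = 0" "integrable lborel (time_deriv \<Upsilon>)"
proof -
  have K: "compact (X \<times> {s..t})" by (intro compact_Times X) auto
  have "{z. \<Upsilon> z \<noteq> 0} \<subseteq> X \<times> {s..t}" using supp by blast
  then have "closure {z. \<Upsilon> z \<noteq> 0} \<subseteq> X \<times> {s..t}" by (rule closure_minimal) (rule compact_imp_closed[OF K])
  then have out: "time_deriv \<Upsilon> z = 0" if "z \<notin> X \<times> {s..t}" for z
    using that by (subst time_deriv_def) (subst frechet_derivative_zero_outside; auto)
  show int: "integrable lborel (time_deriv \<Upsilon>)"
    by (rule integrable_continuous_compact_support[OF C1_fun_time_deriv_continuous[OF C1] K out])
  have inner: "(\<integral>r. time_deriv \<Upsilon> (x, r) \<partial>lborel) = 0" for x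
  proof -
    \<comment> \<open>Both endpoints lie outside \<open>{s..t}\<close>, also when that interval is
      empty, so the boundary values vanish.\<close>
    let ?a = "min s t - 1" and ?b = "max s t + 1"
    have "(\<integral>r. time_deriv \<Upsilon> (x, r) * indicator {?a..?b} r \<partial>lborel) = \<Upsilon> (x, ?b) - \<Upsilon> (x, ?a)"
    proof (rule integral_FTC_Icc_real)
      fix r :: real
      have "((\<lambda>r. (x, r)) has_derivative (\<lambda>h. (0, h))) (at r)" by (auto intro!: derivative_eq_intros)
      from has_derivative_compose[OF this C1_funD(1)[OF C1, of "(x, r)"]]
      have d: "((\<lambda>r. \<Upsilon> (x, r)) has_derivative (\<lambda>h. FD \<Upsilon> (x, r) (0, h))) (at r)" .
      have "FD \<Upsilon> (x, r) (0, h) = h * time_deriv \<Upsilon> (x, r)" for h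
        using linear_scale[OF bounded_linear.linear[OF has_derivative_bounded_linear[OF C1_funD(1)[OF C1, of "(x, r)"]]], of h "(0, 1)"]
        by (simp add: time_deriv_def)
      then have "(\<lambda>h. FD \<Upsilon> (x, r) (0, h)) = (*) (time_deriv \<Upsilon> (x, r))"
        by (auto simp: fun_eq_iff mult.commute)
      with d show "((\<lambda>r. \<Upsilon> (x, r)) has_real_derivative time_deriv \<Upsilon> (x, r)) (at r)"
        by (simp add: has_field_derivative_def)
      have "continuous_on UNIV (\<lambda>r. time_deriv \<Upsilon> (x, r))"
        by (rule continuous_on_compose2[OF C1_fun_time_deriv_continuous[OF C1]]) (auto intro: continuous_intros)
      then show "isCont (\<lambda>r. time_deriv \<Upsilon> (x, r)) r" by (simp add: continuous_on_eq_continuous_at)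
    qed simp
    also have "\<Upsilon> (x, ?b) - \<Upsilon> (x, ?a) = 0" by (subst (1 2) supp) auto
    also have "(\<lambda>r. time_deriv \<Upsilon> (x, r) * indicator {?a..?b} r) = (\<lambda>r. time_deriv \<Upsilon> (x, r))"
    proof
      fix r show "time_deriv \<Upsilon> (x, r) * indicator {?a..?b} r = time_deriv \<Upsilon> (x, r)"
        using out[of "(x, r)"] by (cases "r \<in> {?a..?b}"; cases "s \<le> t") (auto simp: min_def max_def)
    qed
    finally show ?thesis .
  qed
  have "(\<integral>z. time_deriv \<Upsilon> z \<partial>(lborel \<Otimes>\<^sub>M lborel)) = (\<integral>x. (\<integral>r. time_deriv \<Upsilon> (x, r) \<partial>lborel) \<partial>lborel)"
    by (rule lborel_pair.integral_fst'[symmetric]) (simp add: lborel_prod int)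
  then show "(\<integral>z. time_deriv \<Upsilon> z \<partial>lborel) = 0" by (simp add: lborel_prod inner)
qed

definition grad :: "(real ^ 'n::finite \<Rightarrow> real) \<Rightarrow> real ^ 'n \<Rightarrow> real ^ 'n" where
  "grad \<zeta> x = (\<chi> i. FD \<zeta> x (axis i 1))"

context growth
begin

text \<open>The test function is \<open>p (w + c) * \<zeta> ^ Q * \<kappa>\<close>: coercivity
  produces the term with \<open>f\<close>, the time derivative the term with \<open>P\<close>. The
  shift \<open>c\<close> keeps the argument away from 0, where the profiles may blow up.
  \<open>M\<close> multiplies only the mollification error, so it may depend badly on
  \<open>c\<close>, while \<open>S\<close> measures the true error and has to be sharp.\<close>

lemma energy_estimate:
  fixes w :: "(real ^ 'n::finite) \<times> real \<Rightarrow> real" and F e and X :: "(real ^ 'n) set"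
    and t1 t2 C0 C1 c L M S \<epsilon> :: real and P p f \<kappa> \<kappa>' :: "real \<Rightarrow> real"
    and \<zeta> :: "real ^ 'n \<Rightarrow> real"
  defines "K \<equiv> X \<times> {t1..t2}"
  assumes C: "0 < C0" "0 < C1" and w: "C1_fun w" "\<And>z. 0 \<le> w z"
    and F: "integrable lborel F" and e: "integrable lborel e" "\<And>z. 0 \<le> e z"
    and coer: "\<And>z. z \<in> K \<Longrightarrow> C0 * G (norm (space_grad w z)) - e z \<le> F z \<bullet> space_grad w z"
    and bd: "\<And>z. z \<in> K \<Longrightarrow> norm (F z) \<le> C1 * g (norm (space_grad w z)) + e z"
    and weak: "\<And>\<psi>. C1_fun \<psi> \<Longrightarrow> closure {z. \<psi> z \<noteq> 0} \<subseteq> K \<Longrightarrow> (\<And>z. 0 \<le> \<psi> z) \<Longrightarrow>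
       0 \<le> - (\<integral>z. w z * time_deriv \<psi> z \<partial>lborel) + (\<integral>z. F z \<bullet> space_grad \<psi> z \<partial>lborel)"
    and X: "compact X" and t12: "t1 \<le> t2"
    and c: "0 < c" and P': "\<And>y. 0 < y \<Longrightarrow> (P has_real_derivative - p y) (at y)"
    and p': "\<And>y. 0 < y \<Longrightarrow> (p has_real_derivative - f y) (at y)" and cf: "continuous_on {0<..} f"
    and p0: "\<And>y. 0 < y \<Longrightarrow> 0 \<le> f y" "\<And>y. 0 < y \<Longrightarrow> 0 \<le> p y" "\<And>y. 0 < y \<Longrightarrow> p y \<le> y * f y"
    and M: "\<And>y. c \<le> y \<Longrightarrow> f y \<le> M" "\<And>y. c \<le> y \<Longrightarrow> p y \<le> M"
    and L: "0 < L" and S: "\<And>y. c \<le> y \<Longrightarrow> f y * G (y * L) \<le> S"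
    and \<zeta>: "C1_fun \<zeta>" "\<And>x. 0 \<le> \<zeta> x" "\<And>x. \<zeta> x \<le> 1" "\<And>x. norm (grad \<zeta> x) \<le> L" "\<And>x. x \<notin> X \<Longrightarrow> \<zeta> x = 0"
    and \<kappa>: "\<And>t. (\<kappa> has_real_derivative \<kappa>' t) (at t)" "continuous_on UNIV \<kappa>'" "\<And>t. 0 \<le> \<kappa> t" "\<And>t. \<kappa> t \<le> 1"
      "\<And>t. t \<notin> {t1..t2} \<Longrightarrow> \<kappa> t = 0"
    and \<epsilon>: "0 < \<epsilon>" "\<epsilon> \<le> 1" "2 * Q * C1 * \<epsilon> * Q \<le> C0"
  shows "C0 / 2 * (\<integral>z. f (w z + c) * G (norm (space_grad w z)) * \<zeta> (fst z) ^ Q * \<kappa> (snd z) \<partial>lborel)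
    \<le> (\<integral>z. P (w z + c) * \<zeta> (fst z) ^ Q * \<kappa>' (snd z) \<partial>lborel)
      + C0 / 2 * inverse \<epsilon> ^ Q * S * measure lborel X * (t2 - t1) + M * (1 + Q * L) * (\<integral>z. e z \<partial>lborel)"
proof -
  have y0: "0 < w z + c" "c \<le> w z + c" for z using w(2)[of z] c by auto
  have K: "compact K" unfolding K_def by (intro compact_Times X) auto
  define v where "v z = w z + c" for z
  have v: "C1_fun v" "FD v z = FD w z" for z
  proof -
    have d: "(v has_derivative FD w z) (at z)" for z
      unfolding v_def by (rule has_derivative_add_const) (rule C1_funD[OF w(1)])
    show "C1_fun v" "FD v z = FD w z" for z using C1_funI[OF d C1_funD(2)[OF w(1)]] by auto
  qed
  have v0: "0 < v z" "c \<le> v z" for z using y0[of z] by (auto simp: v_def)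
  have cv: "continuous_on UNIV v" using v(1) by (rule C1_fun_continuous)
  have cfv: "continuous_on UNIV (\<lambda>z. f (v z))"
    by (rule continuous_on_compose2[OF cf cv]) (use v0 in auto)
  have cpv: "continuous_on UNIV (\<lambda>z. p (v z))"
  proof (rule continuous_on_compose2[OF _ cv])
    show "continuous_on {0<..} p" by (rule DERIV_continuous_on) (use p' in \<open>auto intro: has_field_derivative_at_within\<close>)
  qed (use v0 in auto)
  have cPv: "continuous_on UNIV (\<lambda>z. P (v z))"
  proof (rule continuous_on_compose2[OF _ cv])
    show "continuous_on {0<..} P" by (rule DERIV_continuous_on) (use P' in \<open>auto intro: has_field_derivative_at_within\<close>)
  qed (use v0 in auto)
  have a: "C1_fun (\<lambda>z. p (v z))" "FD (\<lambda>z. p (v z)) z h = - f (v z) * FD w z h" for z h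
    using C1_fun_chain[OF v(1), of p "\<lambda>y. - f y", OF p'[OF v0(1)] continuous_on_minus[OF cfv]] by (simp_all add: v(2))
  have b: "C1_fun (\<lambda>z. P (v z))" "FD (\<lambda>z. P (v z)) z h = - p (v z) * FD w z h" for z h
    using C1_fun_chain[OF v(1), of P "\<lambda>y. - p y", OF P'[OF v0(1)] continuous_on_minus[OF cpv]] by (simp_all add: v(2))
  have z1: "C1_fun (\<lambda>z::(real^'n)\<times>real. \<zeta> (fst z))" "FD (\<lambda>z::(real^'n)\<times>real. \<zeta> (fst z)) z h = FD \<zeta> (fst z) (fst h)" for z h
    using C1_fun_linear[OF \<zeta>(1) bounded_linear_fst[where 'b = real], of 0] by auto
  have pw: "((\<lambda>r. r ^ Q) has_real_derivative Q * r ^ (Q - 1)) (at r)" for r :: real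
    using DERIV_pow[of Q r UNIV] by simp
  have z2: "C1_fun (\<lambda>z::(real^'n)\<times>real. \<zeta> (fst z) ^ Q)"
    "FD (\<lambda>z::(real^'n)\<times>real. \<zeta> (fst z) ^ Q) z h = Q * \<zeta> (fst z) ^ (Q - 1) * FD \<zeta> (fst z) (fst h)" for z h
  proof -
    have "continuous_on UNIV (\<lambda>z::(real^'n)\<times>real. Q * \<zeta> (fst z) ^ (Q - 1))"
      by (intro continuous_intros C1_fun_continuous[OF z1(1)])
    note * = C1_fun_chain[OF z1(1), of "\<lambda>r. r ^ Q" "\<lambda>r. Q * r ^ (Q - 1)", OF pw this]
    show "C1_fun (\<lambda>z::(real^'n)\<times>real. \<zeta> (fst z) ^ Q)" by (rule *(1))
    show "FD (\<lambda>z::(real^'n)\<times>real. \<zeta> (fst z) ^ Q) z h = Q * \<zeta> (fst z) ^ (Q - 1) * FD \<zeta> (fst z) (fst h)"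
      unfolding *(2) z1(2) ..
  qed
  have C\<kappa>: "C1_fun \<kappa>" "FD \<kappa> t = (\<lambda>h. \<kappa>' t * h)" for t
    using C1_funI[of \<kappa> "\<lambda>t h. \<kappa>' t * h", OF \<kappa>(1)[unfolded has_field_derivative_def] continuous_on_mult_right[OF \<kappa>(2)]] .
  have q: "C1_fun (\<lambda>z::(real^'n)\<times>real. \<kappa> (snd z))" "FD (\<lambda>z::(real^'n)\<times>real. \<kappa> (snd z)) z h = \<kappa>' (snd z) * snd h" for z h
    using C1_fun_linear[OF C\<kappa>(1) bounded_linear_snd[where 'a = "real^'n"], of 0] by (auto simp: C\<kappa>(2))
  define pq where "pq = (\<lambda>z::(real^'n)\<times>real. \<zeta> (fst z) ^ Q * \<kappa> (snd z))"
  have pq: "C1_fun pq" "FD pq z h = \<zeta> (fst z) ^ Q * (\<kappa>' (snd z) * snd h) + Q * \<zeta> (fst z) ^ (Q - 1) * FD \<zeta> (fst z) (fst h) * \<kappa> (snd z)" for z h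
    unfolding pq_def using C1_fun_mult[OF z2(1) q(1)] by (auto simp: z2(2) q(2))
  have pq0: "pq z = 0" if "z \<notin> K" for z
    using that \<zeta>(5)[of "fst z"] \<kappa>(5)[of "snd z"] Q_ge2 by (cases z) (auto simp: K_def pq_def zero_power)
  have pqn: "0 \<le> pq z" for z using \<zeta>(2) \<kappa>(3) by (simp add: pq_def)
  define \<psi> where "\<psi> = (\<lambda>z. p (v z) * pq z)"
  have \<psi>: "C1_fun \<psi>" "FD \<psi> z h = p (v z) * FD pq z h - f (v z) * FD w z h * pq z" for z h
    unfolding \<psi>_def using C1_fun_mult[OF a(1) pq(1)] by (auto simp: a(2))
  \<comment> \<open>Since \<open>P' = - p\<close>, the derivative of
    \<open>w * p (w + c) + P (w + c)\<close> in \<open>w\<close> is \<open>- w * f (w + c)\<close>,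
    the same as in \<open>w\<close> times the derivative of \<psi>. Hence the time derivatives match
    except for \<open>P\<close> times the derivative of the cut-off.\<close>
  define \<Upsilon> where "\<Upsilon> = (\<lambda>z. (w z * p (v z) + P (v z)) * pq z)"
  have wa: "C1_fun (\<lambda>z. w z * p (v z))" "FD (\<lambda>z. w z * p (v z)) z h = w z * (- f (v z) * FD w z h) + FD w z h * p (v z)" for z h
    using C1_fun_mult[OF w(1) a(1)] by (auto simp: a(2))
  have wab: "C1_fun (\<lambda>z. w z * p (v z) + P (v z))" "FD (\<lambda>z. w z * p (v z) + P (v z)) z h = - w z * f (v z) * FD w z h" for z h
    using C1_fun_add[OF wa(1) b(1)] by (auto simp: wa(2) b(2))
  have \<Upsilon>: "C1_fun \<Upsilon>" "FD \<Upsilon> z h = (w z * p (v z) + P (v z)) * FD pq z h - w z * f (v z) * FD w z h * pq z" for z h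
    unfolding \<Upsilon>_def using C1_fun_mult[OF wab(1) pq(1)] by (auto simp: wab(2))
  have t\<psi>: "w z * time_deriv \<psi> z = time_deriv \<Upsilon> z - P (v z) * \<zeta> (fst z) ^ Q * \<kappa>' (snd z)" for z
  proof -
    have "FD \<zeta> (fst z) 0 = 0"
      using linear_0[OF bounded_linear.linear[OF has_derivative_bounded_linear[OF C1_funD(1)[OF \<zeta>(1)]]]] .
    then have pqt: "FD pq z (0, 1) = \<zeta> (fst z) ^ Q * \<kappa>' (snd z)" by (simp add: pq(2))
    show ?thesis unfolding time_deriv_def \<psi>(2) \<Upsilon>(2) pqt by (simp add: algebra_simps)
  qed
  have z\<Upsilon>: "\<Upsilon> z = 0" if "z \<notin> X \<times> {t1..t2}" for z using pq0[of z] that by (simp add: \<Upsilon>_def K_def)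
  note int\<Upsilon> = integral_time_deriv_zero[OF \<Upsilon>(1) z\<Upsilon> X]
  have cfst: "continuous_on UNIV (\<lambda>z::(real^'n)\<times>real. \<zeta> (fst z))" using C1_fun_continuous[OF z1(1)] .
  have c\<kappa>: "continuous_on UNIV (\<lambda>z::(real^'n)\<times>real. \<kappa> (snd z))" using C1_fun_continuous[OF q(1)] .
  have c\<kappa>': "continuous_on UNIV (\<lambda>z::(real^'n)\<times>real. \<kappa>' (snd z))"
    by (rule continuous_on_compose2[OF \<kappa>(2)]) (auto intro: continuous_intros)
  have \<kappa>'0: "\<kappa>' t = 0" if "t \<notin> {t1..t2}" for t
  proof -
    have "closure {t. \<kappa> t \<noteq> 0} \<subseteq> {t1..t2}" by (rule closure_minimal) (use \<kappa>(5) in \<open>blast, simp\<close>)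
    then have "t \<notin> closure {t. \<kappa> t \<noteq> 0}" using that by blast
    from frechet_derivative_zero_outside[OF this] show ?thesis by (metis C\<kappa>(2) mult_1_right)
  qed
  have intP: "integrable lborel (\<lambda>z. P (v z) * \<zeta> (fst z) ^ Q * \<kappa>' (snd z))"
  proof (rule integrable_continuous_compact_support[OF _ K])
    show "continuous_on UNIV (\<lambda>z. P (v z) * \<zeta> (fst z) ^ Q * \<kappa>' (snd z))"
      by (intro continuous_intros cPv cfst c\<kappa>')
    show "P (v z) * \<zeta> (fst z) ^ Q * \<kappa>' (snd z) = 0" if "z \<notin> K" for z
      using that \<zeta>(5)[of "fst z"] \<kappa>'0[of "snd z"] Q_ge2 by (cases z) (auto simp: K_def zero_power)
  qed
  have eq1: "- (\<integral>z. w z * time_deriv \<psi> z \<partial>lborel) = (\<integral>z. P (v z) * \<zeta> (fst z) ^ Q * \<kappa>' (snd z) \<partial>lborel)"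
    unfolding t\<psi> using int\<Upsilon> intP by simp
  have "{z. \<psi> z \<noteq> 0} \<subseteq> K" using pq0 by (auto simp: \<psi>_def)
  then have supp: "closure {z. \<psi> z \<noteq> 0} \<subseteq> K" by (rule closure_minimal) (rule compact_imp_closed[OF K])
  have "0 \<le> \<psi> z" for z using p0(2)[OF v0(1)[of z]] pqn[of z] by (simp add: \<psi>_def)
  from weak[OF \<psi>(1) supp this] have main: "0 \<le> (\<integral>z. P (v z) * \<zeta> (fst z) ^ Q * \<kappa>' (snd z) \<partial>lborel) + (\<integral>z. F z \<bullet> space_grad \<psi> z \<partial>lborel)"
    unfolding eq1 .
  define Ce where "Ce = C0 / 2 * inverse \<epsilon> ^ Q"
  have Ce: "0 \<le> Ce" using C \<epsilon> by (simp add: Ce_def)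
  have M0: "0 \<le> M" using p0(1)[OF c] M(1)[of c] by simp
  have S0: "0 \<le> S" 
    by (rule order_trans[OF mult_nonneg_nonneg[OF p0(1)[OF c] G_nonneg] S[OF order_refl]]) (use c L in simp)
  define J where "J z = f (v z) * G (norm (space_grad w z)) * \<zeta> (fst z) ^ Q * \<kappa> (snd z)" for z
  have intJ: "integrable lborel J"
  proof (rule integrable_continuous_compact_support[OF _ K])
    have cG: "continuous_on UNIV (\<lambda>z. G (norm (space_grad w z)))"
      by (rule continuous_on_compose2[OF G_norm_continuous C1_fun_space_grad_continuous[OF w(1)]]) auto
    show "continuous_on UNIV J"
      unfolding J_def by (intro continuous_intros cfv cfst c\<kappa> cG)
    show "J z = 0" if "z \<notin> K" for z using pq0[OF that] by (simp add: J_def pq_def mult.assoc)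
  qed
  \<comment> \<open>The pointwise inequality \<open>energy_density\<close> at
    \<open>y = v z\<close>. The factor \<kappa> stays with the gradient term and is replaced by 1 in
    the nonnegative errors.\<close>
  have bound: "F z \<bullet> space_grad \<psi> z \<le> - (C0 / 2) * J z + Ce * S * indicator K z + M * (1 + Q * L) * e z" for z
  proof (cases "z \<in> K")
    case False
    have "space_grad \<psi> z = 0" by (rule derivs_zero_outside(2)[OF supp False])
    moreover have "J z = 0" using pq0[OF False] by (simp add: J_def pq_def mult.assoc)
    ultimately show ?thesis using False e(2)[of z] M0 L by simp
  next
    case True
    have ax: "FD pq z (axis i 1, 0) = Q * \<zeta> (fst z) ^ (Q - 1) * (grad \<zeta> (fst z) $ i) * \<kappa> (snd z)" for i
      by (simp add: pq(2) grad_def)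
    have sg: "space_grad \<psi> z = \<kappa> (snd z) *\<^sub>R (p (v z) *\<^sub>R ((Q * \<zeta> (fst z) ^ (Q - 1)) *\<^sub>R grad \<zeta> (fst z)) - (f (v z) * \<zeta> (fst z) ^ Q) *\<^sub>R space_grad w z)"
    proof -
      have "pq z = \<zeta> (fst z) ^ Q * \<kappa> (snd z)" by (simp add: pq_def)
      then show ?thesis by (simp add: vec_eq_iff space_grad_def \<psi>(2) ax algebra_simps)
    qed
    have "F z \<bullet> space_grad \<psi> z = \<kappa> (snd z) * (- f (v z) * \<zeta> (fst z) ^ Q * (F z \<bullet> space_grad w z) + p (v z) * (F z \<bullet> ((Q * \<zeta> (fst z) ^ (Q - 1)) *\<^sub>R grad \<zeta> (fst z))))"
      unfolding sg by (simp add: inner_diff_right algebra_simps)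
    also have "\<dots> \<le> \<kappa> (snd z) * (- (C0 / 2) * (f (v z) * G (norm (space_grad w z)) * \<zeta> (fst z) ^ Q) + C0 / 2 * inverse \<epsilon> ^ Q * (f (v z) * G (v z * L)) + (f (v z) + Q * L * p (v z)) * e z)"
      using v0[of z] p0[OF v0(1)[of z]] by (intro mult_left_mono \<kappa>(3) energy_density[OF C] coer[OF True] bd[OF True] \<zeta> L e(2) \<epsilon>) auto
    also have "\<dots> \<le> \<kappa> (snd z) * (- (C0 / 2) * (f (v z) * G (norm (space_grad w z)) * \<zeta> (fst z) ^ Q)) + 1 * (Ce * S + M * (1 + Q * L) * e z)"
    proof -
      have 1: "C0 / 2 * inverse \<epsilon> ^ Q * (f (v z) * G (v z * L)) \<le> Ce * S"
        unfolding Ce_def[symmetric] using S[OF v0(2)] Ce by (intro mult_left_mono)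
      have "f (v z) + Q * L * p (v z) \<le> M + Q * L * M"
        using M[OF v0(2)[of z]] L by (intro add_mono mult_left_mono) auto
      then have 2: "(f (v z) + Q * L * p (v z)) * e z \<le> M * (1 + Q * L) * e z"
        using e(2)[of z] by (intro mult_right_mono) (simp_all add: algebra_simps)
      have 3: "0 \<le> Ce * S + M * (1 + Q * L) * e z" using Ce S0 M0 L e(2)[of z] by simp
      have "\<kappa> (snd z) * (C0 / 2 * inverse \<epsilon> ^ Q * (f (v z) * G (v z * L)) + (f (v z) + Q * L * p (v z)) * e z) \<le> \<kappa> (snd z) * (Ce * S + M * (1 + Q * L) * e z)"
        using 1 2 \<kappa>(3) by (intro mult_left_mono add_mono) auto
      also have "\<dots> \<le> 1 * (Ce * S + M * (1 + Q * L) * e z)"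
        using \<kappa>(4) 3 by (intro mult_right_mono) auto
      finally have 4: "\<kappa> (snd z) * (C0 / 2 * inverse \<epsilon> ^ Q * (f (v z) * G (v z * L)) + (f (v z) + Q * L * p (v z)) * e z) \<le> 1 * (Ce * S + M * (1 + Q * L) * e z)" .
      have "k * (r1 + r2 + r3) \<le> k * r1 + 1 * r4" if "k * (r2 + r3) \<le> 1 * r4" for k r1 r2 r3 r4 :: real
        using that by (simp add: algebra_simps)
      from this[OF 4] show ?thesis .
    qed
    finally show ?thesis using True by (simp add: J_def mult_ac)
  qed
  have intsg: "integrable lborel (\<lambda>z. F z \<bullet> space_grad \<psi> z)"
  proof -
    obtain M2 where M2: "\<And>z. norm (space_grad \<psi> z) \<le> M2"
    proof (rule continuous_compact_support_bounded[OF C1_fun_space_grad_continuous[OF \<psi>(1)] K])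
      show "space_grad \<psi> z = 0" if "z \<notin> K" for z
        by (rule derivs_zero_outside(2)[OF supp that])
    qed blast
    show ?thesis
    proof (rule Bochner_Integration.integrable_bound)
      show "integrable lborel (\<lambda>z. M2 * norm (F z))" using F by simp
      show "(\<lambda>z. F z \<bullet> space_grad \<psi> z) \<in> borel_measurable lborel"
        using borel_measurable_integrable[OF F] borel_measurable_continuous_onI[OF C1_fun_space_grad_continuous[OF \<psi>(1)]] by simp
      show "AE z in lborel. norm (F z \<bullet> space_grad \<psi> z) \<le> norm (M2 * norm (F z))"
      proof (rule AE_I2)
        fix z
        have "\<bar>F z \<bullet> space_grad \<psi> z\<bar> \<le> norm (F z) * norm (space_grad \<psi> z)" by (rule Cauchy_Schwarz_ineq2)
        also have "\<dots> \<le> norm (F z) * M2" using M2 by (intro mult_left_mono) auto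
        finally show "norm (F z \<bullet> space_grad \<psi> z) \<le> norm (M2 * norm (F z))"
          by (simp add: mult.commute)
      qed
    qed
  qed
  have mK: "measure lborel K = measure lborel X * (t2 - t1)" "emeasure lborel K < \<infinity>"
  proof -
    have Xm: "X \<in> sets lborel" using X by (simp add: borel_compact)
    have "emeasure (lborel \<Otimes>\<^sub>M lborel) (X \<times> {t1..t2}) = emeasure lborel X * emeasure lborel {t1..t2}"
      by (rule lborel.emeasure_pair_measure_Times[OF Xm]) simp
    then have "emeasure lborel K = emeasure lborel X * ennreal (t2 - t1)" using t12 by (simp add: lborel_prod K_def)
    then show "measure lborel K = measure lborel X * (t2 - t1)" using t12 by (simp add: measure_def enn2real_mult)
    show "emeasure lborel K < \<infinity>" using emeasure_bounded_finite[OF compact_imp_bounded[OF K]] .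
  qed
  have Ksets: "K \<in> sets lborel" using K by (simp add: borel_compact)
  have iK: "integrable lborel (indicator K :: _ \<Rightarrow> real)" using mK(2) Ksets by (intro integrable_real_indicator) auto
  have "(\<integral>z. F z \<bullet> space_grad \<psi> z \<partial>lborel) \<le> (\<integral>z. - (C0 / 2) * J z + Ce * S * indicator K z + M * (1 + Q * L) * e z \<partial>lborel)"
    using intsg intJ iK e(1) by (intro integral_mono bound) auto
  also have "\<dots> = - (C0 / 2) * (\<integral>z. J z \<partial>lborel) + Ce * S * measure lborel K + M * (1 + Q * L) * (\<integral>z. e z \<partial>lborel)"
    using intJ iK e(1) Ksets by simp
  finally have "0 \<le> (\<integral>z. P (v z) * \<zeta> (fst z) ^ Q * \<kappa>' (snd z) \<partial>lborel) - C0 / 2 * (\<integral>z. J z \<partial>lborel)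
      + Ce * S * measure lborel X * (t2 - t1) + M * (1 + Q * L) * (\<integral>z. e z \<partial>lborel)"
    using main unfolding mK(1) by (simp add: mult.assoc)
  then show ?thesis unfolding Ce_def J_def v_def by linarith
qed

end

section \<open>Poincare's inequality\<close>

text \<open>Fundamental theorem of calculus along a segment, which convexity keeps inside
  \<open>K\<close>. The \<open>ennreal\<close> form lets the later exchanges of three integrals rest
  on Tonelli alone.\<close>

lemma C1_fun_segment:
  fixes H :: "'a::euclidean_space \<Rightarrow> real"
  assumes H: "C1_fun H" and b: "\<And>x v. \<bar>FD H x v\<bar> \<le> hn x * norm v"
    and K: "convex K" "x \<in> K" "y \<in> K" and d: "norm (x - y) \<le> d" and hn: "\<And>x. 0 \<le> hn x"
  shows "ennreal \<bar>H x - H y\<bar> \<le> (\<integral>\<^sup>+r. indicator {0..1} r * ennreal (indicator K (x + r *\<^sub>R (y - x)) * hn (x + r *\<^sub>R (y - x)) * d) \<partial>lborel)"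
proof -
  let ?p = "\<lambda>r. x + r *\<^sub>R (y - x)"
  let ?f = "\<lambda>r. FD H (?p r) (y - x)"
  have der: "((\<lambda>r. H (?p r)) has_real_derivative ?f r) (at r)" for r
  proof -
    have "(?p has_derivative (\<lambda>h. h *\<^sub>R (y - x))) (at r)" by (auto intro!: derivative_eq_intros)
    from has_derivative_compose[OF this C1_funD(1)[OF H, of "?p r"]]
    have "((\<lambda>r. H (?p r)) has_derivative (\<lambda>h. FD H (?p r) (h *\<^sub>R (y - x)))) (at r)" .
    moreover have "(\<lambda>h. FD H (?p r) (h *\<^sub>R (y - x))) = (*) (?f r)"
      using linear_scale[OF bounded_linear.linear[OF has_derivative_bounded_linear[OF C1_funD(1)[OF H, of "?p r"]]]]
      by (auto simp: fun_eq_iff mult.commute)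
    ultimately show ?thesis by (simp add: has_field_derivative_def)
  qed
  have cont: "continuous_on UNIV ?f"
    by (rule continuous_on_compose2[OF C1_funD(2)[OF H]]) (auto intro!: continuous_intros)
  have "(\<integral>r. ?f r * indicator {0..1} r \<partial>lborel) = H (?p 1) - H (?p 0)"
    by (rule integral_FTC_Icc_real[OF _ der]) (use cont in \<open>auto simp: continuous_on_eq_continuous_at\<close>)
  then have eq: "\<bar>H x - H y\<bar> = norm (\<integral>r. ?f r * indicator {0..1} r \<partial>lborel)" by simp
  have int: "integrable lborel (\<lambda>r. ?f r * indicator {0..1} r)"
    using borel_integrable_compact[of "{0..1::real}" ?f] continuous_on_subset[OF cont, of "{0..1}"]
    by (simp add: mult.commute)
  have "ennreal \<bar>H x - H y\<bar> \<le> (\<integral>\<^sup>+r. ennreal (norm (?f r * indicator {0..1} r)) \<partial>lborel)"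
    unfolding eq by (rule integral_norm_bound_ennreal[OF int])
  also have "\<dots> \<le> (\<integral>\<^sup>+r. indicator {0..1} r * ennreal (indicator K (?p r) * hn (?p r) * d) \<partial>lborel)"
  proof (rule nn_integral_mono)
    fix r :: real
    show "ennreal (norm (?f r * indicator {0..1} r)) \<le> indicator {0..1} r * ennreal (indicator K (?p r) * hn (?p r) * d)"
    proof (cases "r \<in> {0..1}")
      case True
      have "?p r = (1 - r) *\<^sub>R x + r *\<^sub>R y" by (simp add: algebra_simps)
      then have "?p r \<in> K" using K True by (auto intro: convexD)
      moreover have "\<bar>?f r\<bar> \<le> hn (?p r) * d"
        using b[of "?p r" "y - x"] mult_left_mono[OF d hn[of "?p r"]] by (simp add: norm_minus_commute)
      ultimately show ?thesis using True by (auto intro!: ennreal_leI)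
    qed simp
  qed
  finally show ?thesis .
qed

text \<open>In the average over pairs \<open>(x, y)\<close> of the gradient along the
  segment, the point \<open>x + r (y - x)\<close> is, for \<open>r \<le> 1/2\<close>, an affine image of \<open>x\<close> with ratio
  at least \<open>1/2\<close>, and for \<open>r \<ge> 1/2\<close> of \<open>y\<close>.\<close>

lemma poincare_zero_set:
  fixes H :: "'a::euclidean_space \<Rightarrow> real"
  assumes H: "C1_fun H" and H0: "\<And>x. 0 \<le> H x" and b: "\<And>x v. \<bar>FD H x v\<bar> \<le> hn x * norm v"
    and hn: "\<And>x. 0 \<le> hn x" "continuous_on UNIV hn"
    and K: "convex K" "compact K" and d: "\<And>x y. x \<in> K \<Longrightarrow> y \<in> K \<Longrightarrow> norm (x - y) \<le> d" "0 \<le> d"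
    and Z: "Z \<in> sets borel" "Z \<subseteq> K" "\<And>x. x \<in> Z \<Longrightarrow> H x = 0"
  shows "measure lborel Z * (\<integral>x. indicator K x * H x \<partial>lborel)
    \<le> 2 ^ DIM('a) * d * measure lborel K * (\<integral>x. indicator K x * hn x \<partial>lborel)"
proof -
  have Km[measurable]: "K \<in> sets borel" using K(2) by (rule borel_compact)
  note [measurable] = Z(1)
  have [measurable]: "H \<in> borel_measurable borel" "hn \<in> borel_measurable borel"
    using borel_measurable_continuous_onI C1_fun_continuous[OF H] hn(2) by auto
  define N where "N x = ennreal (indicator K x * hn x * d)" for x
  have [measurable]: "N \<in> borel_measurable borel" unfolding N_def by measurable
  define W where "W = (\<integral>\<^sup>+x. N x \<partial>lborel)"
  define \<mu> where "\<mu> = emeasure lborel K"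
  let ?c = "2 ^ DIM('a) :: ennreal"
  \<comment> \<open>An affine substitution of ratio \<open>c\<close> divides the integral by
    \<open>c\<close> to the power of the dimension, which for \<open>c \<ge> 1/2\<close> costs at
    most the factor \<open>2 ^ DIM('a)\<close>.\<close>
  have aff: "(\<integral>\<^sup>+x. N (t + c *\<^sub>R x) \<partial>lborel) \<le> ?c * W" if c: "1/2 \<le> c" for t c
  proof -
    have "(\<integral>\<^sup>+x. N (t + c *\<^sub>R x) \<partial>lborel) \<le> (2 * ennreal c) ^ DIM('a) * (\<integral>\<^sup>+x. N (t + c *\<^sub>R x) \<partial>lborel)"
    proof -
      have "1 \<le> 2 * ennreal c"
      proof -
        have "ennreal 1 \<le> ennreal (2 * c)" using c by (intro ennreal_leI) auto
        then show ?thesis by (simp add: ennreal_mult')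
      qed
      then have "1 \<le> (2 * ennreal c) ^ DIM('a)" by (rule one_le_power)
      from mult_right_mono[OF this] show ?thesis by simp
    qed
    also have "\<dots> = ?c * W"
      unfolding W_def using c nn_integral_lborel_affine[of N c t] by (simp add: power_mult_distrib mult.assoc)
    finally show ?thesis .
  qed
  have slice: "(\<integral>\<^sup>+x. (\<integral>\<^sup>+y. indicator K x * indicator K y * N (x + r *\<^sub>R (y - x)) \<partial>lborel) \<partial>lborel) \<le> ?c * W * \<mu>" for r
  proof (cases "1/2 \<le> r")
    case True
    have "(\<integral>\<^sup>+x. (\<integral>\<^sup>+y. indicator K x * indicator K y * N (x + r *\<^sub>R (y - x)) \<partial>lborel) \<partial>lborel)
       \<le> (\<integral>\<^sup>+x. ?c * W * indicator K x \<partial>lborel)"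
    proof (rule nn_integral_mono)
      fix x
      have "(\<integral>\<^sup>+y. indicator K x * indicator K y * N (x + r *\<^sub>R (y - x)) \<partial>lborel) \<le> (\<integral>\<^sup>+y. indicator K x * N ((x - r *\<^sub>R x) + r *\<^sub>R y) \<partial>lborel)"
        by (rule nn_integral_mono) (auto simp: indicator_def algebra_simps)
      also have "\<dots> = indicator K x * (\<integral>\<^sup>+y. N ((x - r *\<^sub>R x) + r *\<^sub>R y) \<partial>lborel)"
        by (rule nn_integral_cmult) measurable
      also have "\<dots> \<le> indicator K x * (?c * W)" by (intro mult_left_mono aff True) auto
      finally show "(\<integral>\<^sup>+y. indicator K x * indicator K y * N (x + r *\<^sub>R (y - x)) \<partial>lborel) \<le> ?c * W * indicator K x"
        by (simp add: mult.commute)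
    qed
    also have "\<dots> = ?c * W * \<mu>" by (simp add: nn_integral_cmult \<mu>_def)
    finally show ?thesis .
  next
    case False
    have "(\<integral>\<^sup>+x. (\<integral>\<^sup>+y. indicator K x * indicator K y * N (x + r *\<^sub>R (y - x)) \<partial>lborel) \<partial>lborel)
       = (\<integral>\<^sup>+y. (\<integral>\<^sup>+x. indicator K x * indicator K y * N (x + r *\<^sub>R (y - x)) \<partial>lborel) \<partial>lborel)"
      by (rule lborel_pair.Fubini'[symmetric]) measurable
    also have "\<dots> \<le> (\<integral>\<^sup>+y. ?c * W * indicator K y \<partial>lborel)"
    proof (rule nn_integral_mono)
      fix y
      have "(\<integral>\<^sup>+x. indicator K x * indicator K y * N (x + r *\<^sub>R (y - x)) \<partial>lborel) \<le> (\<integral>\<^sup>+x. indicator K y * N (r *\<^sub>R y + (1 - r) *\<^sub>R x) \<partial>lborel)"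
        by (rule nn_integral_mono) (auto simp: indicator_def algebra_simps)
      also have "\<dots> = indicator K y * (\<integral>\<^sup>+x. N (r *\<^sub>R y + (1 - r) *\<^sub>R x) \<partial>lborel)"
        by (rule nn_integral_cmult) measurable
      also have "\<dots> \<le> indicator K y * (?c * W)" using False by (intro mult_left_mono aff) auto
      finally show "(\<integral>\<^sup>+x. indicator K x * indicator K y * N (x + r *\<^sub>R (y - x)) \<partial>lborel) \<le> ?c * W * indicator K y"
        by (simp add: mult.commute)
    qed
    also have "\<dots> = ?c * W * \<mu>" by (simp add: nn_integral_cmult \<mu>_def)
    finally show ?thesis .
  qed
  \<comment> \<open>As \<open>H\<close> vanishes on \<open>Z\<close>, the left side is the integral
    of \<open>H x - H y\<close> over \<open>x\<close> in \<open>K\<close> and \<open>y\<close> in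
    \<open>Z\<close>, to which the segment bound applies.\<close>
  have "emeasure lborel Z * (\<integral>\<^sup>+x. ennreal (indicator K x * H x) \<partial>lborel) = (\<integral>\<^sup>+x. ennreal (indicator K x * H x) * emeasure lborel Z \<partial>lborel)"
    by (subst nn_integral_multc) (simp_all add: mult.commute)
  also have "\<dots> = (\<integral>\<^sup>+x. (\<integral>\<^sup>+y. ennreal (indicator K x * H x) * indicator Z y \<partial>lborel) \<partial>lborel)"
    by (simp add: nn_integral_cmult)
  also have "\<dots> \<le> (\<integral>\<^sup>+x. (\<integral>\<^sup>+y. (\<integral>\<^sup>+r. indicator {0..1} r * (indicator K x * indicator K y * N (x + r *\<^sub>R (y - x))) \<partial>lborel) \<partial>lborel) \<partial>lborel)"
  proof (intro nn_integral_mono)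
    fix x y
    show "ennreal (indicator K x * H x) * indicator Z y \<le> (\<integral>\<^sup>+r. indicator {0..1} r * (indicator K x * indicator K y * N (x + r *\<^sub>R (y - x))) \<partial>lborel)"
    proof (cases "x \<in> K \<and> y \<in> Z")
      case True
      then have "x \<in> K" "y \<in> K" "H y = 0" using Z by auto
      with C1_fun_segment[OF H b K(1), of x y d] d hn H0[of x] True show ?thesis
        by (simp add: N_def)
    qed (auto simp: indicator_def)
  qed
  also have "\<dots> = (\<integral>\<^sup>+x. (\<integral>\<^sup>+r. (\<integral>\<^sup>+y. indicator {0..1} r * (indicator K x * indicator K y * N (x + r *\<^sub>R (y - x))) \<partial>lborel) \<partial>lborel) \<partial>lborel)"
    by (intro nn_integral_cong lborel_pair.Fubini') measurable
  also have "\<dots> = (\<integral>\<^sup>+r. (\<integral>\<^sup>+x. (\<integral>\<^sup>+y. indicator {0..1} r * (indicator K x * indicator K y * N (x + r *\<^sub>R (y - x))) \<partial>lborel) \<partial>lborel) \<partial>lborel)"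
    by (rule lborel_pair.Fubini') measurable
  also have "\<dots> = (\<integral>\<^sup>+r. indicator {0..1} r * (\<integral>\<^sup>+x. (\<integral>\<^sup>+y. indicator K x * indicator K y * N (x + r *\<^sub>R (y - x)) \<partial>lborel) \<partial>lborel) \<partial>lborel)"
    by (simp add: nn_integral_cmult)
  also have "\<dots> \<le> (\<integral>\<^sup>+r. indicator {0..1::real} r * (?c * W * \<mu>) \<partial>lborel)"
    by (intro nn_integral_mono mult_left_mono slice) auto
  also have "\<dots> = ?c * W * \<mu>" by (simp add: nn_integral_multc)
  finally have main: "emeasure lborel Z * (\<integral>\<^sup>+x. ennreal (indicator K x * H x) \<partial>lborel) \<le> ?c * W * \<mu>" .
  have iH: "integrable lborel (\<lambda>x. indicator K x * H x)"
    using borel_integrable_compact[OF K(2) continuous_on_subset[OF C1_fun_continuous[OF H]]] by simp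
  have iN: "integrable lborel (\<lambda>x. indicator K x * hn x)"
    using borel_integrable_compact[OF K(2) continuous_on_subset[OF hn(2)]] by simp
  have fK: "emeasure lborel K < \<infinity>" using emeasure_bounded_finite[OF compact_imp_bounded[OF K(2)]] .
  have fZ: "emeasure lborel Z < \<infinity>" using emeasure_mono[OF Z(2), of lborel] fK by (auto intro: le_less_trans)
  have 1: "(\<integral>\<^sup>+x. ennreal (indicator K x * H x) \<partial>lborel) = ennreal (\<integral>x. indicator K x * H x \<partial>lborel)"
    using iH H0 by (intro nn_integral_eq_integral) auto
  have 2: "W = ennreal ((\<integral>x. indicator K x * hn x \<partial>lborel) * d)"
    unfolding W_def N_def using iN hn(1) d(2) by (subst nn_integral_eq_integral) auto
  have 3: "emeasure lborel Z = ennreal (measure lborel Z)" "\<mu> = ennreal (measure lborel K)"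
    using fK fZ by (auto simp: \<mu>_def emeasure_eq_ennreal_measure less_top)
  have 4: "0 \<le> (\<integral>x. indicator K x * H x \<partial>lborel)" "0 \<le> (\<integral>x. indicator K x * hn x \<partial>lborel)"
    using H0 hn(1) by (auto intro!: integral_nonneg_AE)
  have c: "?c = ennreal (2 ^ DIM('a))" by (simp flip: ennreal_power)
  have "ennreal (measure lborel Z * (\<integral>x. indicator K x * H x \<partial>lborel)) \<le> ennreal (2 ^ DIM('a) * ((\<integral>x. indicator K x * hn x \<partial>lborel) * d) * measure lborel K)"
    using main unfolding 1 2 3 c using 4 d(2) by (simp flip: ennreal_mult)
  then have "measure lborel Z * (\<integral>x. indicator K x * H x \<partial>lborel) \<le> 2 ^ DIM('a) * ((\<integral>x. indicator K x * hn x \<partial>lborel) * d) * measure lborel K"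
    using 4 d(2) by (subst (asm) ennreal_le_iff) auto
  then show ?thesis by (simp add: mult_ac)
qed

section \<open>Profiles and cut-offs\<close>

text \<open>Near \<open>y\<close> the tail integral is a constant minus an indefinite integral based
  at a point below \<open>y\<close>. This remains true beyond \<open>l\<close>, where
  \<open>{y..l}\<close> is empty or a point and the integral is 0, in agreement with
  \<open>f = 0\<close>.\<close>

lemma tail_integral_deriv:
  fixes f :: "real \<Rightarrow> real"
  assumes f: "continuous_on {0<..} f" "\<And>y. l \<le> y \<Longrightarrow> f y = 0" and y: "0 < y"
  shows "((\<lambda>y. integral {y..l} f) has_real_derivative - f y) (at y)"
proof -
  define a b where "a = y / 2" and "b = max y l + 1"
  have ab: "0 < a" "a < y" "y < b" "l < b" using y by (auto simp: a_def b_def)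
  have cont: "continuous_on {s..b} f" if "a \<le> s" for s using that ab by (intro continuous_on_subset[OF f(1)]) auto
  then have int: "f integrable_on {s..b}" if "a \<le> s" for s using that by (intro integrable_continuous_interval) auto
  have eq: "integral {a..b} f - integral {a..s} f = integral {s..l} f" if s: "s \<in> {a<..<b}" for s
  proof -
    have "integral {a..s} f + integral {s..b} f = integral {a..b} f"
      using s by (intro Henstock_Kurzweil_Integration.integral_combine int) auto
    moreover have "integral {s..b} f = integral {s..l} f"
    proof (cases "s \<le> l")
      case True
      have "integral {s..l} f + integral {l..b} f = integral {s..b} f"
        using s True ab by (intro Henstock_Kurzweil_Integration.integral_combine int) auto
      moreover have "integral {l..b} f = integral {l..b} (\<lambda>_. 0)"
        by (rule Henstock_Kurzweil_Integration.integral_cong) (use f(2) in auto)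
      ultimately show ?thesis by simp
    next
      case False
      have "integral {s..b} f = integral {s..b} (\<lambda>_. 0)"
        by (rule Henstock_Kurzweil_Integration.integral_cong) (use f(2) False in auto)
      then show ?thesis using False by simp
    qed
    ultimately show ?thesis by linarith
  qed
  have "((\<lambda>s. integral {a..s} f) has_real_derivative f y) (at y within {a..b})"
    by (rule integral_has_real_derivative[OF cont]) (use ab in auto)
  then have "((\<lambda>s. integral {a..s} f) has_real_derivative f y) (at y)"
    using ab by (simp add: at_within_Icc_at)
  then have "((\<lambda>s. integral {a..b} f - integral {a..s} f) has_real_derivative 0 - f y) (at y)"
    by (intro derivative_intros)
  then have "((\<lambda>s. integral {a..b} f - integral {a..s} f) has_real_derivative - f y) (at y)" by simp
  then show ?thesis
    by (rule has_field_derivative_transform_within_open[of _ _ _ "{a<..<b}"]) (use ab eq in auto)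
qed

lemma tail_integral_eq:
  fixes f :: "real \<Rightarrow> real"
  assumes d: "\<And>y. 0 < y \<Longrightarrow> y \<le> l \<Longrightarrow> (J has_real_derivative - f y) (at y)" and J: "J l = 0" and y: "0 < y" "y \<le> l"
  shows "integral {y..l} f = J y"
proof -
  have "(f has_integral (- J l - - J y)) {y..l}"
  proof (rule fundamental_theorem_of_calculus[OF y(2)])
    fix x assume "x \<in> {y..l}"
    then have "((\<lambda>x. - J x) has_real_derivative f x) (at x)" using DERIV_minus[OF d[of x]] y by simp
    then show "((\<lambda>x. - J x) has_vector_derivative f x) (at x within {y..l})"
      by (simp add: has_real_derivative_iff_has_vector_derivative[symmetric] has_field_derivative_at_within)
  qed
  then show ?thesis using J by (simp add: integral_unique)
qed

text \<open>The monotonicity of \<open>m(y) y\<^sup>2\<close> gives \<open>p(y) \<le> y f(y)\<close>, which makes the error term of the energy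
  estimate comparable with \<open>f(y) G(y L)\<close>.\<close>

locale profile =
  fixes m :: "real \<Rightarrow> real" and l :: real
  assumes m: "continuous_on {0<..} m" "\<And>y. 0 < y \<Longrightarrow> 0 \<le> m y"
    and mono: "\<And>y z. 0 < y \<Longrightarrow> y \<le> z \<Longrightarrow> m z * z\<^sup>2 \<le> m y * y\<^sup>2" and l: "0 < l"
begin

text \<open>Continuous truncation at the level \<open>l\<close>, which makes \<open>f\<close>,
  \<open>p\<close> and \<open>P\<close> vanish above it. Being decreasing, it is compatible with the
  monotonicity of \<open>m y * y\<^sup>2\<close>; being quadratic, it keeps the integrals computed
  below elementary.\<close>

definition \<theta> :: "real \<Rightarrow> real" where "\<theta> y = max 0 (1 - (y / l)\<^sup>2)"
definition f :: "real \<Rightarrow> real" where "f y = m y * \<theta> y"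
definition p :: "real \<Rightarrow> real" where "p y = integral {y..l} f"
definition P :: "real \<Rightarrow> real" where "P y = integral {y..l} p"

lemma \<theta>_bounds: "0 \<le> \<theta> y" "\<theta> y \<le> 1" by (auto simp: \<theta>_def)

lemma \<theta>_zero: "l \<le> y \<Longrightarrow> \<theta> y = 0"
proof -
  assume "l \<le> y"
  then have "1 \<le> (y / l)\<^sup>2" using l by (intro one_le_power) auto
  then show ?thesis by (simp add: \<theta>_def)
qed

lemma \<theta>_antimono: "0 < y \<Longrightarrow> y \<le> z \<Longrightarrow> \<theta> z \<le> \<theta> y"
proof -
  assume "0 < y" "y \<le> z"
  then have "(y / l)\<^sup>2 \<le> (z / l)\<^sup>2" using l by (intro power_mono divide_right_mono) auto
  then show ?thesis by (auto simp: \<theta>_def)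
qed

lemma \<theta>_cont: "continuous_on S \<theta>"
  unfolding \<theta>_def[abs_def] using l by (intro continuous_intros) auto

lemma f_cont: "continuous_on {0<..} f"
  unfolding f_def[abs_def] by (intro continuous_intros m(1) \<theta>_cont)

lemma f_nonneg: "0 < y \<Longrightarrow> 0 \<le> f y" using m(2) \<theta>_bounds by (simp add: f_def)

lemma f_zero: "l \<le> y \<Longrightarrow> f y = 0" by (simp add: f_def \<theta>_zero)

lemma p_zero: "l \<le> y \<Longrightarrow> p y = 0"
proof -
  assume y: "l \<le> y"
  have "integral {y..l} f = integral {y..l} (\<lambda>_. 0)"
    by (rule Henstock_Kurzweil_Integration.integral_cong) (use y f_zero in auto)
  then show ?thesis by (simp add: p_def)
qed

lemma p_deriv: "0 < y \<Longrightarrow> (p has_real_derivative - f y) (at y)"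
  unfolding p_def[abs_def] by (rule tail_integral_deriv[OF f_cont f_zero])

lemma p_cont: "continuous_on {0<..} p"
  by (rule DERIV_continuous_on) (use p_deriv in \<open>auto intro: has_field_derivative_at_within\<close>)

lemma P_deriv: "0 < y \<Longrightarrow> (P has_real_derivative - p y) (at y)"
  unfolding P_def[abs_def] by (rule tail_integral_deriv[OF p_cont p_zero])

lemma f_integrable: "0 < y \<Longrightarrow> f integrable_on {y..z}"
  by (intro integrable_continuous_interval continuous_on_subset[OF f_cont]) auto

lemma p_integrable: "0 < y \<Longrightarrow> p integrable_on {y..z}"
  by (intro integrable_continuous_interval continuous_on_subset[OF p_cont]) auto

lemma p_nonneg: "0 < y \<Longrightarrow> 0 \<le> p y"
  unfolding p_def by (intro integral_nonneg f_integrable) (auto intro!: f_nonneg)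

lemma P_nonneg: "0 < y \<Longrightarrow> 0 \<le> P y"
  unfolding P_def by (intro integral_nonneg p_integrable) (auto intro!: p_nonneg)

lemma P_antimono:
  assumes "0 < y" "y \<le> z" shows "P z \<le> P y"
  using assms(2)
proof (rule DERIV_nonpos_imp_nonincreasing)
  fix x assume "y \<le> x" "x \<le> z"
  then show "\<exists>d. (P has_real_derivative d) (at x) \<and> d \<le> 0"
    using P_deriv[of x] p_nonneg[of x] assms(1) by (intro exI[of _ "- p x"]) auto
qed

lemma P_zero: "l \<le> y \<Longrightarrow> P y = 0"
proof -
  assume y: "l \<le> y"
  have "integral {y..l} p = integral {y..l} (\<lambda>_. 0)"
    by (rule Henstock_Kurzweil_Integration.integral_cong) (use y p_zero in auto)
  then show ?thesis by (simp add: P_def)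
qed

text \<open>Both \<open>m x * x\<^sup>2\<close> and \<open>\<theta> x\<close> are nonincreasing, so
  \<open>f x \<le> y\<^sup>2 * f y / x\<^sup>2\<close> on \<open>{y..l}\<close>, and the integral of
  \<open>1 / x\<^sup>2\<close> from \<open>y\<close> to \<open>l\<close> is at most
  \<open>1 / y\<close>.\<close>

lemma p_le:
  assumes y: "0 < y" shows "p y \<le> y * f y"
proof (cases "y < l")
  case False then show ?thesis using p_zero[of y] f_zero[of y] by simp
next
  case True
  define J where "J x = y\<^sup>2 * f y * (inverse x - inverse l)" for x
  have dJ: "(J has_real_derivative - (y\<^sup>2 * f y * (inverse x)\<^sup>2)) (at x)" if "0 < x" for x
    unfolding J_def[abs_def] using that by (auto intro!: derivative_eq_intros simp: power2_eq_square)
  have "integral {y..l} (\<lambda>x. y\<^sup>2 * f y * (inverse x)\<^sup>2) = J y"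
  proof (rule tail_integral_eq[OF dJ _ y])
    show "J l = 0" by (simp add: J_def)
  qed (use True in auto)
  moreover have "p y \<le> integral {y..l} (\<lambda>x. y\<^sup>2 * f y * (inverse x)\<^sup>2)"
    unfolding p_def
  proof (rule integral_le)
    show "(\<lambda>x. y\<^sup>2 * f y * (inverse x)\<^sup>2) integrable_on {y..l}"
      using y by (intro integrable_continuous_interval continuous_intros) auto
    fix x assume x: "x \<in> {y..l}"
    have "m x * x\<^sup>2 * \<theta> x \<le> m y * y\<^sup>2 * \<theta> y"
      using x y m(2)[OF y] by (intro mult_mono mono \<theta>_antimono \<theta>_bounds) auto
    then show "f x \<le> y\<^sup>2 * f y * (inverse x)\<^sup>2"
      using x y by (simp add: f_def field_simps power2_eq_square)
  qed (use f_integrable[OF y] in auto)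
  moreover have "J y \<le> y\<^sup>2 * f y * inverse y"
    unfolding J_def using f_nonneg[OF y] l by (intro mult_left_mono) auto
  moreover have "y\<^sup>2 * f y * inverse y = y * f y" using y by (simp add: power2_eq_square)
  ultimately show ?thesis by simp
qed

text \<open>Crude bounds that provide the constant \<open>M\<close> of the energy estimate, where
  their growth for small \<open>c\<close> is harmless.\<close>

lemma f_bound:
  assumes "0 < c" "c \<le> y" shows "f y \<le> m c" "p y \<le> m c * c"
proof -
  have y: "0 < y" using assms by simp
  have fm: "f y \<le> m y" using \<theta>_bounds m(2)[OF y] by (simp add: f_def mult_left_le)
  have 1: "m y * y\<^sup>2 \<le> m c * c\<^sup>2" using mono assms by blast
  have "m y * c\<^sup>2 \<le> m y * y\<^sup>2" using assms m(2)[OF y] by (intro mult_left_mono power_mono) auto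
  with 1 have "m y * c\<^sup>2 \<le> m c * c\<^sup>2" by linarith
  then have "m y \<le> m c" using assms by simp
  with fm show "f y \<le> m c" by simp
  have "y * m y * c \<le> y * m y * y" using assms m(2)[OF y] y by (intro mult_left_mono) auto
  with 1 have "y * m y * c \<le> m c * c * c" by (simp add: power2_eq_square mult_ac)
  then have "y * m y \<le> m c * c" using assms by simp
  moreover have "p y \<le> y * m y" using p_le[OF y] mult_left_mono[OF fm, of y] y by linarith
  ultimately show "p y \<le> m c * c" by linarith
qed

text \<open>From \<open>p x \<le> x * m x \<le> m c * c\<^sup>2 / x\<close>, whose integral is a
  logarithm. The prefactor is 1 for the profile \<open>inverse (y\<^sup>2)\<close> and an intrinsic
  time for the profile \<open>inverse (G (y * L))\<close>.\<close>

lemma P_le: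
  assumes c: "0 < c" "c \<le> l" shows "P c \<le> m c * c\<^sup>2 * ln (l / c)"
proof -
  define J where "J x = m c * c\<^sup>2 * (ln l - ln x)" for x
  have "integral {c..l} (\<lambda>x. m c * c\<^sup>2 * inverse x) = J c"
  proof (rule tail_integral_eq[OF _ _ c])
    show "(J has_real_derivative - (m c * c\<^sup>2 * inverse x)) (at x)" if "0 < x" for x
      unfolding J_def[abs_def] using that by (auto intro!: derivative_eq_intros simp: inverse_eq_divide)
  qed (simp add: J_def)
  moreover have "P c \<le> integral {c..l} (\<lambda>x. m c * c\<^sup>2 * inverse x)"
    unfolding P_def
  proof (rule integral_le)
    show "(\<lambda>x. m c * c\<^sup>2 * inverse x) integrable_on {c..l}"
      using c by (intro integrable_continuous_interval continuous_intros) auto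
    fix x assume x: "x \<in> {c..l}"
    have x0: "0 < x" using x c by simp
    have "p x \<le> x * m x"
    proof -
      have "f x \<le> m x" using \<theta>_bounds m(2)[OF x0] by (simp add: f_def mult_left_le)
      from mult_left_mono[OF this, of x] p_le[OF x0] x0 show ?thesis by linarith
    qed
    also have "\<dots> \<le> m c * c\<^sup>2 * inverse x" using mono[OF c(1), of x] x x0 by (simp add: field_simps power2_eq_square)
    finally show "p x \<le> m c * c\<^sup>2 * inverse x" .
  qed (use p_integrable[OF c(1)] in auto)
  ultimately have "P c \<le> J c" by linarith
  then show ?thesis using c by (simp add: J_def ln_div)
qed

end

text \<open>For this profile \<open>P y\<close> equals
  \<open>ln (l / y) - 3/2 + 2 * (y / l) - (y / l)\<^sup>2 / 2\<close>, and the last two terms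
  together are nonnegative for \<open>y \<le> l\<close>.\<close>

lemma profile_log_lower:
  assumes "0 < l" "0 < y" "y \<le> l"
  shows "ln (l / y) - 3/2 \<le> profile.P (\<lambda>y. inverse (y\<^sup>2)) l y"
proof -
  interpret profile "\<lambda>y. inverse (y\<^sup>2)" l
    by unfold_locales (use assms in \<open>auto intro!: continuous_intros\<close>)
  have "p x = inverse x - 2 / l + x / l\<^sup>2" if x: "0 < x" "x \<le> l" for x
    unfolding p_def
  proof (rule tail_integral_eq[OF _ _ x])
    fix z assume z: "0 < z" "z \<le> l"
    have "(z / l)\<^sup>2 \<le> 1" using z by (intro power_le_one) auto
    then have "f z = inverse (z\<^sup>2) * (1 - (z / l)\<^sup>2)" unfolding f_def \<theta>_def by simp
    also have "\<dots> = inverse (z\<^sup>2) - inverse (l\<^sup>2)" using z by (simp add: field_simps)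
    finally have "f z = inverse (z\<^sup>2) - inverse (l\<^sup>2)" .
    then show "((\<lambda>x. inverse x - 2 / l + x / l\<^sup>2) has_real_derivative - f z) (at z)"
      using z assms by (auto intro!: derivative_eq_intros simp: power2_eq_square inverse_eq_divide)
  qed (use assms in \<open>simp add: power2_eq_square field_simps\<close>)
  note peq = this
  have "P y = ln (l / y) - 2 * (l - y) / l + (l\<^sup>2 - y\<^sup>2) / (2 * l\<^sup>2)"
    unfolding P_def
  proof (rule tail_integral_eq[OF _ _ assms(2,3)])
    fix z assume z: "0 < z" "z \<le> l"
    show "((\<lambda>y. ln (l / y) - 2 * (l - y) / l + (l\<^sup>2 - y\<^sup>2) / (2 * l\<^sup>2)) has_real_derivative - p z) (at z)"
      unfolding peq[OF z] using z assms by (auto intro!: derivative_eq_intros simp: field_simps power2_eq_square)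
  qed (use assms in simp)
  also have "\<dots> = ln (l / y) - 3/2 + (2 * (y / l) - (y / l)\<^sup>2 / 2)"
    using assms by (simp add: field_simps power2_eq_square)
  also have "\<dots> \<ge> ln (l / y) - 3/2"
  proof -
    have "(y / l)\<^sup>2 \<le> y / l" using assms power_decreasing[of 1 2 "y / l"] by simp
    moreover have "0 \<le> y / l" using assms by simp
    ultimately show ?thesis by linarith
  qed
  finally show ?thesis .
qed

text \<open>Because \<open>\<sigma>'\<close> is nonnegative of mass one and lives on
  \<open>{a..a+h}\<close>, integrating against it approximates evaluation at time \<open>a\<close>
  when \<open>h\<close> is small.\<close>

lemma smoothstep:
  fixes a h :: real
  assumes h: "0 < h"
  obtains \<sigma> \<sigma>' :: "real \<Rightarrow> real" where "\<And>t. (\<sigma> has_real_derivative \<sigma>' t) (at t)" "continuous_on UNIV \<sigma>'"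
    "\<And>t. 0 \<le> \<sigma>' t" "\<And>t. 0 \<le> \<sigma> t" "\<And>t. \<sigma> t \<le> 1" "\<And>t. t \<le> a \<Longrightarrow> \<sigma> t = 0" "\<And>t. a + h \<le> t \<Longrightarrow> \<sigma> t = 1"
    "\<And>t. t \<notin> {a..a+h} \<Longrightarrow> \<sigma>' t = 0" "integrable lborel \<sigma>'" "(\<integral>t. \<sigma>' t \<partial>lborel) = 1"
proof -
  define q where "q r = (max 0 r)\<^sup>2" for r :: real
  \<comment> \<open>A second difference of the squared positive part; its derivative
    \<open>S'\<close> is the tent over the unit interval with apex 2 at \<open>1/2\<close>.\<close>
  define S where "S x = 2 * (q x - 2 * q (x - 1/2) + q (x - 1))" for x
  define S' where "S' x = 4 * (max 0 x - 2 * max 0 (x - 1/2) + max 0 (x - 1))" for x :: real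
  have dq: "(q has_real_derivative 2 * max 0 r) (at r)" for r
    unfolding q_def[abs_def] by (rule pos_square_deriv)
  have dS: "(S has_real_derivative S' x) (at x)" for x
  proof -
    have *: "((\<lambda>x. q (x - e)) has_real_derivative 2 * max 0 (x - e)) (at x)" for e
      using DERIV_shift[of q "2 * max 0 (x - e)" x "- e"] dq[of "x - e"] by simp
    show ?thesis unfolding S_def[abs_def] S'_def
      by (rule derivative_eq_intros dq * refl)+ simp
  qed
  have S'0: "0 \<le> S' x" for x unfolding S'_def by (auto simp: max_def)
  have S0: "S x = 0" if "x \<le> 0" for x using that by (simp add: S_def q_def)
  have S1: "S x = 1" if "1 \<le> x" for x using that by (simp add: S_def q_def power2_eq_square algebra_simps)
  have Smono: "S x \<le> S y" if "x \<le> y" for x y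
    by (rule DERIV_nonneg_imp_nondecreasing[OF that]) (use dS S'0 in blast)
  have Sb: "0 \<le> S x" "S x \<le> 1" for x
    using Smono[of "min x 0" x] S0[of "min x 0"] Smono[of x "max x 1"] S1[of "max x 1"] by auto
  define \<sigma> where "\<sigma> t = S ((t - a) / h)" for t
  define \<sigma>' where "\<sigma>' t = S' ((t - a) / h) / h" for t
  have d: "(\<sigma> has_real_derivative \<sigma>' t) (at t)" for t
  proof -
    have "((\<lambda>t. (t - a) / h) has_real_derivative 1 / h) (at t)" using h by (auto intro!: derivative_eq_intros)
    from DERIV_chain2[OF dS this] show ?thesis by (simp add: \<sigma>_def[abs_def] \<sigma>'_def)
  qed
  have c: "continuous_on UNIV \<sigma>'" unfolding \<sigma>'_def S'_def using h by (intro continuous_intros) auto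
  have out: "\<sigma>' t = 0" if "t \<notin> {a..a+h}" for t
  proof -
    have "(t - a) / h < 0 \<or> 1 < (t - a) / h" using that h by (auto simp: field_simps)
    moreover have "S' x = 0" if "x < 0 \<or> 1 < x" for x using that by (auto simp: S'_def max_def)
    ultimately show ?thesis by (simp add: \<sigma>'_def)
  qed
  have i: "integrable lborel \<sigma>'" by (rule integrable_continuous_compact_support[OF c compact_Icc out])
  have "(\<integral>t. \<sigma>' t * indicator {a..a+h} t \<partial>lborel) = \<sigma> (a + h) - \<sigma> a"
    by (rule integral_FTC_Icc_real[OF _ d]) (use h c in \<open>auto simp: continuous_on_eq_continuous_at\<close>)
  also have "(\<lambda>t. \<sigma>' t * indicator {a..a+h} t) = \<sigma>'"
  proof
    fix t show "\<sigma>' t * indicator {a..a+h} t = \<sigma>' t" using out[of t] by (cases "t \<in> {a..a+h}") auto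
  qed
  finally have int: "(\<integral>t. \<sigma>' t \<partial>lborel) = 1" using h by (simp add: \<sigma>_def S0 S1)
  show ?thesis
    by (rule that[OF d c _ _ _ _ _ out i int]) (use S'0 Sb S0 S1 h in \<open>auto simp: \<sigma>_def \<sigma>'_def divide_le_0_iff le_divide_eq\<close>)
qed

text \<open>The closed counterpart of \<open>cube\<close>: supports of test functions, uniform
  continuity and Poincare's inequality all want a compact convex set.\<close>

definition ccube :: "real \<Rightarrow> (real ^ 'n::finite) set" where
  "ccube \<rho> = cbox (\<chi> i. - \<rho>) (\<chi> i. \<rho>)"

lemma mem_ccube: "x \<in> ccube \<rho> \<longleftrightarrow> (\<forall>i. \<bar>x $ i\<bar> \<le> \<rho>)"
  by (auto simp: ccube_def mem_box_cart abs_le_iff minus_le_iff)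

lemma cube_eq_box: "cube \<rho> = box (\<chi> i. - \<rho>) (\<chi> i. \<rho>)"
  by (auto simp: cube_def mem_box_cart abs_less_iff minus_less_iff)

lemma ccube_convex_compact: "convex (ccube \<rho>)" "compact (ccube \<rho>)"
  by (auto simp: ccube_def convex_box)

lemma measure_ccube: "0 \<le> \<rho> \<Longrightarrow> measure lborel (ccube \<rho> :: (real ^ 'n::finite) set) = (2 * \<rho>) ^ CARD('n)"
  unfolding ccube_def by (subst content_cbox_cart) (auto simp: interval_eq_empty_cart)

lemma measure_cube:
  assumes "0 \<le> \<rho>"
  shows "measure lborel (cube \<rho> :: (real ^ 'n::finite) set) = (2 * \<rho>) ^ CARD('n)"
proof -
  have "measure lborel (cube \<rho> :: (real ^ 'n) set) = measure lborel (ccube \<rho> :: (real ^ 'n) set)"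
    by (simp add: cube_eq_box ccube_def measure_def emeasure_lborel_box_eq emeasure_lborel_cbox_eq)
  then show ?thesis using assms by (simp add: measure_ccube)
qed

lemma ccube_diam:
  fixes x y :: "real ^ 'n::finite"
  assumes "x \<in> ccube \<rho>" "y \<in> ccube \<rho>" shows "norm (x - y) \<le> 2 * real CARD('n) * \<rho>"
proof -
  have "norm (x - y) \<le> (\<Sum>i\<in>UNIV. \<bar>(x - y) $ i\<bar>)" by (rule norm_le_l1_cart)
  also have "\<dots> \<le> (\<Sum>i\<in>(UNIV::'n set). 2 * \<rho>)"
  proof (rule sum_mono)
    fix i :: 'n
    show "\<bar>(x - y) $ i\<bar> \<le> 2 * \<rho>" using assms[unfolded mem_ccube, rule_format, of i] by simp
  qed
  finally show ?thesis by (simp add: mult_ac)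
qed

text \<open>In the proof \<open>1 - E x\<close> is the squared distance from \<open>x\<close> to
  \<open>ccube r\<close> in units of \<open>d\<close>, and \<zeta> is the squared positive part of
  \<open>E\<close>. Where \<open>E\<close> is positive each coordinate exceeds \<open>r\<close> by
  at most \<open>d\<close>, so the partial derivatives of \<open>E\<close> are at most
  \<open>2 / d\<close> and those of \<zeta> at most \<open>4 / d\<close>. The factor
  \<open>CARD('n)\<close> comes from bounding the norm by the sum of the coordinates.\<close>

lemma space_cutoff:
  fixes r d :: real
  assumes r: "0 < r" and d: "0 < d"
  obtains \<zeta> :: "real ^ 'n::finite \<Rightarrow> real" where "C1_fun \<zeta>" "\<And>x. 0 \<le> \<zeta> x" "\<And>x. \<zeta> x \<le> 1"
    "\<And>x. norm (\<chi> i. FD \<zeta> x (axis i 1)) \<le> 4 * real CARD('n) / d"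
    "\<And>x. x \<in> ccube r \<Longrightarrow> \<zeta> x = 1" "\<And>x. x \<notin> ccube (r + d) \<Longrightarrow> \<zeta> x = 0"
proof -
  define q where "q s = (max 0 s)\<^sup>2" for s :: real
  define E where "E x = 1 - (\<Sum>i\<in>UNIV. q (x $ i - r) + q (- (x $ i) - r)) / d\<^sup>2" for x :: "real ^ 'n"
  define E' where "E' x v = - (\<Sum>i\<in>UNIV. 2 * max 0 (x $ i - r) * v $ i - 2 * max 0 (- (x $ i) - r) * v $ i) / d\<^sup>2" for x v :: "real ^ 'n"
  define \<zeta> where "\<zeta> x = q (E x)" for x
  have dq: "(q has_derivative (\<lambda>h. 2 * max 0 s * h)) (at s)" for s
    using pos_square_deriv[of s] unfolding q_def[abs_def] has_field_derivative_def .
  have dE: "(E has_derivative E' x) (at x)" for x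
  proof -
    have 1: "((\<lambda>x::real^'n. q (x $ i - r)) has_derivative (\<lambda>v. 2 * max 0 (x $ i - r) * v $ i)) (at x)" for i
    proof -
      have "((\<lambda>x::real^'n. x $ i - r) has_derivative (\<lambda>v. v $ i)) (at x)"
        by (auto intro!: derivative_eq_intros bounded_linear_imp_has_derivative bounded_linear_vec_nth)
      from has_derivative_compose[OF this dq] show ?thesis .
    qed
    have 2: "((\<lambda>x::real^'n. q (- (x $ i) - r)) has_derivative (\<lambda>v. - (2 * max 0 (- (x $ i) - r) * v $ i))) (at x)" for i
    proof -
      have "((\<lambda>x::real^'n. - (x $ i) - r) has_derivative (\<lambda>v. - (v $ i))) (at x)"
        by (auto intro!: derivative_eq_intros bounded_linear_imp_has_derivative bounded_linear_vec_nth)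
      from has_derivative_compose[OF this dq] show ?thesis by simp
    qed
    have "((\<lambda>x. \<Sum>i\<in>UNIV. q (x $ i - r) + q (- (x $ i) - r)) has_derivative
        (\<lambda>v. \<Sum>i\<in>UNIV. 2 * max 0 (x $ i - r) * v $ i + - (2 * max 0 (- (x $ i) - r) * v $ i))) (at x)"
      by (intro has_derivative_sum has_derivative_add 1 2)
    from has_derivative_diff[OF has_derivative_const[of 1] has_derivative_mult_left[OF this, of "inverse (d\<^sup>2)"]]
    have "(E has_derivative (\<lambda>v. 0 - (\<Sum>i\<in>UNIV. 2 * max 0 (x $ i - r) * v $ i + - (2 * max 0 (- (x $ i) - r) * v $ i)) * inverse (d\<^sup>2))) (at x)"
      by (simp add: E_def[abs_def] divide_inverse)
    then show ?thesis by (simp add: E'_def[abs_def] divide_inverse)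
  qed
  have d\<zeta>: "(\<zeta> has_derivative (\<lambda>v. 2 * max 0 (E x) * E' x v)) (at x)" for x
    using has_derivative_compose[OF dE dq] unfolding \<zeta>_def[abs_def] .
  have cE: "continuous_on UNIV E" unfolding E_def q_def using d by (intro continuous_intros) auto
  have cE': "continuous_on UNIV (\<lambda>x. E' x v)" for v
    unfolding E'_def using d by (intro continuous_intros) auto
  have cd: "continuous_on UNIV (\<lambda>x. 2 * max 0 (E x) * E' x v)" for v
    by (intro continuous_intros cE cE')
  note C = C1_funI[of \<zeta> "\<lambda>x v. 2 * max 0 (E x) * E' x v", OF d\<zeta> cd]
  have E1: "E x \<le> 1" for x unfolding E_def using d by (auto simp: q_def intro!: divide_nonneg_nonneg sum_nonneg)
  have summand: "q (x $ i - r) + q (- (x $ i) - r) \<le> (1 - E x) * d\<^sup>2" for x i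
  proof -
    have "q (x $ i - r) + q (- (x $ i) - r) \<le> (\<Sum>i\<in>UNIV. q (x $ i - r) + q (- (x $ i) - r))"
      by (rule member_le_sum) (auto simp: q_def)
    then show ?thesis using d by (simp add: E_def)
  qed
  show ?thesis
  proof (rule that)
    show "C1_fun \<zeta>" by (rule C(1))
    show "0 \<le> \<zeta> x" for x by (simp add: \<zeta>_def q_def)
    show "\<zeta> x \<le> 1" for x unfolding \<zeta>_def q_def using E1[of x] by (intro power_le_one) auto
    show "\<zeta> x = 1" if "x \<in> ccube r" for x
    proof -
      have "q (x $ i - r) + q (- (x $ i) - r) = 0" for i
        using that[unfolded mem_ccube, rule_format, of i] by (simp add: q_def abs_le_iff)
      then show ?thesis by (simp add: \<zeta>_def q_def E_def)
    qed
    show "\<zeta> x = 0" if "x \<notin> ccube (r + d)" for x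
    proof -
      have "\<exists>i. r + d < \<bar>x $ i\<bar>" using that by (simp add: mem_ccube not_le)
      then obtain i where i: "r + d < \<bar>x $ i\<bar>" by blast
      have "d\<^sup>2 \<le> q (x $ i - r) + q (- (x $ i) - r)"
      proof (cases "0 \<le> x $ i")
        case True
        then have "d\<^sup>2 \<le> q (x $ i - r)" using i d unfolding q_def by (intro power_mono) auto
        then show ?thesis by (simp add: q_def add_increasing2)
      next
        case False
        then have "d\<^sup>2 \<le> q (- (x $ i) - r)" using i d unfolding q_def by (intro power_mono) auto
        then show ?thesis by (simp add: q_def add_increasing)
      qed
      also have "\<dots> \<le> (1 - E x) * d\<^sup>2" by (rule summand)
      finally have "E x \<le> 0" using d by (simp add: algebra_simps mult_le_0_iff)
      then show ?thesis by (simp add: \<zeta>_def q_def)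
    qed
    fix x
    have comp: "\<bar>FD \<zeta> x (axis i 1)\<bar> \<le> 4 / d" for i
    proof (cases "0 < E x")
      case False
      then show ?thesis using d by (simp add: C(2))
    next
      case True
      have "E' x (axis i 1) = - (\<Sum>j\<in>UNIV. if j = i then 2 * max 0 (x $ i - r) - 2 * max 0 (- (x $ i) - r) else 0) / d\<^sup>2"
        unfolding E'_def by (intro arg_cong[where f = "\<lambda>s. - s / d\<^sup>2"] sum.cong refl) (auto simp: axis_def)
      then have E': "E' x (axis i 1) = - (2 * max 0 (x $ i - r) - 2 * max 0 (- (x $ i) - r)) / d\<^sup>2" by simp
      have "q (x $ i - r) + q (- (x $ i) - r) \<le> 1 * d\<^sup>2"
        using summand[of x i] mult_right_mono[of "1 - E x" 1 "d\<^sup>2"] True by simp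
      then have "(max 0 (x $ i - r))\<^sup>2 \<le> d\<^sup>2" "(max 0 (- (x $ i) - r))\<^sup>2 \<le> d\<^sup>2"
        unfolding q_def using zero_le_power2[of "max 0 (x $ i - r)"] zero_le_power2[of "max 0 (- (x $ i) - r)"] by linarith+
      then have "max 0 (x $ i - r) \<le> d" "max 0 (- (x $ i) - r) \<le> d"
        using d by (auto intro: power2_le_imp_le)
      then have "\<bar>2 * max 0 (x $ i - r) - 2 * max 0 (- (x $ i) - r)\<bar> \<le> 2 * d" using r d by (auto simp: max_def)
      then have "\<bar>E' x (axis i 1)\<bar> \<le> 2 * d / d\<^sup>2"
        unfolding E' by (simp add: abs_divide divide_right_mono)
      also have "\<dots> = 2 / d" using d by (simp add: power2_eq_square)
      finally have e: "\<bar>E' x (axis i 1)\<bar> \<le> 2 / d" .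
      have "\<bar>FD \<zeta> x (axis i 1)\<bar> = 2 * E x * \<bar>E' x (axis i 1)\<bar>" using True by (simp add: C(2) abs_mult)
      also have "\<dots> \<le> 2 * 1 * (2 / d)" using e E1[of x] True by (intro mult_mono) auto
      finally show ?thesis by simp
    qed
    have "norm (\<chi> i. FD \<zeta> x (axis i 1)) \<le> (\<Sum>i\<in>UNIV. \<bar>(\<chi> i. FD \<zeta> x (axis i 1)) $ i\<bar>)" by (rule norm_le_l1_cart)
    also have "\<dots> \<le> (\<Sum>i\<in>(UNIV::'n set). 4 / d)" by (intro sum_mono) (use comp in simp)
    finally show "norm (\<chi> i. FD \<zeta> x (axis i 1)) \<le> 4 * real CARD('n) / d" by (simp add: mult.commute)
  qed
qed

section \<open>Propagation of positivity in measure\<close>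

lemma integral_times_product:
  fixes U :: "'a::euclidean_space \<Rightarrow> real" and s :: "'b::euclidean_space \<Rightarrow> real"
  assumes U: "integrable lborel U" and s: "integrable lborel s"
  shows "integrable lborel (\<lambda>z. U (fst z) * s (snd z))"
    "(\<integral>z. U (fst z) * s (snd z) \<partial>lborel) = (\<integral>x. U x \<partial>lborel) * (\<integral>t. s t \<partial>lborel)"
proof -
  have [measurable]: "U \<in> borel_measurable borel" "s \<in> borel_measurable borel"
    using borel_measurable_integrable[OF U] borel_measurable_integrable[OF s] by auto
  have *: "integrable (lborel \<Otimes>\<^sub>M lborel) (\<lambda>z. U (fst z) * s (snd z))"
  proof (rule lborel_pair.Fubini_integrable)
    show "integrable lborel (\<lambda>x. \<integral>y. norm (U (fst (x, y)) * s (snd (x, y))) \<partial>lborel)"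
      using U s by (simp add: abs_mult)
    show "AE x in lborel. integrable lborel (\<lambda>y. U (fst (x, y)) * s (snd (x, y)))"
      using s by simp
  qed measurable
  then show "integrable lborel (\<lambda>z. U (fst z) * s (snd z))" by (simp add: lborel_prod)
  show "(\<integral>z. U (fst z) * s (snd z) \<partial>lborel) = (\<integral>x. U x \<partial>lborel) * (\<integral>t. s t \<partial>lborel)"
    using lborel_pair.integral_fst'[OF *] U s by (simp add: lborel_prod)
qed

lemma sublevel_borel:
  fixes v :: "'a::euclidean_space \<Rightarrow> real"
  assumes "continuous_on X v" "compact X"
  shows "closed {x \<in> X. l \<le> v x}" "{x \<in> X. v x < l} \<in> sets borel"
proof -
  show c: "closed {x \<in> X. l \<le> v x}"
    using continuous_closed_preimage[OF assms(1) compact_imp_closed[OF assms(2)] closed_atLeast[of l]]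
    by (simp add: vimage_def Int_def)
  have "{x \<in> X. v x < l} = X - {x \<in> X. l \<le> v x}" by auto
  then show "{x \<in> X. v x < l} \<in> sets borel" using c borel_compact[OF assms(2)] by (simp add: sets.Diff)
qed

lemma (in profile) P_comp_cont:
  assumes "continuous_on UNIV w" "\<And>z. 0 \<le> w z" "0 < c"
  shows "continuous_on UNIV (\<lambda>z. P (w z + c))"
proof (rule continuous_on_compose2[of "{0<..}" P])
  show "continuous_on {0<..} P" by (rule DERIV_continuous_on) (use P_deriv in \<open>auto intro: has_field_derivative_at_within\<close>)
  show "continuous_on UNIV (\<lambda>z. w z + c)" by (intro continuous_intros assms)
  show "(\<lambda>z. w z + c) ` UNIV \<subseteq> {0<..}" using assms(2,3) by (auto intro: add_nonneg_pos)
qed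

lemma cylinder_cbox:
  fixes s t :: real
  shows "ccube \<rho> \<times> {s..t} = cbox ((\<chi> i. - \<rho>) :: real ^ 'n::finite, s) (\<chi> i. \<rho>, t)"
    "cube \<rho> \<times> {s<..<t} = box ((\<chi> i. - \<rho>) :: real ^ 'n::finite, s) (\<chi> i. \<rho>, t)"
  unfolding ccube_def cube_eq_box cbox_Pair_eq
  by (simp_all add: interior_cbox[symmetric] cbox_Pair_eq interior_Times del: interior_cbox)

lemma ccube_subset:
  "\<rho> < \<rho>' \<Longrightarrow> ccube \<rho> \<subseteq> cube \<rho>'" "\<rho> \<le> \<rho>' \<Longrightarrow> ccube \<rho> \<subseteq> ccube \<rho>'" "cube \<rho> \<subseteq> ccube \<rho>"
  unfolding subset_iff mem_ccube by (auto simp: cube_def) (meson le_less_trans order_trans less_imp_le)+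

context growth
begin

text \<open>A closed cylinder halfway between the given one and the domain leaves room for
  mollification on all sides, in particular below time 0.\<close>

lemma cylinder_approx:
  fixes A :: "'n::finite vector_field" and u :: "(real ^ 'n) \<times> real \<Rightarrow> real" and C0 C1 \<rho>0 t0 \<rho> s t \<epsilon> :: real
  assumes struct: "structure_conditions C0 C1 g A" and C: "0 < C0" "0 < C1"
    and ws: "weak_supersolution g A (cube \<rho>0 \<times> {t0<..<0}) u" and nn: "\<And>z. z \<in> cube \<rho>0 \<times> {t0<..<0} \<Longrightarrow> 0 \<le> u z"
    and \<rho>: "0 < \<rho>" "\<rho> < \<rho>0" and st: "t0 < s" "s \<le> t" "t < 0" and \<epsilon>: "0 < \<epsilon>"
  obtains w :: "(real ^ 'n) \<times> real \<Rightarrow> real" and F and e where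
    "C1_fun w" "\<And>z. 0 \<le> w z" "\<And>z. z \<in> ccube \<rho> \<times> {s..t} \<Longrightarrow> \<bar>w z - u z\<bar> \<le> \<epsilon>"
    "integrable lborel F" "integrable lborel e" "\<And>z. 0 \<le> e z" "(\<integral>z. e z \<partial>lborel) < \<epsilon>"
    "\<And>z. z \<in> ccube \<rho> \<times> {s..t} \<Longrightarrow> C0 * G (norm (space_grad w z)) - e z \<le> F z \<bullet> space_grad w z"
    "\<And>z. z \<in> ccube \<rho> \<times> {s..t} \<Longrightarrow> norm (F z) \<le> C1 * g (norm (space_grad w z)) + e z"
    "\<And>\<psi>. C1_fun \<psi> \<Longrightarrow> closure {z. \<psi> z \<noteq> 0} \<subseteq> ccube \<rho> \<times> {s..t} \<Longrightarrow> (\<And>z. 0 \<le> \<psi> z) \<Longrightarrow>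
       0 \<le> - (\<integral>z. w z * time_deriv \<psi> z \<partial>lborel) + (\<integral>z. F z \<bullet> space_grad \<psi> z \<partial>lborel)"
proof -
  define \<rho>1 where "\<rho>1 = (\<rho> + \<rho>0) / 2"
  define s1 t1 where "s1 = (t0 + s) / 2" and "t1 = t / 2"
  have 1: "ccube \<rho>1 \<times> {s1..t1} \<subseteq> cube \<rho>0 \<times> {t0<..<0}"
    using \<rho> st by (intro Sigma_mono ccube_subset(1)) (auto simp: \<rho>1_def s1_def t1_def)
  have 2: "ccube \<rho> \<times> {s..t} \<subseteq> cube \<rho>1 \<times> {s1<..<t1}"
    using \<rho> st by (intro Sigma_mono ccube_subset(1)) (auto simp: \<rho>1_def s1_def t1_def)
  have K: "compact (ccube \<rho> \<times> {s..t} :: ((real ^ 'n) \<times> real) set)"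
    by (intro compact_Times ccube_convex_compact compact_Icc)
  show ?thesis
    apply (rule weak_supersolution_approx[OF struct less_imp_le[OF C(1)] C(2) ws nn 1[unfolded cylinder_cbox(1)] K 2[unfolded cylinder_cbox(2)] \<epsilon>])
     apply assumption
    apply (rule that)
             apply assumption+
    apply blast
    done
qed

text \<open>The energy estimate for the profile \<open>inverse (y\<^sup>2)\<close> with its
  nonnegative gradient term dropped. The derivative of the time cut-off concentrates at
  \<open>s\<close> with positive and at \<tau> with negative sign, so the integral of
  \<open>P\<close> at \<tau> is bounded by that at \<open>s\<close>. At \<open>s\<close> the
  integrand is at most \<open>ln (l / c)\<close> and lives on \<open>{u < l}\<close>; at \<tau> it
  is at least \<open>ln (l / c) - 5/2\<close> on \<open>{u < c / 2}\<close>. For large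
  \<open>l / c\<close> the two prefactors nearly agree, so hardly any measure is lost.\<close>

lemma positivity_propagation:
  fixes A :: "'n::finite vector_field" and u :: "(real ^ 'n) \<times> real \<Rightarrow> real" and C0 C1 r d \<rho>0 t0 s \<tau> c l \<epsilon> :: real
  assumes struct: "structure_conditions C0 C1 g A" and C: "0 < C0" "0 < C1"
    and ws: "weak_supersolution g A (cube \<rho>0 \<times> {t0<..<0}) u" and nn: "\<And>z. z \<in> cube \<rho>0 \<times> {t0<..<0} \<Longrightarrow> 0 \<le> u z"
    and r: "0 < r" "0 < d" "r + d < \<rho>0" and st: "t0 < s" "s < \<tau>" "\<tau> < 0"
    and c: "0 < c" "2 * c \<le> l" and \<epsilon>: "0 < \<epsilon>" "\<epsilon> \<le> 1" "2 * Q * C1 * \<epsilon> * Q \<le> C0"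
  defines "L \<equiv> 4 * real CARD('n) / d" and "X \<equiv> ccube (r + d) :: (real ^ 'n) set"
  shows "(ln (l / c) - 5/2) * measure lborel {x \<in> ccube r. u (x, \<tau>) < c / 2}
    \<le> ln (l / c) * measure lborel {x \<in> X. u (x, s) < l}
      + (C0 / 2 * inverse \<epsilon> ^ Q * (G (l * L) / l\<^sup>2) * (2 * (\<tau> - s)) + 1) * measure lborel X"
proof -
  define \<Lambda> where "\<Lambda> = ln (l / c)"
  have l: "0 < l" "c \<le> l" using c by auto
  have \<Lambda>: "0 \<le> \<Lambda>" using c l by (simp add: \<Lambda>_def)
  have L: "0 < L" using r by (simp add: L_def)
  interpret pr: profile "\<lambda>y. inverse (y\<^sup>2)" l
    by unfold_locales (use l in \<open>auto intro!: continuous_intros\<close>)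
  have Xc: "compact X" "convex X" using ccube_convex_compact by (auto simp: X_def)
  have mX: "0 < measure lborel X" unfolding X_def using r by (subst measure_ccube) auto
  \<comment> \<open>The bound by \<open>- \<tau> / 2\<close> keeps the final step of the cut-off
    below time 0; the bound by \<open>\<tau> - s\<close> separates the two steps and limits the
    total duration to \<open>2 * (\<tau> - s)\<close>.\<close>
  define h0 where "h0 = min (\<tau> - s) (- \<tau> / 2)"
  have h0: "0 < h0" "\<tau> + h0 < 0" "h0 \<le> \<tau> - s" using st by (auto simp: h0_def min_def)
  have sub: "X \<times> {s..\<tau> + h0} \<subseteq> cube \<rho>0 \<times> {t0<..<0}"
    unfolding X_def using r st h0 by (intro Sigma_mono ccube_subset(1)) auto
  have cu: "continuous_on (X \<times> {s..\<tau> + h0}) u"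
    using ws sub unfolding weak_supersolution_def by (auto intro: continuous_on_subset)
  \<comment> \<open>Variation in time and mollification each cost at most \<eta>, together
    \<open>c / 4\<close>. Hence \<open>u \<ge> l\<close> at time \<open>s\<close> forces
    \<open>w + c \<ge> l\<close>, and \<open>u < c / 2\<close> at time \<tau> forces
    \<open>w + c \<le> 2 * c\<close>.\<close>
  define \<eta> where "\<eta> = c / 8"
  have \<eta>: "0 < \<eta>" using c by (simp add: \<eta>_def)
  have "uniformly_continuous_on (X \<times> {s..\<tau> + h0}) u"
    by (rule compact_uniformly_continuous[OF cu]) (intro compact_Times Xc compact_Icc)
  then obtain \<delta> where \<delta>: "0 < \<delta>" "\<And>z z'. z \<in> X \<times> {s..\<tau> + h0} \<Longrightarrow> z' \<in> X \<times> {s..\<tau> + h0} \<Longrightarrow> dist z' z < \<delta> \<Longrightarrow> dist (u z') (u z) < \<eta>"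
    unfolding uniformly_continuous_on_def using \<eta> by metis
  define h where "h = min h0 (\<delta> / 2)"
  have h: "0 < h" "h \<le> h0" "h < \<delta>" using h0 \<delta> by (auto simp: h_def)
  have slice: "\<bar>u (x, t) - u (x, t')\<bar> < \<eta>" if "x \<in> X" "t \<in> {t'..t' + h}" "t' = s \<or> t' = \<tau>" for x t t'
  proof -
    have "dist (u (x, t)) (u (x, t')) < \<eta>"
      using that st h h0 by (intro \<delta>(2)) (auto simp: dist_Pair_Pair dist_real_def)
    then show ?thesis by (simp add: dist_real_def)
  qed
  define M where "M = inverse (c\<^sup>2) * (1 + c)"
  have M: "pr.f y \<le> M" "pr.p y \<le> M" if "c \<le> y" for y
    using pr.f_bound[OF c(1) that] c by (auto simp: M_def distrib_left intro: order_trans)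
  have M0: "0 < M" using c by (auto simp: M_def)
  define B where "B = M * (1 + Q * L)"
  have B: "0 < B" using M0 L by (auto simp: B_def intro!: mult_pos_pos add_pos_nonneg)
  \<comment> \<open>The second entry pushes the mollification error below
    \<open>measure lborel X\<close>, the source of the \<open>+ 1\<close> in the statement.\<close>
  define e' where "e' = min \<eta> (measure lborel X / B)"
  have e': "0 < e'" "e' \<le> \<eta>" "B * e' \<le> measure lborel X" using \<eta> mX B by (auto simp: e'_def min_def field_simps)
  have st': "s \<le> \<tau> + h" "\<tau> + h < 0" using st h h0 by auto
  have rd: "0 < r + d" using r by simp
  obtain w F e where w: "C1_fun w" "\<And>z. 0 \<le> w z" and wu: "\<And>z. z \<in> X \<times> {s..\<tau> + h} \<Longrightarrow> \<bar>w z - u z\<bar> \<le> e'"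
    and F: "integrable lborel F" and e: "integrable lborel e" "\<And>z. 0 \<le> e z" "(\<integral>z. e z \<partial>lborel) < e'"
    and coer: "\<And>z. z \<in> X \<times> {s..\<tau> + h} \<Longrightarrow> C0 * G (norm (space_grad w z)) - e z \<le> F z \<bullet> space_grad w z"
    and bd: "\<And>z. z \<in> X \<times> {s..\<tau> + h} \<Longrightarrow> norm (F z) \<le> C1 * g (norm (space_grad w z)) + e z"
    and weak: "\<And>\<psi>. C1_fun \<psi> \<Longrightarrow> closure {z. \<psi> z \<noteq> 0} \<subseteq> X \<times> {s..\<tau> + h} \<Longrightarrow> (\<And>z. 0 \<le> \<psi> z) \<Longrightarrow>
       0 \<le> - (\<integral>z. w z * time_deriv \<psi> z \<partial>lborel) + (\<integral>z. F z \<bullet> space_grad \<psi> z \<partial>lborel)"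

    \<comment> \<open>Approximation and cut-off functions\<close>
    using cylinder_approx[OF struct C ws nn rd r(3) st(1) st'(1) st'(2) e'(1)] unfolding X_def by blast
  obtain \<zeta> :: "real ^ 'n \<Rightarrow> real" where \<zeta>: "C1_fun \<zeta>" "\<And>x. 0 \<le> \<zeta> x" "\<And>x. \<zeta> x \<le> 1"
    "\<And>x. norm (grad \<zeta> x) \<le> L" "\<And>x. x \<notin> X \<Longrightarrow> \<zeta> x = 0" and \<zeta>1: "\<And>x. x \<in> ccube r \<Longrightarrow> \<zeta> x = 1"
    using space_cutoff[OF r(1,2), where 'n = 'n] unfolding grad_def L_def X_def by metis
  obtain \<sigma>1 \<sigma>1' where \<sigma>1: "\<And>t. (\<sigma>1 has_real_derivative \<sigma>1' t) (at t)" "continuous_on UNIV \<sigma>1'"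
    "\<And>t. 0 \<le> \<sigma>1' t" "\<And>t. 0 \<le> \<sigma>1 t" "\<And>t. \<sigma>1 t \<le> 1" "\<And>t. t \<le> s \<Longrightarrow> \<sigma>1 t = 0" "\<And>t. s + h \<le> t \<Longrightarrow> \<sigma>1 t = 1"
    "\<And>t. t \<notin> {s..s+h} \<Longrightarrow> \<sigma>1' t = 0" "integrable lborel \<sigma>1'" "(\<integral>t. \<sigma>1' t \<partial>lborel) = 1"
    using smoothstep[OF h(1), of s] by metis
  obtain \<sigma>2 \<sigma>2' where \<sigma>2: "\<And>t. (\<sigma>2 has_real_derivative \<sigma>2' t) (at t)" "continuous_on UNIV \<sigma>2'"
    "\<And>t. 0 \<le> \<sigma>2' t" "\<And>t. 0 \<le> \<sigma>2 t" "\<And>t. \<sigma>2 t \<le> 1" "\<And>t. t \<le> \<tau> \<Longrightarrow> \<sigma>2 t = 0" "\<And>t. \<tau> + h \<le> t \<Longrightarrow> \<sigma>2 t = 1"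
    "\<And>t. t \<notin> {\<tau>..\<tau>+h} \<Longrightarrow> \<sigma>2' t = 0" "integrable lborel \<sigma>2'" "(\<integral>t. \<sigma>2' t \<partial>lborel) = 1"
    using smoothstep[OF h(1), of \<tau>] by metis
  define \<kappa> where "\<kappa> t = \<sigma>1 t - \<sigma>2 t" for t
  define \<kappa>' where "\<kappa>' t = \<sigma>1' t - \<sigma>2' t" for t
  have \<kappa>d: "(\<kappa> has_real_derivative \<kappa>' t) (at t)" for t
    unfolding \<kappa>_def[abs_def] \<kappa>'_def by (intro derivative_intros \<sigma>1(1) \<sigma>2(1))
  have \<kappa>c: "continuous_on UNIV \<kappa>'" unfolding \<kappa>'_def by (intro continuous_intros \<sigma>1(2) \<sigma>2(2))
  have \<kappa>0: "0 \<le> \<kappa> t" for t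
  proof (cases "t \<le> \<tau>")
    case True then show ?thesis using \<sigma>2(6)[OF True] \<sigma>1(4)[of t] by (simp add: \<kappa>_def)
  next
    case False then show ?thesis using \<sigma>1(7)[of t] \<sigma>2(5)[of t] h h0 by (simp add: \<kappa>_def)
  qed
  have \<kappa>1: "\<kappa> t \<le> 1" for t using \<sigma>1(5)[of t] \<sigma>2(4)[of t] by (simp add: \<kappa>_def)
  have \<kappa>out: "\<kappa> t = 0" if "t \<notin> {s..\<tau> + h}" for t
  proof (cases "t < s")
    case True then show ?thesis using \<sigma>1(6)[of t] \<sigma>2(6)[of t] st by (simp add: \<kappa>_def)
  next
    case False then show ?thesis using that \<sigma>1(7)[of t] \<sigma>2(7)[of t] st by (simp add: \<kappa>_def)
  qed
  \<comment> \<open>Quadratic growth makes \<open>G (y * L) / y\<^sup>2\<close> nondecreasing, so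
    the worst case is the top level \<open>l\<close>.\<close>
  have S: "pr.f y * G (y * L) \<le> G (l * L) / l\<^sup>2" if y: "c \<le> y" for y
  proof (cases "y < l")
    case False
    then show ?thesis using pr.f_zero[of y] G_nonneg[of "l * L"] l L by simp
  next
    case True
    have y0: "0 < y" using y c by simp
    have "pr.f y * G (y * L) \<le> inverse (y\<^sup>2) * G (y * L)"
      using pr.\<theta>_bounds[of y] G_nonneg[of "y * L"] y0 L unfolding pr.f_def by (intro mult_right_mono mult_left_le) auto
    also have "\<dots> = L\<^sup>2 * (G (y * L) / (y * L)\<^sup>2)" using L y0 by (simp add: field_simps power_mult_distrib)
    also have "\<dots> \<le> L\<^sup>2 * (G (l * L) / (l * L)\<^sup>2)" using True y0 L by (intro mult_left_mono G_ratio2) auto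
    also have "\<dots> = G (l * L) / l\<^sup>2" using L l by (simp add: field_simps power_mult_distrib)
    finally show ?thesis .
  qed

  \<comment> \<open>The time term at the initial and the final time\<close>
  define W where "W z = pr.P (w z + c) * \<zeta> (fst z) ^ Q" for z
  have W0: "0 \<le> W z" for z using pr.P_nonneg[of "w z + c"] w(2)[of z] c \<zeta>(2) by (simp add: W_def)
  have Wc: "continuous_on UNIV W"
    unfolding W_def using c w by (intro continuous_intros pr.P_comp_cont C1_fun_continuous
      continuous_on_compose2[OF C1_fun_continuous[OF \<zeta>(1)]]) auto
  have Wi: "integrable lborel (\<lambda>z. W z * \<sigma>' (snd z))" if "continuous_on UNIV \<sigma>'" "\<And>t. t \<notin> {s..\<tau>+h} \<Longrightarrow> \<sigma>' t = 0" for \<sigma>'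
  proof (rule integrable_continuous_compact_support)
    show "continuous_on UNIV (\<lambda>z. W z * \<sigma>' (snd z))"
      by (intro continuous_intros Wc continuous_on_compose2[OF that(1)]) auto
    show "compact (X \<times> {s..\<tau>+h})" by (intro compact_Times Xc compact_Icc)
    show "W z * \<sigma>' (snd z) = 0" if "z \<notin> X \<times> {s..\<tau>+h}" for z
      using that \<zeta>(5)[of "fst z"] \<open>\<And>t. t \<notin> {s..\<tau>+h} \<Longrightarrow> \<sigma>' t = 0\<close>[of "snd z"] Q_ge2
      by (cases z) (auto simp: W_def zero_power)
  qed
  have o1: "\<sigma>1' t = 0" if "t \<notin> {s..\<tau>+h}" for t using \<sigma>1(8)[of t] that h h0 by auto
  have o2: "\<sigma>2' t = 0" if "t \<notin> {s..\<tau>+h}" for t using \<sigma>2(8)[of t] that st by auto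
  have "(\<integral>z. W z * \<kappa>' (snd z) \<partial>lborel) = (\<integral>z. W z * \<sigma>1' (snd z) - W z * \<sigma>2' (snd z) \<partial>lborel)"
    by (simp add: \<kappa>'_def right_diff_distrib)
  also have "\<dots> = (\<integral>z. W z * \<sigma>1' (snd z) \<partial>lborel) - (\<integral>z. W z * \<sigma>2' (snd z) \<partial>lborel)"
    using Wi[OF \<sigma>1(2) o1] Wi[OF \<sigma>2(2) o2] by simp
  finally have split: "(\<integral>z. W z * \<kappa>' (snd z) \<partial>lborel) = (\<integral>z. W z * \<sigma>1' (snd z) \<partial>lborel) - (\<integral>z. W z * \<sigma>2' (snd z) \<partial>lborel)" .
  have cs: "continuous_on X (\<lambda>x. u (x, t))" if "t \<in> {s..\<tau> + h0}" for t
    by (rule continuous_on_compose2[OF cu]) (use that in \<open>auto intro!: continuous_intros\<close>)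
  have rX: "ccube r \<subseteq> X" unfolding X_def using r by (intro ccube_subset(2)) simp
  define A1 where "A1 = {x \<in> X. u (x, s) < l}"
  define A2 where "A2 = {x \<in> ccube r. u (x, \<tau>) < c / 2}"
  have A1m: "A1 \<in> sets borel" unfolding A1_def using st h0 by (intro sublevel_borel(2) cs Xc) auto
  have A2m: "A2 \<in> sets borel" unfolding A2_def
    using st h0 ccube_convex_compact(2) by (intro sublevel_borel(2) continuous_on_subset[OF cs rX]) auto
  have Xf: "emeasure lborel X < \<infinity>" using emeasure_bounded_finite[OF compact_imp_bounded[OF Xc(1)]] .
  have Xm: "X \<in> sets borel" using borel_compact[OF Xc(1)] .
  have Af: "emeasure lborel A1 < \<infinity>" "emeasure lborel A2 < \<infinity>"
    using emeasure_mono[of A1 X lborel] emeasure_mono[of A2 X lborel] Xf Xm rX by (auto simp: A1_def A2_def intro: le_less_trans)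
  have i1: "integrable lborel (\<lambda>x. \<Lambda> * indicator A1 x :: real)" using A1m Af by auto
  have i2: "integrable lborel (\<lambda>x. (\<Lambda> - 5/2) * indicator A2 x :: real)" using A2m Af by auto
  have up: "(\<integral>z. W z * \<sigma>1' (snd z) \<partial>lborel) \<le> \<Lambda> * measure lborel A1"
  proof -
    have "(\<integral>z. W z * \<sigma>1' (snd z) \<partial>lborel) \<le> (\<integral>z. (\<Lambda> * indicator A1 (fst z)) * \<sigma>1' (snd z) \<partial>lborel)"
    proof (rule integral_mono[OF Wi[OF \<sigma>1(2) o1] integral_times_product(1)[OF i1 \<sigma>1(9)]])
      fix z :: "(real ^ 'n) \<times> real"
      obtain x t where z: "z = (x, t)" by (cases z)
      show "W z * \<sigma>1' (snd z) \<le> (\<Lambda> * indicator A1 (fst z)) * \<sigma>1' (snd z)"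
      proof (cases "x \<in> X \<and> t \<in> {s..s+h}")
        case False
        then show ?thesis using \<zeta>(5)[of x] \<sigma>1(8)[of t] \<sigma>1(3)[of t] Q_ge2 \<Lambda> by (auto simp: z W_def zero_power)
      next
        case True
        then have "z \<in> X \<times> {s..\<tau>+h}" using h h0 by (auto simp: z)
        from wu[OF this] have 1: "u z - \<eta> \<le> w z" using e' by linarith
        have 2: "u (x, s) - 2 * \<eta> \<le> w z" using slice[of x t s] True 1 by (simp add: z)
        have "W z \<le> \<Lambda> * indicator A1 x"
        proof (cases "x \<in> A1")
          case False
          then have "l \<le> w z + c" using 2 True c by (simp add: A1_def \<eta>_def)
          then have "pr.P (w z + c) = 0" by (rule pr.P_zero)
          then show ?thesis using False by (simp add: W_def)
        next
          case A: True
          have "pr.P (w z + c) \<le> pr.P c" using w(2)[of z] c by (intro pr.P_antimono) auto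
          also have "\<dots> \<le> \<Lambda>" using pr.P_le[OF c(1) l(2)] c by (simp add: \<Lambda>_def)
          finally have "pr.P (w z + c) \<le> \<Lambda>" .
          moreover have "\<zeta> x ^ Q \<le> 1" using \<zeta>(2,3) by (intro power_le_one) auto
          ultimately have "W z \<le> \<Lambda> * 1"
            unfolding W_def using \<Lambda> \<zeta>(2) by (intro mult_mono) (auto simp: z)
          then show ?thesis using A by simp
        qed
        then show ?thesis using \<sigma>1(3)[of t] by (simp add: z mult_right_mono)
      qed
    qed
    also have "\<dots> = \<Lambda> * measure lborel A1"
      unfolding integral_times_product(2)[OF i1 \<sigma>1(9)] using \<sigma>1(10) A1m by simp
    finally show ?thesis .
  qed
  have low: "(\<Lambda> - 5/2) * measure lborel A2 \<le> (\<integral>z. W z * \<sigma>2' (snd z) \<partial>lborel)"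
  proof -
    have "(\<Lambda> - 5/2) * measure lborel A2 = (\<integral>z. ((\<Lambda> - 5/2) * indicator A2 (fst z)) * \<sigma>2' (snd z) \<partial>lborel)"
      unfolding integral_times_product(2)[OF i2 \<sigma>2(9)] using \<sigma>2(10) A2m by simp
    also have "\<dots> \<le> (\<integral>z. W z * \<sigma>2' (snd z) \<partial>lborel)"
    proof (rule integral_mono[OF integral_times_product(1)[OF i2 \<sigma>2(9)] Wi[OF \<sigma>2(2) o2]])
      fix z :: "(real ^ 'n) \<times> real"
      obtain x t where z: "z = (x, t)" by (cases z)
      show "((\<Lambda> - 5/2) * indicator A2 (fst z)) * \<sigma>2' (snd z) \<le> W z * \<sigma>2' (snd z)"
      proof (cases "x \<in> A2 \<and> t \<in> {\<tau>..\<tau>+h}")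
        case False
        then have "indicator A2 (fst z) * \<sigma>2' (snd z) = 0" using \<sigma>2(8)[of t] by (auto simp: z)
        then have "((\<Lambda> - 5/2) * indicator A2 (fst z)) * \<sigma>2' (snd z) = 0" by simp
        moreover have "0 \<le> W z * \<sigma>2' (snd z)" using W0 \<sigma>2(3) by simp
        ultimately show ?thesis by linarith
      next
        case True
        have xr: "x \<in> ccube r" "u (x, \<tau>) < c / 2" using True by (auto simp: A2_def)
        then have "x \<in> X" using rX by auto
        then have "z \<in> X \<times> {s..\<tau>+h}" using True st by (auto simp: z)
        from wu[OF this] have 1: "w z \<le> u z + \<eta>" using e' by linarith
        have "w z \<le> u (x, \<tau>) + 2 * \<eta>" using slice[of x t \<tau>] True \<open>x \<in> X\<close> 1 by (simp add: z)
        then have 2: "w z + c \<le> 2 * c" using xr c by (simp add: \<eta>_def)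
        \<comment> \<open>The total loss \<open>5/2\<close> is \<open>3/2\<close> from the profile
          and 1 as a bound for \<open>ln 2\<close>.\<close>
        have "ln (l / (2 * c)) = \<Lambda> - ln 2" using c l by (simp add: \<Lambda>_def ln_div ln_mult)
        moreover have "ln 2 \<le> (1::real)" using ln_le_minus_one[of 2] by simp
        ultimately have "\<Lambda> - 5/2 \<le> ln (l / (2 * c)) - 3/2" by simp
        also have "\<dots> \<le> pr.P (2 * c)" using c l by (intro profile_log_lower) auto
        also have "\<dots> \<le> pr.P (w z + c)" using 2 w(2)[of z] c by (intro pr.P_antimono) auto
        finally have "\<Lambda> - 5/2 \<le> W z" using \<zeta>1[OF xr(1)] by (simp add: W_def z)
        then show ?thesis using \<sigma>2(3)[of t] True by (simp add: z mult_right_mono)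
      qed
    qed
    finally show ?thesis .
  qed

  \<comment> \<open>Application of the energy estimate\<close>
  have fz: "0 \<le> pr.f (w z + c)" for z by (rule pr.f_nonneg) (use w(2)[of z] c in linarith)
  have lhs: "0 \<le> C0 / 2 * (\<integral>z. pr.f (w z + c) * G (norm (space_grad w z)) * \<zeta> (fst z) ^ Q * \<kappa> (snd z) \<partial>lborel)"
    using C G_nonneg \<zeta>(2) \<kappa>0 by (intro mult_nonneg_nonneg integral_nonneg_AE AE_I2 fz) auto
  have en': "C0 / 2 * (\<integral>z. pr.f (w z + c) * G (norm (space_grad w z)) * \<zeta> (fst z) ^ Q * \<kappa> (snd z) \<partial>lborel)
    \<le> (\<integral>z. W z * \<kappa>' (snd z) \<partial>lborel)
      + C0 / 2 * inverse \<epsilon> ^ Q * (G (l * L) / l\<^sup>2) * measure lborel X * (\<tau> + h - s) + B * (\<integral>z. e z \<partial>lborel)"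
    unfolding W_def B_def
    by (rule energy_estimate[OF C w F e(1,2) coer bd weak Xc(1) st'(1) c(1) pr.P_deriv pr.p_deriv pr.f_cont pr.f_nonneg pr.p_nonneg pr.p_le M L S \<zeta> \<kappa>d \<kappa>c \<kappa>0 \<kappa>1 \<kappa>out \<epsilon>])
  have 1: "B * (\<integral>z. e z \<partial>lborel) \<le> measure lborel X"
    using mult_left_mono[OF less_imp_le[OF e(3)] less_imp_le[OF B]] e'(3) by linarith
  have 2: "C0 / 2 * inverse \<epsilon> ^ Q * (G (l * L) / l\<^sup>2) * measure lborel X * (\<tau> + h - s)
    \<le> C0 / 2 * inverse \<epsilon> ^ Q * (G (l * L) / l\<^sup>2) * measure lborel X * (2 * (\<tau> - s))"
    using h h0 C \<epsilon> G_nonneg[of "l * L"] l L mX by (intro mult_left_mono) auto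
  have "(\<Lambda> - 5/2) * measure lborel A2 \<le> \<Lambda> * measure lborel A1 + C0 / 2 * inverse \<epsilon> ^ Q * (G (l * L) / l\<^sup>2) * measure lborel X * (2 * (\<tau> - s)) + measure lborel X"
    using lhs en' split up low 1 2 by linarith
  then show ?thesis unfolding \<Lambda>_def A1_def A2_def by (simp add: algebra_simps)
qed

end

section \<open>Smallness of a sublevel set\<close>

lemma space_grad_inner:
  fixes w :: "(real ^ 'n::finite) \<times> real \<Rightarrow> real"
  assumes "C1_fun w"
  shows "FD w z (v, 0) = space_grad w z \<bullet> v"
proof -
  have lin: "linear (FD w z)" using has_derivative_bounded_linear[OF C1_funD(1)[OF assms]] by (rule bounded_linear.linear)
  have lin2: "linear (\<lambda>v::real^'n. FD w z (v, 0))"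
  proof (rule linearI)
    show "FD w z (a + b, 0) = FD w z (a, 0) + FD w z (b, 0)" for a b :: "real ^ 'n"
      using linear_add[OF lin, of "(a, 0)" "(b, 0)"] by simp
    show "FD w z (r *\<^sub>R a, 0) = r *\<^sub>R FD w z (a, 0)" for r and a :: "real ^ 'n"
      using linear_scale[OF lin, of r "(a, 0)"] by simp
  qed
  have "FD w z (v, 0) = FD w z ((\<Sum>i\<in>UNIV. (v $ i) *\<^sub>R axis i 1), 0)"
    using basis_expansion[of v] by (simp add: scalar_mult_eq_scaleR)
  also have "\<dots> = (\<Sum>i\<in>UNIV. v $ i * FD w z (axis i 1, 0))"
    using linear_sum[OF lin2, of "\<lambda>i. (v $ i) *\<^sub>R axis i 1" UNIV] linear_scale[OF lin2] by simp
  finally show ?thesis by (simp add: inner_vec_def space_grad_def mult.commute)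
qed

text \<open>Below \<open>l\<close> the truncated logarithm is
  \<open>ln (l / y) - (1 - (y / l)\<^sup>2) / 2\<close>. Its derivative carries the same factor
  \<theta> as \<open>f\<close>, which makes its gradient comparable with the energy.\<close>

lemma (in profile) log_profile:
  defines "H \<equiv> \<lambda>y. integral {y..l} (\<lambda>y. \<theta> y / y)"
  shows "\<And>y. 0 < y \<Longrightarrow> (H has_real_derivative - (\<theta> y / y)) (at y)"
    "\<And>y. 0 < y \<Longrightarrow> y \<le> l \<Longrightarrow> ln (l / y) - 1/2 \<le> H y" "\<And>y. l \<le> y \<Longrightarrow> H y = 0" "\<And>y. 0 < y \<Longrightarrow> 0 \<le> H y"
proof -
  have c: "continuous_on {0<..} (\<lambda>y. \<theta> y / y)" by (intro continuous_intros \<theta>_cont) auto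
  have z: "\<theta> y / y = 0" if "l \<le> y" for y using \<theta>_zero[OF that] by simp
  show "(H has_real_derivative - (\<theta> y / y)) (at y)" if "0 < y" for y
    unfolding H_def by (rule tail_integral_deriv[OF c z that])
  have eq: "H y = ln (l / y) - (l\<^sup>2 - y\<^sup>2) / (2 * l\<^sup>2)" if y: "0 < y" "y \<le> l" for y
    unfolding H_def
  proof (rule tail_integral_eq[OF _ _ y])
    fix x assume x: "0 < x" "x \<le> l"
    have "(x / l)\<^sup>2 \<le> 1" using x by (intro power_le_one) auto
    then have th: "- (\<theta> x / x) = - (1 / x) + x / l\<^sup>2" using x by (simp add: \<theta>_def field_simps power2_eq_square)
    have "((\<lambda>y. ln (l / y) - (l\<^sup>2 - y\<^sup>2) / (2 * l\<^sup>2)) has_real_derivative - (1 / x) + x / l\<^sup>2) (at x)"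
      using x l by (auto intro!: derivative_eq_intros simp: field_simps power2_eq_square)
    then show "((\<lambda>y. ln (l / y) - (l\<^sup>2 - y\<^sup>2) / (2 * l\<^sup>2)) has_real_derivative - (\<theta> x / x)) (at x)"
      unfolding th .
  qed (use l in simp)
  show "ln (l / y) - 1/2 \<le> H y" if y: "0 < y" "y \<le> l" for y
  proof -
    have "(l\<^sup>2 - y\<^sup>2) / (2 * l\<^sup>2) \<le> l\<^sup>2 / (2 * l\<^sup>2)" by (intro divide_right_mono) auto
    also have "\<dots> = 1/2" using l by simp
    finally show ?thesis unfolding eq[OF y] by linarith
  qed
  show "H y = 0" if "l \<le> y" for y
  proof -
    have "integral {y..l} (\<lambda>y. \<theta> y / y) = integral {y..l} (\<lambda>_. 0)"
      by (rule Henstock_Kurzweil_Integration.integral_cong) (use z that in auto)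
    then show ?thesis by (simp add: H_def)
  qed
  show "0 \<le> H y" if "0 < y" for y
    unfolding H_def using that \<theta>_bounds
    by (intro integral_nonneg integrable_continuous_interval continuous_on_subset[OF c]) auto
qed

context growth
begin

text \<open>The energy estimate for the profile \<open>inverse (G (y * L))\<close>: there
  \<open>f y * G (y * L) = \<theta> y\<close>, so the error constant is 1, and \<open>P c\<close> is
  at most \<open>T * ln (l / c)\<close> by \<open>Tc\<close>. Both contributions are proportional to
  \<open>T\<close>, like the volume of the cylinder. The parameter \<mu> weighs the energy against a
  constant in Young's inequality and stays free for the final optimisation.\<close>

lemma sublevel_mass_small:
  fixes A :: "'n::finite vector_field" and u :: "(real ^ 'n) \<times> real \<Rightarrow> real"
    and C0 C1 r d \<rho>0 t0 T h2 c l \<epsilon> \<alpha> \<mu> :: real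
  assumes struct: "structure_conditions C0 C1 g A" and C: "0 < C0" "0 < C1"
    and ws: "weak_supersolution g A (cube \<rho>0 \<times> {t0<..<0}) u" and nn: "\<And>z. z \<in> cube \<rho>0 \<times> {t0<..<0} \<Longrightarrow> 0 \<le> u z"
    and r: "0 < r" "0 < d" "r + d < \<rho>0" and T: "t0 < - 2 * T" "0 < h2" "2 * h2 < T"
    and c: "0 < c" "3 * c \<le> l" and \<epsilon>: "0 < \<epsilon>" "\<epsilon> \<le> 1" "2 * Q * C1 * \<epsilon> * Q \<le> C0" and \<mu>: "0 < \<mu>" and \<alpha>: "0 < \<alpha>"
  defines "L \<equiv> 4 * real CARD('n) / d" and "X \<equiv> ccube (r + d) :: (real ^ 'n) set"
  assumes Tc: "c\<^sup>2 / G (c * L) \<le> T"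
    and pos: "\<And>t. t \<in> {- T..- 2 * h2} \<Longrightarrow> \<alpha> * measure lborel X \<le> measure lborel {x \<in> ccube r. l \<le> u (x, t)}"
  shows "\<alpha> * ((ln (l / c) - 5/2) * measure lborel {z \<in> ccube r \<times> {- T..- 2 * h2}. u z < c})
    \<le> 2 ^ CARD('n) * (2 * real CARD('n) * r) * L
       * (\<mu> * (2 / C0 * (ln (l / c) + C0 * inverse \<epsilon> ^ Q + 1)) + \<mu> + 1 / \<mu>) * T * measure lborel X"
proof -
  define \<Lambda> where "\<Lambda> = ln (l / c)"
  have l: "0 < l" "c \<le> l" using c by auto
  have \<Lambda>: "0 \<le> \<Lambda>" using c l by (simp add: \<Lambda>_def)
  have L: "0 < L" using r by (simp add: L_def)
  have T0: "0 < T" using T by simp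
  interpret pr: profile "\<lambda>y. inverse (G (y * L))" l
  proof
    show "continuous_on {0<..} (\<lambda>y. inverse (G (y * L)))"
    proof (intro continuous_intros continuous_on_compose2[OF G_cont])
      show "\<forall>y\<in>{0<..}. G (y * L) \<noteq> 0" using G_pos L by (auto simp: less_imp_neq[THEN not_sym])
    qed (use L in auto)
    show "0 \<le> inverse (G (y * L))" if "0 < y" for y using G_nonneg[of "y * L"] that L by simp
    \<comment> \<open>The monotonicity required of a profile is exactly the quadratic growth of
      \<open>G\<close>.\<close>
    fix y z :: real assume yz: "0 < y" "y \<le> z"
    have "G (y * L) / (y * L)\<^sup>2 \<le> G (z * L) / (z * L)\<^sup>2" using yz L by (intro G_ratio2) auto
    then have "G (y * L) / y\<^sup>2 \<le> G (z * L) / z\<^sup>2" using L by (simp add: power_mult_distrib divide_le_cancel flip: divide_divide_eq_left)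
    then show "inverse (G (z * L)) * z\<^sup>2 \<le> inverse (G (y * L)) * y\<^sup>2"
      using G_pos[of "y * L"] G_pos[of "z * L"] yz L by (simp add: field_simps)
  qed (use l in auto)

  \<comment> \<open>Approximation and cut-off functions\<close>
  have Xc: "compact X" "convex X" using ccube_convex_compact by (auto simp: X_def)
  have mX: "0 < measure lborel X" unfolding X_def using r by (subst measure_ccube) auto
  have rX: "ccube r \<subseteq> X" unfolding X_def using r by (intro ccube_subset(2)) simp
  have sub: "X \<times> {- 2 * T..- h2} \<subseteq> cube \<rho>0 \<times> {t0<..<0}"
    unfolding X_def using r T by (intro Sigma_mono ccube_subset(1)) auto
  have cu: "continuous_on (X \<times> {- 2 * T..- h2}) u"
    using ws sub unfolding weak_supersolution_def by (auto intro: continuous_on_subset)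
  define M where "M = inverse (G (c * L)) * (1 + c)"
  have Gc: "0 < G (c * L)" using c L by (intro G_pos) simp
  have M: "pr.f y \<le> M" "pr.p y \<le> M" if "c \<le> y" for y
    using pr.f_bound[OF c(1) that] c Gc by (auto simp: M_def distrib_left intro: order_trans)
  have M0: "0 < M" using c Gc by (auto simp: M_def)
  define B where "B = M * (1 + Q * L)"
  have B: "0 < B" using M0 L by (auto simp: B_def intro!: mult_pos_pos add_pos_nonneg)
  define e' where "e' = min c (measure lborel X * T / B)"
  have e': "0 < e'" "e' \<le> c" "B * e' \<le> measure lborel X * T" using c mX B T0 by (auto simp: e'_def min_def field_simps)
  have st: "- 2 * T \<le> - h2" "- h2 < 0" using T by auto
  have rd: "0 < r + d" using r by simp
  obtain w F e where w: "C1_fun w" "\<And>z. 0 \<le> w z" and wu: "\<And>z. z \<in> X \<times> {- 2 * T..- h2} \<Longrightarrow> \<bar>w z - u z\<bar> \<le> e'"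
    and F: "integrable lborel F" and e: "integrable lborel e" "\<And>z. 0 \<le> e z" "(\<integral>z. e z \<partial>lborel) < e'"
    and coer: "\<And>z. z \<in> X \<times> {- 2 * T..- h2} \<Longrightarrow> C0 * G (norm (space_grad w z)) - e z \<le> F z \<bullet> space_grad w z"
    and bd: "\<And>z. z \<in> X \<times> {- 2 * T..- h2} \<Longrightarrow> norm (F z) \<le> C1 * g (norm (space_grad w z)) + e z"
    and weak: "\<And>\<psi>. C1_fun \<psi> \<Longrightarrow> closure {z. \<psi> z \<noteq> 0} \<subseteq> X \<times> {- 2 * T..- h2} \<Longrightarrow> (\<And>z. 0 \<le> \<psi> z) \<Longrightarrow>
       0 \<le> - (\<integral>z. w z * time_deriv \<psi> z \<partial>lborel) + (\<integral>z. F z \<bullet> space_grad \<psi> z \<partial>lborel)"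
    using cylinder_approx[OF struct C ws nn rd r(3) T(1) st e'(1)] unfolding X_def by blast
  obtain \<zeta> :: "real ^ 'n \<Rightarrow> real" where \<zeta>: "C1_fun \<zeta>" "\<And>x. 0 \<le> \<zeta> x" "\<And>x. \<zeta> x \<le> 1"
    "\<And>x. norm (grad \<zeta> x) \<le> L" "\<And>x. x \<notin> X \<Longrightarrow> \<zeta> x = 0" and \<zeta>1: "\<And>x. x \<in> ccube r \<Longrightarrow> \<zeta> x = 1"
    using space_cutoff[OF r(1,2), where 'n = 'n] unfolding grad_def L_def X_def by metis
  have T2: "- 2 * T + T = - T" by simp
  obtain \<sigma>1 \<sigma>1' where \<sigma>1: "\<And>t. (\<sigma>1 has_real_derivative \<sigma>1' t) (at t)" "continuous_on UNIV \<sigma>1'"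
    "\<And>t. 0 \<le> \<sigma>1' t" "\<And>t. 0 \<le> \<sigma>1 t" "\<And>t. \<sigma>1 t \<le> 1" "\<And>t. t \<le> - 2 * T \<Longrightarrow> \<sigma>1 t = 0" "\<And>t. - T \<le> t \<Longrightarrow> \<sigma>1 t = 1"
    "\<And>t. t \<notin> {- 2 * T..- T} \<Longrightarrow> \<sigma>1' t = 0" "integrable lborel \<sigma>1'" "(\<integral>t. \<sigma>1' t \<partial>lborel) = 1"
    using smoothstep[OF T0, of "- 2 * T", unfolded T2] by metis
  obtain \<sigma>2 \<sigma>2' where \<sigma>2: "\<And>t. (\<sigma>2 has_real_derivative \<sigma>2' t) (at t)" "continuous_on UNIV \<sigma>2'"
    "\<And>t. 0 \<le> \<sigma>2' t" "\<And>t. 0 \<le> \<sigma>2 t" "\<And>t. \<sigma>2 t \<le> 1" "\<And>t. t \<le> - 2 * h2 \<Longrightarrow> \<sigma>2 t = 0" "\<And>t. - 2 * h2 + h2 \<le> t \<Longrightarrow> \<sigma>2 t = 1"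
    "\<And>t. t \<notin> {- 2 * h2..- 2 * h2 + h2} \<Longrightarrow> \<sigma>2' t = 0"
    using smoothstep[OF T(2), of "- 2 * h2"] by metis
  \<comment> \<open>The plateau \<open>{- T..- 2 * h2}\<close> is the time range of the conclusion.
    On the rise only the mass one of the derivative counts; the fall has the favourable sign however
    steep it is, so no power of \<open>1 / h2\<close> appears in the bound.\<close>
  define \<kappa> where "\<kappa> t = \<sigma>1 t - \<sigma>2 t" for t
  define \<kappa>' where "\<kappa>' t = \<sigma>1' t - \<sigma>2' t" for t
  have \<kappa>d: "(\<kappa> has_real_derivative \<kappa>' t) (at t)" for t
    unfolding \<kappa>_def[abs_def] \<kappa>'_def by (intro derivative_intros \<sigma>1(1) \<sigma>2(1))
  have \<kappa>c: "continuous_on UNIV \<kappa>'" unfolding \<kappa>'_def by (intro continuous_intros \<sigma>1(2) \<sigma>2(2))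
  have \<kappa>0: "0 \<le> \<kappa> t" for t
  proof (cases "t \<le> - 2 * h2")
    case True then show ?thesis using \<sigma>2(6)[OF True] \<sigma>1(4)[of t] by (simp add: \<kappa>_def)
  next
    case False then show ?thesis using \<sigma>1(7)[of t] \<sigma>2(5)[of t] T by (simp add: \<kappa>_def)
  qed
  have \<kappa>1: "\<kappa> t \<le> 1" for t using \<sigma>1(5)[of t] \<sigma>2(4)[of t] by (simp add: \<kappa>_def)
  have \<kappa>J: "\<kappa> t = 1" if "t \<in> {- T..- 2 * h2}" for t using \<sigma>1(7)[of t] \<sigma>2(6)[of t] that by (simp add: \<kappa>_def)
  have \<kappa>out: "\<kappa> t = 0" if "t \<notin> {- 2 * T..- h2}" for t
  proof (cases "t < - 2 * T")
    case True then show ?thesis using \<sigma>1(6)[of t] \<sigma>2(6)[of t] T by (simp add: \<kappa>_def)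
  next
    case False then show ?thesis using that \<sigma>1(7)[of t] \<sigma>2(7)[of t] T by (simp add: \<kappa>_def)
  qed

  \<comment> \<open>The energy bound\<close>
  have fG: "pr.f y * G (y * L) = pr.\<theta> y" if y: "0 < y" for y
    using G_pos[of "y * L"] y L by (simp add: pr.f_def)
  have S: "pr.f y * G (y * L) \<le> 1" if y: "c \<le> y" for y
    using fG[of y] y c pr.\<theta>_bounds[of y] by simp
  define W where "W z = pr.P (w z + c) * \<zeta> (fst z) ^ Q" for z
  define D where "D z = pr.f (w z + c) * G (norm (space_grad w z))" for z
  define IE where "IE = (\<integral>z. D z * \<zeta> (fst z) ^ Q * \<kappa> (snd z) \<partial>lborel)"
  have y0: "0 < w z + c" "c \<le> w z + c" for z using w(2)[of z] c by auto
  have D0: "0 \<le> D z" for z unfolding D_def using pr.f_nonneg[OF y0(1)] G_nonneg by simp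
  have cv: "continuous_on UNIV (\<lambda>z. w z + c)" by (intro continuous_intros C1_fun_continuous w)
  have csg: "continuous_on UNIV (space_grad w)" by (rule C1_fun_space_grad_continuous[OF w(1)])
  have Dc: "continuous_on UNIV D"
    unfolding D_def
    by (intro continuous_intros continuous_on_compose2[OF pr.f_cont cv] continuous_on_compose2[OF G_norm_continuous csg])
      (use y0 in auto)
  have c\<zeta>: "continuous_on UNIV (\<lambda>z::(real^'n)\<times>real. \<zeta> (fst z))"
    by (intro continuous_on_compose2[OF C1_fun_continuous[OF \<zeta>(1)]] continuous_intros) auto
  have c\<kappa>: "continuous_on UNIV \<kappa>"
    by (rule DERIV_continuous_on[of UNIV \<kappa> \<kappa>']) (use \<kappa>d in simp)
  have Kc: "compact (X \<times> {- 2 * T..- h2})" by (intro compact_Times Xc compact_Icc)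
  have out: "\<zeta> (fst z) ^ Q * \<sigma>' (snd z) = 0" if "z \<notin> X \<times> {- 2 * T..- h2}" "\<And>t. t \<notin> {- 2 * T..- h2} \<Longrightarrow> \<sigma>' t = 0" for \<sigma>' :: "real \<Rightarrow> real" and z
    using that(1) \<zeta>(5)[of "fst z"] that(2)[of "snd z"] Q_ge2 by (cases z) (auto simp: zero_power)
  have iD: "integrable lborel (\<lambda>z. D z * \<zeta> (fst z) ^ Q * \<kappa> (snd z))"
  proof (rule integrable_continuous_compact_support[OF _ Kc])
    show "continuous_on UNIV (\<lambda>z. D z * \<zeta> (fst z) ^ Q * \<kappa> (snd z))"
      by (intro continuous_intros Dc c\<zeta> continuous_on_compose2[OF c\<kappa>]) auto
    show "D z * \<zeta> (fst z) ^ Q * \<kappa> (snd z) = 0" if "z \<notin> X \<times> {- 2 * T..- h2}" for z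
      using out[OF that, of \<kappa>, OF \<kappa>out] by (simp add: mult.assoc)
  qed
  have Xf: "emeasure lborel X < \<infinity>" using emeasure_bounded_finite[OF compact_imp_bounded[OF Xc(1)]] .
  have Xm: "X \<in> sets borel" using borel_compact[OF Xc(1)] .
  have mrX: "measure lborel (ccube r :: (real ^ 'n) set) \<le> measure lborel X"
    using rX Xf Xm by (intro measure_mono_fmeasurable) (auto simp: fmeasurable_def ccube_def)
  have iX: "integrable lborel (\<lambda>x. pr.P c * indicator X x :: real)" using Xm Xf by auto
  \<comment> \<open>The prefactor in \<open>P_le\<close> is \<open>c\<^sup>2 / G (c * L)\<close>,
    which \<open>Tc\<close> compares with \<open>T\<close>.\<close>
  have Pc: "pr.P c \<le> T * \<Lambda>"
  proof -
    have "pr.P c \<le> (inverse (G (c * L)) * c\<^sup>2) * \<Lambda>" using pr.P_le[OF c(1) l(2)] by (simp add: \<Lambda>_def)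
    also have "\<dots> \<le> T * \<Lambda>" using Tc \<Lambda> by (intro mult_right_mono) (auto simp: field_simps)
    finally show ?thesis .
  qed
  have \<kappa>'out: "\<kappa>' t = 0" if "t \<notin> {- 2 * T..- h2}" for t
    using \<sigma>1(8)[of t] \<sigma>2(8)[of t] that T by (auto simp: \<kappa>'_def)
  have up: "(\<integral>z. W z * \<kappa>' (snd z) \<partial>lborel) \<le> T * \<Lambda> * measure lborel X"
  proof -
    have "(\<integral>z. W z * \<kappa>' (snd z) \<partial>lborel) \<le> (\<integral>z. (pr.P c * indicator X (fst z)) * \<sigma>1' (snd z) \<partial>lborel)"
    proof (rule integral_mono[OF _ integral_times_product(1)[OF iX \<sigma>1(9)]])
      show "integrable lborel (\<lambda>z. W z * \<kappa>' (snd z))"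
      proof (rule integrable_continuous_compact_support[OF _ Kc])
        show "continuous_on UNIV (\<lambda>z. W z * \<kappa>' (snd z))"
          unfolding W_def using w c
          by (intro continuous_intros c\<zeta> pr.P_comp_cont C1_fun_continuous continuous_on_compose2[OF \<kappa>c]) auto
        show "W z * \<kappa>' (snd z) = 0" if "z \<notin> X \<times> {- 2 * T..- h2}" for z
          using out[OF that, of \<kappa>', OF \<kappa>'out] by (simp add: W_def mult.assoc)
      qed
      fix z :: "(real ^ 'n) \<times> real"
      have W0: "0 \<le> W z" using pr.P_nonneg[OF y0(1)[of z]] \<zeta>(2) by (simp add: W_def)
      have "W z \<le> pr.P c * indicator X (fst z)"
      proof (cases "fst z \<in> X")
        case False then show ?thesis using \<zeta>(5)[OF False] Q_ge2 by (simp add: W_def zero_power)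
      next
        case True
        have "pr.P (w z + c) \<le> pr.P c" using y0[of z] c by (intro pr.P_antimono)
        moreover have "\<zeta> (fst z) ^ Q \<le> 1" using \<zeta>(2,3) by (intro power_le_one) auto
        ultimately have "W z \<le> pr.P c * 1"
          unfolding W_def using \<zeta>(2) pr.P_nonneg[OF c(1)] by (intro mult_mono) auto
        then show ?thesis using True by simp
      qed
      then have "W z * \<sigma>1' (snd z) \<le> (pr.P c * indicator X (fst z)) * \<sigma>1' (snd z)" by (rule mult_right_mono[OF _ \<sigma>1(3)])
      moreover have "W z * \<kappa>' (snd z) \<le> W z * \<sigma>1' (snd z)"
        using W0 \<sigma>2(3)[of "snd z"] by (intro mult_left_mono) (auto simp: \<kappa>'_def)
      ultimately show "W z * \<kappa>' (snd z) \<le> (pr.P c * indicator X (fst z)) * \<sigma>1' (snd z)" by linarith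
    qed
    also have "\<dots> = pr.P c * measure lborel X"
      unfolding integral_times_product(2)[OF iX \<sigma>1(9)] using \<sigma>1(10) Xm by simp
    also have "\<dots> \<le> T * \<Lambda> * measure lborel X" using Pc by (intro mult_right_mono) auto
    finally show ?thesis .
  qed
  have en: "C0 / 2 * IE \<le> (\<integral>z. W z * \<kappa>' (snd z) \<partial>lborel)
      + C0 / 2 * inverse \<epsilon> ^ Q * 1 * measure lborel X * (- h2 - - 2 * T) + B * (\<integral>z. e z \<partial>lborel)"
    unfolding W_def B_def IE_def D_def
    by (rule energy_estimate[OF C w F e(1,2) coer bd weak Xc(1) st(1) c(1) pr.P_deriv pr.p_deriv pr.f_cont pr.f_nonneg pr.p_nonneg pr.p_le M L S \<zeta> \<kappa>d \<kappa>c \<kappa>0 \<kappa>1 \<kappa>out \<epsilon>])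
  have 1: "B * (\<integral>z. e z \<partial>lborel) \<le> measure lborel X * T"
    using mult_left_mono[OF less_imp_le[OF e(3)] less_imp_le[OF B]] e'(3) by linarith
  have 2: "C0 / 2 * inverse \<epsilon> ^ Q * 1 * measure lborel X * (- h2 - - 2 * T) \<le> C0 / 2 * inverse \<epsilon> ^ Q * 1 * measure lborel X * (2 * T)"
    using T C \<epsilon> mX by (intro mult_left_mono) auto
  have "C0 / 2 * IE \<le> T * \<Lambda> * measure lborel X + C0 / 2 * inverse \<epsilon> ^ Q * 1 * measure lborel X * (2 * T) + measure lborel X * T"
    using en up 1 2 by linarith
  also have "\<dots> = (\<Lambda> + C0 * inverse \<epsilon> ^ Q + 1) * (T * measure lborel X)" by (simp add: algebra_simps)
  finally have "C0 / 2 * IE \<le> (\<Lambda> + C0 * inverse \<epsilon> ^ Q + 1) * (T * measure lborel X)" .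
  then have IE: "IE \<le> 2 / C0 * (\<Lambda> + C0 * inverse \<epsilon> ^ Q + 1) * (T * measure lborel X)"
    using C by (simp add: field_simps)

  \<comment> \<open>Poincare's inequality for the truncated logarithm on time slices\<close>
  define H where "H y = integral {y..l} (\<lambda>y. pr.\<theta> y / y)" for y
  note Hp = pr.log_profile[folded H_def]
  \<comment> \<open>The norm of the spatial gradient of \<open>H (w + c)\<close>.\<close>
  define \<phi> where "\<phi> z = pr.\<theta> (w z + c) / (w z + c) * norm (space_grad w z)" for z
  have \<phi>0: "0 \<le> \<phi> z" for z unfolding \<phi>_def using pr.\<theta>_bounds y0[of z] by simp
  have c\<phi>: "continuous_on UNIV \<phi>"
    unfolding \<phi>_def using y0 by (intro continuous_intros continuous_on_compose2[OF pr.\<theta>_cont[of UNIV] cv] cv csg) (auto simp: less_imp_neq[THEN not_sym])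
  have cH: "continuous_on UNIV (\<lambda>z. H (w z + c))"
  proof (rule continuous_on_compose2[OF _ cv])
    show "continuous_on {0<..} H" by (rule DERIV_continuous_on) (use Hp(1) in \<open>auto intro: has_field_derivative_at_within\<close>)
  qed (use y0 in auto)
  define J :: "((real ^ 'n) \<times> real) set" where "J = ccube r \<times> {- T..- 2 * h2}"
  have Jc: "compact J" unfolding J_def by (intro compact_Times ccube_convex_compact compact_Icc)
  have JK: "J \<subseteq> X \<times> {- 2 * T..- h2}" unfolding J_def using rX T by (intro Sigma_mono) auto
  have Jm: "J \<in> sets borel" using borel_compact[OF Jc] .
  have intJ: "integrable lborel (\<lambda>z. indicator J z * f z)" if "continuous_on UNIV f" for f :: "(real^'n)\<times>real \<Rightarrow> real"
    using borel_integrable_compact[OF Jc continuous_on_subset[OF that]] by simp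
  define dn where "dn = 2 * real CARD('n) * r"
  have dn: "0 \<le> dn" using r by (simp add: dn_def)
  have slice: "\<alpha> * (\<integral>x. indicator (ccube r) x * H (w (x, t) + c) \<partial>lborel) \<le> 2 ^ CARD('n) * dn * (\<integral>x. indicator (ccube r) x * \<phi> (x, t) \<partial>lborel)"
    if t: "t \<in> {- T..- 2 * h2}" for t
  proof -
    have blin: "bounded_linear (\<lambda>x::real^'n. (x, 0::real))" by (intro bounded_linear_Pair bounded_linear_ident bounded_linear_zero)
    have wt: "C1_fun (\<lambda>x. w (x, t))" "FD (\<lambda>x. w (x, t)) x v = space_grad w (x, t) \<bullet> v" for x v
      using C1_fun_linear[OF w(1) blin, of "(0, t)"] by (simp_all add: space_grad_inner[OF w(1)])
    have vt: "C1_fun (\<lambda>x. w (x, t) + c)" "FD (\<lambda>x. w (x, t) + c) x v = space_grad w (x, t) \<bullet> v" for x v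
    proof -
      have d: "((\<lambda>x. w (x, t) + c) has_derivative (\<lambda>v. space_grad w (x, t) \<bullet> v)) (at x)" for x
      proof -
        have "FD (\<lambda>x. w (x, t)) x = (\<lambda>v. space_grad w (x, t) \<bullet> v)" by (rule ext) (rule wt(2))
        then show ?thesis
          using has_derivative_add_const[OF C1_funD(1)[OF wt(1), of x], where c = c] by simp
      qed
      have cc: "continuous_on UNIV (\<lambda>x. space_grad w (x, t) \<bullet> v)" for v
        by (intro continuous_intros continuous_on_compose2[OF csg]) auto
      show "C1_fun (\<lambda>x. w (x, t) + c)" by (rule C1_funI(1)[OF d cc])
      show "FD (\<lambda>x. w (x, t) + c) x v = space_grad w (x, t) \<bullet> v" unfolding C1_funI(2)[OF d cc] ..
    qed
    have cvt: "continuous_on UNIV (\<lambda>x. w (x, t) + c)" by (rule C1_fun_continuous[OF vt(1)])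
    have ct: "continuous_on UNIV (\<lambda>x. - (pr.\<theta> (w (x, t) + c) / (w (x, t) + c)))"
      using y0[of "(_, t)"] by (intro continuous_intros continuous_on_compose2[OF pr.\<theta>_cont[of UNIV] cvt] cvt) (auto simp: less_imp_neq[THEN not_sym])
    note Ht = C1_fun_chain[OF vt(1), of H "\<lambda>y. - (pr.\<theta> y / y)", OF Hp(1)[OF y0(1)] ct]
    have cut: "continuous_on (ccube r) (\<lambda>x. u (x, t))"
      by (rule continuous_on_compose2[OF cu]) (use t T rX in \<open>auto intro!: continuous_intros\<close>)
    let ?Z = "{x \<in> ccube r. l \<le> u (x, t)}"
    have Zb: "?Z \<in> sets borel" using sublevel_borel(1)[OF cut ccube_convex_compact(2)] by simp
    have "measure lborel ?Z * (\<integral>x. indicator (ccube r) x * H (w (x, t) + c) \<partial>lborel)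
      \<le> 2 ^ DIM(real ^ 'n) * dn * measure lborel (ccube r :: (real ^ 'n) set) * (\<integral>x. indicator (ccube r) x * \<phi> (x, t) \<partial>lborel)"
    proof (rule poincare_zero_set[OF Ht(1)])
      show "0 \<le> H (w (x, t) + c)" for x by (rule Hp(4)[OF y0(1)])
      show "\<bar>FD (\<lambda>x. H (w (x, t) + c)) x v\<bar> \<le> \<phi> (x, t) * norm v" for x v
      proof -
        have "\<bar>space_grad w (x, t) \<bullet> v\<bar> \<le> norm (space_grad w (x, t)) * norm v" by (rule Cauchy_Schwarz_ineq2)
        then have "pr.\<theta> (w (x, t) + c) / (w (x, t) + c) * \<bar>space_grad w (x, t) \<bullet> v\<bar> \<le> pr.\<theta> (w (x, t) + c) / (w (x, t) + c) * (norm (space_grad w (x, t)) * norm v)"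
          using pr.\<theta>_bounds y0[of "(x, t)"] by (intro mult_left_mono) auto
        then show ?thesis using pr.\<theta>_bounds y0[of "(x, t)"] unfolding Ht(2) vt(2) \<phi>_def by (simp add: abs_mult mult.assoc)
      qed
      show "0 \<le> \<phi> (x, t)" for x by (rule \<phi>0)
      show "continuous_on UNIV (\<lambda>x. \<phi> (x, t))" by (rule continuous_on_compose2[OF c\<phi>]) (auto intro!: continuous_intros)
      show "convex (ccube r :: (real ^ 'n) set)" "compact (ccube r :: (real ^ 'n) set)" by (rule ccube_convex_compact)+
      show "norm (x - y) \<le> dn" if "x \<in> ccube r" "y \<in> ccube r" for x y :: "real ^ 'n" using ccube_diam[OF that] by (simp add: dn_def)
      show "0 \<le> dn" by (rule dn)
      show "?Z \<in> sets borel" by (rule Zb)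
      show "?Z \<subseteq> ccube r" by auto
      \<comment> \<open>On \<open>?Z\<close> the mollification error is at most \<open>c\<close>,
        and the shift by \<open>c\<close> makes up for it: \<open>w + c \<ge> l\<close>.\<close>
      show "H (w (x, t) + c) = 0" if "x \<in> ?Z" for x
      proof -
        have "(x, t) \<in> X \<times> {- 2 * T..- h2}" using that t T rX by auto
        from wu[OF this] have "u (x, t) - c \<le> w (x, t)" using e' by linarith
        then show ?thesis using that by (intro Hp(3)) simp
      qed
    qed
    also have "\<dots> \<le> 2 ^ CARD('n) * dn * measure lborel X * (\<integral>x. indicator (ccube r) x * \<phi> (x, t) \<partial>lborel)"
    proof -
      note mrX
      moreover have "0 \<le> (\<integral>x. indicator (ccube r) x * \<phi> (x, t) \<partial>lborel)" using \<phi>0 by (intro integral_nonneg_AE AE_I2) auto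
      moreover have dim: "DIM(real ^ 'n) = CARD('n)" by simp
      ultimately show ?thesis unfolding dim using dn by (intro mult_right_mono mult_left_mono mult_nonneg_nonneg) simp_all
    qed
    finally have a: "measure lborel ?Z * (\<integral>x. indicator (ccube r) x * H (w (x, t) + c) \<partial>lborel) \<le> 2 ^ CARD('n) * dn * measure lborel X * (\<integral>x. indicator (ccube r) x * \<phi> (x, t) \<partial>lborel)" .
    have "0 \<le> (\<integral>x. indicator (ccube r) x * H (w (x, t) + c) \<partial>lborel)" using Hp(4)[OF y0(1)] by (intro integral_nonneg_AE AE_I2) auto
    with pos[OF t] have "\<alpha> * measure lborel X * (\<integral>x. indicator (ccube r) x * H (w (x, t) + c) \<partial>lborel) \<le> measure lborel ?Z * (\<integral>x. indicator (ccube r) x * H (w (x, t) + c) \<partial>lborel)"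
      by (intro mult_right_mono)
    with a have "measure lborel X * (\<alpha> * (\<integral>x. indicator (ccube r) x * H (w (x, t) + c) \<partial>lborel)) \<le> measure lborel X * (2 ^ CARD('n) * dn * (\<integral>x. indicator (ccube r) x * \<phi> (x, t) \<partial>lborel))"
      by (simp add: mult_ac)
    then show ?thesis using mX by simp
  qed
  have fub: "(\<integral>z. indicator J z * f z \<partial>lborel) = (\<integral>t. indicator {- T..- 2 * h2} t * (\<integral>x. indicator (ccube r) x * f (x, t) \<partial>lborel) \<partial>lborel)"
    "integrable lborel (\<lambda>t. indicator {- T..- 2 * h2} t * (\<integral>x. indicator (ccube r) x * f (x, t) \<partial>lborel))"
    if "continuous_on UNIV f" for f :: "(real^'n)\<times>real \<Rightarrow> real"
  proof -
    have i: "integrable (lborel \<Otimes>\<^sub>M lborel) (\<lambda>(x, t). indicator J (x, t) * f (x, t))"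
      using intJ[OF that] by (simp add: lborel_prod case_prod_beta')
    have eq: "(\<integral>x. indicator J (x, t) * f (x, t) \<partial>lborel) = indicator {- T..- 2 * h2} t * (\<integral>x. indicator (ccube r) x * f (x, t) \<partial>lborel)" for t
      by (cases "t \<in> {- T..- 2 * h2}") (simp_all add: J_def indicator_times)
    show "(\<integral>z. indicator J z * f z \<partial>lborel) = (\<integral>t. indicator {- T..- 2 * h2} t * (\<integral>x. indicator (ccube r) x * f (x, t) \<partial>lborel) \<partial>lborel)"
      using lborel_pair.integral_snd[OF i] unfolding eq by (simp add: lborel_prod case_prod_beta')
    show "integrable lborel (\<lambda>t. indicator {- T..- 2 * h2} t * (\<integral>x. indicator (ccube r) x * f (x, t) \<partial>lborel))"
      using lborel_pair.integrable_snd[OF i] unfolding eq .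
  qed
  have poin: "\<alpha> * (\<integral>z. indicator J z * H (w z + c) \<partial>lborel) \<le> 2 ^ CARD('n) * dn * (\<integral>z. indicator J z * \<phi> z \<partial>lborel)"
  proof -
    have "(\<integral>t. \<alpha> * (indicator {- T..- 2 * h2} t * (\<integral>x. indicator (ccube r) x * H (w (x, t) + c) \<partial>lborel)) \<partial>lborel)
       \<le> (\<integral>t. 2 ^ CARD('n) * dn * (indicator {- T..- 2 * h2} t * (\<integral>x. indicator (ccube r) x * \<phi> (x, t) \<partial>lborel)) \<partial>lborel)"
    proof (rule integral_mono)
      fix t
      show "\<alpha> * (indicator {- T..- 2 * h2} t * (\<integral>x. indicator (ccube r) x * H (w (x, t) + c) \<partial>lborel))
         \<le> 2 ^ CARD('n) * dn * (indicator {- T..- 2 * h2} t * (\<integral>x. indicator (ccube r) x * \<phi> (x, t) \<partial>lborel))"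
        using slice[of t] by (cases "t \<in> {- T..- 2 * h2}") auto
    qed (intro integrable_mult_right fub(2) cH c\<phi>)+
    then show ?thesis unfolding fub(1)[OF cH] fub(1)[OF c\<phi>] by simp
  qed

  \<comment> \<open>The logarithmic gradient against the energy\<close>
  have \<phi>le: "\<phi> z \<le> L * (\<mu> * D z + (\<mu> + 1 / \<mu>))" for z
  proof -
    define y where "y = w z + c"
    \<comment> \<open>The gradient in units of \<open>y * L\<close>. First
      \<open>v \<le> \<mu> * v\<^sup>2 + 1 / \<mu>\<close>; then, for \<open>v \<ge> 1\<close>,
      quadratic growth gives \<open>v\<^sup>2 * G (y * L) \<le> G (v * (y * L))\<close>, which is
      the energy density, while for \<open>v < 1\<close> a constant is enough.\<close>
    define v where "v = norm (space_grad w z) / (y * L)"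
    have y: "0 < y" using y0 by (simp add: y_def)
    have v: "0 \<le> v" using y L by (simp add: v_def)
    have n: "norm (space_grad w z) = v * (y * L)" using y L by (simp add: v_def)
    have "\<phi> z = L * (pr.\<theta> y * v)" using y by (simp add: \<phi>_def y_def[symmetric] n)
    moreover have "pr.\<theta> y * v \<le> \<mu> * D z + (\<mu> + 1 / \<mu>)"
    proof -
      have "v \<le> \<mu> * v\<^sup>2 + 1 / \<mu>"
      proof (cases "\<mu> * v \<le> 1")
        case True
        then have "v \<le> 1 / \<mu>" using \<mu> by (simp add: field_simps)
        then show ?thesis using \<mu> by (simp add: add_increasing)
      next
        case False
        then have "1 * v \<le> \<mu> * v * v" using v by (intro mult_right_mono) auto
        then show ?thesis using \<mu> by (simp add: power2_eq_square mult.assoc add_increasing2)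
      qed
      then have "pr.\<theta> y * v \<le> pr.\<theta> y * (\<mu> * v\<^sup>2 + 1 / \<mu>)" using pr.\<theta>_bounds by (intro mult_left_mono)
      also have "\<dots> = \<mu> * (pr.\<theta> y * v\<^sup>2) + pr.\<theta> y * (1 / \<mu>)" by (simp add: algebra_simps)
      also have "pr.\<theta> y * (1 / \<mu>) \<le> 1 * (1 / \<mu>)" using pr.\<theta>_bounds \<mu> by (intro mult_right_mono) auto
      also have "pr.\<theta> y * v\<^sup>2 \<le> D z + 1"
      proof (cases "1 \<le> v")
        case True
        have "pr.\<theta> y * v\<^sup>2 = pr.f y * (v\<^sup>2 * G (y * L))" using fG[OF y] by (simp add: mult.left_commute mult.commute)
        also have "\<dots> \<le> pr.f y * G (v * (y * L))"
          using True y L pr.f_nonneg[OF y] by (intro mult_left_mono G_scale_ge) auto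
        finally show ?thesis by (simp add: D_def y_def[symmetric] n)
      next
        case False
        have "v\<^sup>2 \<le> 1" using False v by (intro power_le_one) auto
        then have "pr.\<theta> y * v\<^sup>2 \<le> 1 * 1" using pr.\<theta>_bounds by (intro mult_mono) auto
        then show ?thesis using D0[of z] by simp
      qed
      finally show ?thesis using \<mu> by (simp add: algebra_simps)
    qed
    ultimately show ?thesis using L by (simp add: mult_left_mono)
  qed
  have mJ: "measure lborel J \<le> T * measure lborel X" "emeasure lborel J < \<infinity>"
  proof -
    have cm: "(ccube r :: (real ^ 'n) set) \<in> sets lborel" by (simp add: ccube_def)
    have "emeasure (lborel \<Otimes>\<^sub>M lborel) (ccube r \<times> {- T..- 2 * h2} :: ((real ^ 'n) \<times> real) set) = emeasure lborel (ccube r :: (real ^ 'n) set) * emeasure lborel {- T..- 2 * h2}"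
      by (rule lborel.emeasure_pair_measure_Times[OF cm]) simp
    then have "emeasure lborel J = emeasure lborel (ccube r :: (real ^ 'n) set) * ennreal (T - 2 * h2)" using T by (simp add: lborel_prod J_def)
    then have "measure lborel J = measure lborel (ccube r :: (real ^ 'n) set) * (T - 2 * h2)" using T by (simp add: measure_def enn2real_mult)
    also have "\<dots> \<le> measure lborel X * T"
    proof (rule mult_mono)
      show "measure lborel (ccube r :: (real ^ 'n) set) \<le> measure lborel X" by (rule mrX)
    qed (use T in auto)
    finally show "measure lborel J \<le> T * measure lborel X" by (simp add: mult.commute)
    show "emeasure lborel J < \<infinity>" using emeasure_bounded_finite[OF compact_imp_bounded[OF Jc]] .
  qed
  have iJ: "integrable lborel (indicator J :: _ \<Rightarrow> real)" using mJ(2) Jm by (intro integrable_real_indicator) auto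
  have \<phi>int: "(\<integral>z. indicator J z * \<phi> z \<partial>lborel) \<le> L * (\<mu> * IE + (\<mu> + 1 / \<mu>) * (T * measure lborel X))"
  proof -
    have "(\<integral>z. indicator J z * \<phi> z \<partial>lborel) \<le> (\<integral>z. L * (\<mu> * (D z * \<zeta> (fst z) ^ Q * \<kappa> (snd z)) + (\<mu> + 1 / \<mu>) * indicator J z) \<partial>lborel)"
    proof (rule integral_mono[OF intJ[OF c\<phi>]])
      show "integrable lborel (\<lambda>z. L * (\<mu> * (D z * \<zeta> (fst z) ^ Q * \<kappa> (snd z)) + (\<mu> + 1 / \<mu>) * indicator J z))"
        by (intro integrable_mult_right Bochner_Integration.integrable_add iD iJ)
      fix z :: "(real ^ 'n) \<times> real"
      show "indicator J z * \<phi> z \<le> L * (\<mu> * (D z * \<zeta> (fst z) ^ Q * \<kappa> (snd z)) + (\<mu> + 1 / \<mu>) * indicator J z)"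
      proof (cases "z \<in> J")
        case True
        then have "\<zeta> (fst z) = 1" "\<kappa> (snd z) = 1" using \<zeta>1 \<kappa>J by (auto simp: J_def)
        then show ?thesis using True \<phi>le[of z] by simp
      next
        case False
        then show ?thesis using D0[of z] \<zeta>(2) \<kappa>0 L \<mu> by simp
      qed
    qed
    also have "\<dots> = L * (\<mu> * IE + (\<mu> + 1 / \<mu>) * measure lborel J)"
      using iD iJ Jm by (simp add: IE_def)
    also have "\<dots> \<le> L * (\<mu> * IE + (\<mu> + 1 / \<mu>) * (T * measure lborel X))"
      using mJ(1) L \<mu> by (intro mult_left_mono add_left_mono) auto
    finally show ?thesis .
  qed

  \<comment> \<open>Lower bound on the sublevel set, and conclusion\<close>
  have cuJ: "continuous_on J u" using continuous_on_subset[OF cu JK] .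
  define V where "V = {z \<in> J. u z < c}"
  have Vm: "V \<in> sets borel" unfolding V_def by (rule sublevel_borel(2)[OF cuJ Jc])
  have Vf: "emeasure lborel V < \<infinity>" using emeasure_mono[of V J lborel] mJ(2) Jm by (auto simp: V_def intro: le_less_trans)
  have low: "(\<Lambda> - 5/2) * measure lborel V \<le> (\<integral>z. indicator J z * H (w z + c) \<partial>lborel)"
  proof -
    have "(\<Lambda> - 5/2) * measure lborel V = (\<integral>z. (\<Lambda> - 5/2) * indicator V z \<partial>lborel)" using Vm by simp
    also have "\<dots> \<le> (\<integral>z. indicator J z * H (w z + c) \<partial>lborel)"
    proof (rule integral_mono[OF _ intJ[OF cH]])
      show "integrable lborel (\<lambda>z. (\<Lambda> - 5/2) * indicator V z)" using Vm Vf by auto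
      fix z
      show "(\<Lambda> - 5/2) * indicator V z \<le> indicator J z * H (w z + c)"
      proof (cases "z \<in> V")
        case False then show ?thesis using Hp(4)[OF y0(1)[of z]] by simp
      next
        case True
        then have z: "z \<in> J" "u z < c" by (auto simp: V_def)
        have "\<bar>w z - u z\<bar> \<le> e'" using wu z(1) JK by auto
        then have le: "w z + c \<le> 3 * c" using z e' by linarith
        \<comment> \<open>On \<open>V\<close> one has \<open>w + c \<le> 3 * c\<close>. The loss
          \<open>5/2\<close> is 2 as a bound for \<open>ln 3\<close> and \<open>1/2\<close> from
          \<open>H\<close>.\<close>
        have "ln (3::real) \<le> 2" using ln_le_minus_one[of 3] by simp
        moreover have "ln (w z + c) \<le> ln (3 * c)" using le y0[of z] c by (intro ln_mono) auto
        ultimately have "\<Lambda> - 5/2 \<le> ln (l / (w z + c)) - 1/2"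
          using c l y0[of z] by (simp add: \<Lambda>_def ln_div ln_mult)
        also have "\<dots> \<le> H (w z + c)" using le c y0[of z] by (intro Hp(2)) auto
        finally show ?thesis using True z by simp
      qed
    qed
    finally show ?thesis .
  qed
  have "\<alpha> * ((\<Lambda> - 5/2) * measure lborel V) \<le> \<alpha> * (\<integral>z. indicator J z * H (w z + c) \<partial>lborel)"
    using low \<alpha> by (intro mult_left_mono) auto
  also note poin
  also have "2 ^ CARD('n) * dn * (\<integral>z. indicator J z * \<phi> z \<partial>lborel) \<le> 2 ^ CARD('n) * dn * (L * (\<mu> * IE + (\<mu> + 1 / \<mu>) * (T * measure lborel X)))"
    using \<phi>int dn by (intro mult_left_mono) auto
  also have "\<dots> \<le> 2 ^ CARD('n) * dn * (L * (\<mu> * (2 / C0 * (\<Lambda> + C0 * inverse \<epsilon> ^ Q + 1) * (T * measure lborel X)) + (\<mu> + 1 / \<mu>) * (T * measure lborel X)))"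
    using IE dn L \<mu> by (intro mult_left_mono add_right_mono) auto
  also have "\<dots> = 2 ^ CARD('n) * dn * L * (\<mu> * (2 / C0 * (\<Lambda> + C0 * inverse \<epsilon> ^ Q + 1)) + \<mu> + 1 / \<mu>) * T * measure lborel X"
    by (simp only: distrib_left distrib_right mult.assoc)
  finally show ?thesis unfolding V_def J_def \<Lambda>_def dn_def .
qed

end

section \<open>The expansion of positivity\<close>

text \<open>A test function for the smaller set is one for the larger set, and all integrands vanish
  off its support. Property (P) needs this, since it speaks of the interior of its own
  cylinder.\<close>

lemma weak_supersolution_subset:
  fixes A :: "'n::finite vector_field" and u :: "(real ^ 'n) \<times> real \<Rightarrow> real"
  assumes ws: "weak_supersolution g A \<Omega> u" and sub: "\<Omega>' \<subseteq> \<Omega>" and o: "open \<Omega>'"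
  shows "weak_supersolution g A \<Omega>' u"
proof -
  from ws obtain Du where cu: "continuous_on \<Omega> u"
     and K: "\<And>K. compact K \<Longrightarrow> K \<subseteq> \<Omega> \<Longrightarrow> set_integrable lebesgue K Du"
     and gr: "\<And>\<phi>. test_function \<Omega> \<phi> \<Longrightarrow> (LINT z:\<Omega>|lebesgue. u z *\<^sub>R space_grad \<phi> z) = - (LINT z:\<Omega>|lebesgue. \<phi> z *\<^sub>R Du z)"
     and iG: "set_integrable lebesgue \<Omega> (\<lambda>z. G_of g (norm (Du z)))"
     and mA: "set_borel_measurable lebesgue \<Omega> (\<lambda>z. A (fst z) (snd z) (u z) (Du z))"
     and ineq: "\<And>\<phi>. test_function \<Omega> \<phi> \<Longrightarrow> (\<And>z. 0 \<le> \<phi> z) \<Longrightarrow>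
           - (LINT z:\<Omega>|lebesgue. u z * time_deriv \<phi> z)
           + (LINT z:\<Omega>|lebesgue. A (fst z) (snd z) (u z) (Du z) \<bullet> space_grad \<phi> z) \<ge> 0"
    unfolding weak_supersolution_def weak_space_grad_def by blast
  have test: "test_function \<Omega> \<phi>" if "test_function \<Omega>' \<phi>" for \<phi> :: "(real ^ 'n) \<times> real \<Rightarrow> real"
    using that sub unfolding test_function_def by auto
  have out: "\<phi> z = 0" "space_grad \<phi> z = 0" "time_deriv \<phi> z = 0" if "test_function \<Omega>' \<phi>" "z \<notin> \<Omega>'" for \<phi> :: "(real ^ 'n) \<times> real \<Rightarrow> real" and z
  proof -
    have s: "closure {z. \<phi> z \<noteq> 0} \<subseteq> \<Omega>'" using that by (simp add: test_function_def)
    show "space_grad \<phi> z = 0" "time_deriv \<phi> z = 0" using derivs_zero_outside[OF s that(2)] by auto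
    show "\<phi> z = 0" using s that(2) closure_subset[of "{z. \<phi> z \<noteq> 0}"] by auto
  qed
  have eq: "(LINT z:\<Omega>|lebesgue. f z) = (LINT z:\<Omega>'|lebesgue. f z)" if "\<And>z. z \<notin> \<Omega>' \<Longrightarrow> f z = 0"
    for f :: "(real ^ 'n) \<times> real \<Rightarrow> 'b::{banach, second_countable_topology}"
    unfolding set_lebesgue_integral_def
    by (rule Bochner_Integration.integral_cong[OF refl]) (use that sub in \<open>auto simp: indicator_def\<close>)
  have om: "\<Omega>' \<in> sets lebesgue" using o by (simp add: borel_open sets_completionI_sets)
  have "weak_space_grad \<Omega>' u Du"
    unfolding weak_space_grad_def
  proof (intro conjI allI impI)
    show "set_integrable lebesgue K Du" if "compact K \<and> K \<subseteq> \<Omega>'" for K using K that sub by blast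
    fix \<phi> :: "(real ^ 'n) \<times> real \<Rightarrow> real" assume t: "test_function \<Omega>' \<phi>"
    show "(LINT z:\<Omega>'|lebesgue. u z *\<^sub>R space_grad \<phi> z) = - (LINT z:\<Omega>'|lebesgue. \<phi> z *\<^sub>R Du z)"
      using gr[OF test[OF t]] eq[of "\<lambda>z. u z *\<^sub>R space_grad \<phi> z"] eq[of "\<lambda>z. \<phi> z *\<^sub>R Du z"] out[OF t] by simp
  qed
  moreover have "set_integrable lebesgue \<Omega>' (\<lambda>z. G_of g (norm (Du z)))"
    by (rule set_integrable_subset[OF iG om sub])
  moreover have "set_borel_measurable lebesgue \<Omega>' (\<lambda>z. A (fst z) (snd z) (u z) (Du z))"
    by (rule set_borel_measurable_subset[OF mA om sub])
  moreover have "- (LINT z:\<Omega>'|lebesgue. u z * time_deriv \<phi> z)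
           + (LINT z:\<Omega>'|lebesgue. A (fst z) (snd z) (u z) (Du z) \<bullet> space_grad \<phi> z) \<ge> 0"
    if t: "test_function \<Omega>' \<phi>" "\<And>z. 0 \<le> \<phi> z" for \<phi>
    using ineq[OF test[OF t(1)] t(2)] eq[of "\<lambda>z. u z * time_deriv \<phi> z"] out[OF t(1)]
      eq[of "\<lambda>z. A (fst z) (snd z) (u z) (Du z) \<bullet> space_grad \<phi> z"] by simp
  ultimately show ?thesis
    using o continuous_on_subset[OF cu sub] unfolding weak_supersolution_def by blast
qed

text \<open>The essential supremum of a nonmeasurable function is infinite, so the assumed lower
  bound already contains the measurability of \<open>u\<close> on \<open>S'\<close>, and this
  restricts to \<open>S\<close>.\<close>

lemma ess_inf_on_mono:
  fixes u :: "(real ^ 'n::finite) \<times> real \<Rightarrow> real"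
  assumes "S \<subseteq> S'" "S \<in> sets lebesgue" "S' \<in> sets lebesgue" and le: "ereal c \<le> ess_inf_on S' u"
  shows "ereal c \<le> ess_inf_on S u"
proof -
  let ?f = "\<lambda>z. - ereal (u z)"
  have es: "esssup (restrict_space lebesgue S') ?f \<le> - ereal c"
    using le unfolding ess_inf_on_def by (metis ereal_minus_le_minus ereal_uminus_uminus)
  have m: "?f \<in> borel_measurable (restrict_space lebesgue S')"
  proof (rule ccontr)
    assume "?f \<notin> borel_measurable (restrict_space lebesgue S')"
    from esssup_non_measurable[OF this] es show False by (simp add: top_ereal_def)
  qed
  have ae: "AE z in lebesgue. z \<in> S' \<longrightarrow> ?f z \<le> - ereal c"
  proof -
    have "AE z in restrict_space lebesgue S'. ?f z \<le> - ereal c"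
      using esssup_AE[of ?f "restrict_space lebesgue S'"] by eventually_elim (rule order_trans[OF _ es])
    then show ?thesis using assms(3) by (subst (asm) AE_restrict_space_iff) auto
  qed
  have "?f \<in> borel_measurable (restrict_space lebesgue S)"
  proof -
    have "restrict_space lebesgue S = restrict_space (restrict_space lebesgue S') S"
      using assms(1) by (simp add: restrict_restrict_space Int_absorb1 assms(2,3))
    then show ?thesis using measurable_restrict_space1[OF m] by simp
  qed
  then have "esssup (restrict_space lebesgue S) ?f \<le> - ereal c"
  proof (rule esssup_I)
    show "AE z in restrict_space lebesgue S. ?f z \<le> - ereal c"
      using ae assms(1,2) by (subst AE_restrict_space_iff) (auto elim!: eventually_mono)
  qed
  then show ?thesis unfolding ess_inf_on_def by (metis ereal_minus_le_minus ereal_uminus_uminus)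
qed

lemma open_cube: "open (cube \<rho> :: (real ^ 'n::finite) set)"
  by (simp add: cube_eq_box open_box)

lemma cube_finite: "emeasure lborel (cube \<rho> :: (real ^ 'n::finite) set) < \<infinity>"
  unfolding cube_eq_box by (rule emeasure_bounded_finite[OF bounded_box])

text \<open>If every slice were worse than claimed, integration in time would contradict the
  hypothesis. Passing from \<nu> to \<open>\<nu> / 2\<close> makes the contradiction strict.\<close>

lemma good_time_slice:
  fixes u :: "(real ^ 'n::finite) \<times> real \<Rightarrow> real"
  assumes cu: "continuous_on (cube \<rho> \<times> {a<..<b}) u" and ab: "a < b" and \<rho>: "0 < \<rho>" and \<nu>: "0 < \<nu>" "\<nu> < 1"
    and le: "measure lborel ((cube \<rho> \<times> {a<..<b}) \<inter> {z. u z < k}) \<le> (1 - \<nu>) * measure lborel (cube \<rho> :: (real ^ 'n) set) * (b - a)"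
  obtains s where "s \<in> {a<..<b}" "measure lborel {x \<in> cube \<rho>. u (x, s) < k} \<le> (1 - \<nu> / 2) * measure lborel (cube \<rho> :: (real ^ 'n) set)"
proof -
  define m where "m = measure lborel (cube \<rho> :: (real ^ 'n) set)"
  have m: "0 < m" unfolding m_def using \<rho> by (subst measure_cube) auto
  let ?O = "(cube \<rho> \<times> {a<..<b}) \<inter> {z. u z < k}"
  have op: "open ?O"
    using continuous_open_preimage[OF cu _ open_lessThan[of k]] open_cube[of \<rho>, where 'n = 'n]
    by (simp add: open_Times vimage_def)
  have fin: "emeasure lborel ?O < \<infinity>"
    by (rule emeasure_bounded_finite) (intro bounded_Int disjI1 bounded_Times; simp add: cube_eq_box bounded_box)
  have "\<exists>s\<in>{a<..<b}. measure lborel {x \<in> cube \<rho>. u (x, s) < k} \<le> (1 - \<nu> / 2) * m"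
  proof (rule ccontr)
    assume "\<not> ?thesis"
    then have big: "(1 - \<nu> / 2) * m < measure lborel {x \<in> cube \<rho>. u (x, s) < k}" if "s \<in> {a<..<b}" for s using that by (auto simp: not_le)
    have "ennreal ((1 - \<nu> / 2) * m * (b - a)) = (\<integral>\<^sup>+s. ennreal ((1 - \<nu> / 2) * m) * indicator {a<..<b} s \<partial>lborel)"
      using m \<nu> ab by (simp add: nn_integral_cmult ennreal_mult)
    also have "\<dots> \<le> (\<integral>\<^sup>+s. emeasure lborel ((\<lambda>x. (x, s)) -` ?O) \<partial>lborel)"
    proof (rule nn_integral_mono)
      fix s
      show "ennreal ((1 - \<nu> / 2) * m) * indicator {a<..<b} s \<le> emeasure lborel ((\<lambda>x. (x, s)) -` ?O)"
      proof (cases "s \<in> {a<..<b}")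
        case True
        then have eq: "(\<lambda>x. (x, s)) -` ?O = {x \<in> cube \<rho>. u (x, s) < k}" by auto
        have "emeasure lborel {x \<in> cube \<rho>. u (x, s) < k} \<le> emeasure lborel (cube \<rho> :: (real ^ 'n) set)"
          using open_cube[of \<rho>, where 'n = 'n] by (intro emeasure_mono) auto
        then have "emeasure lborel {x \<in> cube \<rho>. u (x, s) < k} = ennreal (measure lborel {x \<in> cube \<rho>. u (x, s) < k})"
          using cube_finite[of \<rho>, where 'n = 'n] by (intro emeasure_eq_ennreal_measure) (auto simp: top_unique)
        then show ?thesis using True big[OF True] unfolding eq by (auto intro: ennreal_leI)
      qed simp
    qed
    also have "\<dots> = emeasure lborel ?O"
    proof -
      have "?O \<in> sets (lborel \<Otimes>\<^sub>M lborel)" using op by (simp only: lborel_prod sets_lborel borel_open)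
      from lborel_pair.emeasure_pair_measure_alt2[OF this] show ?thesis by (simp only: lborel_prod)
    qed
    also have "\<dots> = ennreal (measure lborel ?O)" using fin by (intro emeasure_eq_ennreal_measure) auto
    finally have "(1 - \<nu> / 2) * m * (b - a) \<le> measure lborel ?O" by (subst (asm) ennreal_le_iff) auto
    also have "\<dots> \<le> (1 - \<nu>) * m * (b - a)" using le by (simp add: m_def)
    finally have "(1 - \<nu> / 2) * (m * (b - a)) \<le> (1 - \<nu>) * (m * (b - a))" by (simp add: mult.assoc)
    then show False using m ab \<nu> by (simp add: mult_le_cancel_right)
  qed
  then show ?thesis using that unfolding m_def by blast
qed

context growth
begin

text \<open>A good slice \<open>s\<close> in the window before \<tau>, then
  \<open>positivity_propagation\<close> from \<open>s\<close> to \<tau>. As the window has the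
  intrinsic length \<Delta>, the error term is bounded by a data constant \<open>B\<close>. The
  fraction \<sigma> by which the cube shrinks is small enough to spare most of the volume, and the
  depth \<Lambda> of the new level is large enough for the gain, a multiple of
  \<open>\<nu> * \<Lambda>\<close>, to outweigh \<open>B\<close>.\<close>

lemma measure_positivity:
  fixes A :: "'n::finite vector_field" and u :: "(real ^ 'n) \<times> real \<Rightarrow> real"
    and C0 C1 \<nu> \<epsilon> \<omega> R \<Delta> t0 \<tau> :: real
  assumes struct: "structure_conditions C0 C1 g A" and C: "0 < C0" "0 < C1"
    and ws: "weak_supersolution g A (cube (2 * R) \<times> {t0<..<0}) u"
    and nn: "\<And>z. z \<in> cube (2 * R) \<times> {t0<..<0} \<Longrightarrow> 0 \<le> u z"
    and \<nu>: "0 < \<nu>" "\<nu> < 1" and \<epsilon>: "0 < \<epsilon>" "\<epsilon> \<le> 1" "2 * Q * C1 * \<epsilon> * Q \<le> C0"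
    and \<omega>: "0 < \<omega>" "0 < R" and \<Delta>: "\<Delta> = \<omega>\<^sup>2 * inverse (G (\<omega> / (2 * R)))"
    and \<tau>: "t0 \<le> \<tau> - \<Delta>" "\<tau> < 0"
    and hyp: "measure lebesgue ((cube (2 * R) \<times> {\<tau> - \<Delta><..<\<tau>}) \<inter> {z. u z < \<omega> / 2})
      \<le> (1 - \<nu>) * measure lebesgue (cube (2 * R) :: (real ^ 'n) set) * \<Delta>"
  defines "\<sigma> \<equiv> \<nu> / (2 * real CARD('n))"
  defines "\<Lambda> \<equiv> 8 * (4 * C0 * inverse \<epsilon> ^ Q * (8 * real CARD('n) / \<sigma>) ^ Q + 4) / \<nu>"
  shows "\<nu> / 8 * measure lborel (cube (2 * R) :: (real ^ 'n) set)
    \<le> measure lborel {x \<in> ccube ((2 - \<sigma>) * R). \<omega> / 4 * exp (- \<Lambda>) \<le> u (x, \<tau>)}"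
proof -
  define n where "n = real CARD('n)"
  have n: "1 \<le> n" by (simp add: n_def Suc_leI)
  define L0 where "L0 = 8 * n / \<sigma>"
  define B where "B = 4 * C0 * inverse \<epsilon> ^ Q * L0 ^ Q"
  \<comment> \<open>Bernoulli's inequality will turn \<open>n * \<sigma> = \<nu> / 2\<close> into a
    volume loss of at most the fraction \<open>\<nu> / 4\<close>.\<close>
  have \<sigma>: "0 < \<sigma>" "\<sigma> \<le> 1/2" and n\<sigma>: "n * \<sigma> = \<nu> / 2"
    using \<nu> n by (auto simp: \<sigma>_def n_def[symmetric] field_simps)
  have L0: "1 \<le> L0" using n \<sigma> by (simp add: L0_def field_simps)
  have B: "0 \<le> B" using C \<epsilon> L0 by (simp add: B_def)
  have \<Lambda>: "\<Lambda> = 8 * (B + 4) / \<nu>" by (simp add: \<Lambda>_def B_def L0_def n_def)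
  have \<Lambda>\<nu>: "\<Lambda> * \<nu> = 8 * (B + 4)" using \<nu> by (simp add: \<Lambda>)
  have \<Lambda>32: "32 \<le> \<Lambda>"
  proof -
    have "32 * \<nu> \<le> 32 * 1" using \<nu> by (intro mult_left_mono) auto
    also have "\<dots> \<le> \<Lambda> * \<nu>" using B unfolding \<Lambda>\<nu> by simp
    finally show ?thesis using \<nu> by simp
  qed
  define m where "m = measure lborel (cube (2 * R) :: (real ^ 'n) set)"
  have m: "m = (4 * R) ^ CARD('n)" unfolding m_def using \<omega> by (subst measure_cube) auto
  have m0: "0 < m" using \<omega> by (simp add: m)
  have G0: "0 < G (\<omega> / (2 * R))" using \<omega> by (intro G_pos) simp
  have \<Delta>0: "0 < \<Delta>" using G0 \<omega> by (simp add: \<Delta>)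
  have cu: "continuous_on (cube (2 * R) \<times> {t0<..<0}) u" using ws by (simp add: weak_supersolution_def)
  have sub: "cube (2 * R) \<times> {\<tau> - \<Delta><..<\<tau>} \<subseteq> (cube (2 * R) :: (real ^ 'n) set) \<times> {t0<..<0}" using \<tau> by (intro Sigma_mono) auto
  have cu2: "continuous_on (cube (2 * R) \<times> {\<tau> - \<Delta><..<\<tau>}) u" by (rule continuous_on_subset[OF cu sub])
  have opb: "(cube (2 * R) \<times> {\<tau> - \<Delta><..<\<tau>}) \<inter> {z. u z < \<omega> / 2} \<in> sets lborel"
    using continuous_open_preimage[OF cu2 _ open_lessThan[of "\<omega>/2"]] open_cube[of "2 * R", where 'n = 'n]
    by (simp add: open_Times vimage_def borel_open)
  have mc: "measure lebesgue (cube (2 * R) :: (real ^ 'n) set) = m"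
    unfolding m_def using open_cube[of "2 * R", where 'n = 'n] by (intro measure_completion) (simp add: borel_open)
  have hyp': "measure lborel ((cube (2 * R) \<times> {\<tau> - \<Delta><..<\<tau>}) \<inter> {z. u z < \<omega> / 2}) \<le> (1 - \<nu>) * measure lborel (cube (2 * R) :: (real ^ 'n) set) * (\<tau> - (\<tau> - \<Delta>))"
    using hyp unfolding mc m_def[symmetric] measure_completion[OF opb] by simp
  have R2: "0 < 2 * R" using \<omega> by simp
  have ab: "\<tau> - \<Delta> < \<tau>" using \<Delta>0 by simp
  obtain s where s: "s \<in> {\<tau> - \<Delta><..<\<tau>}" and ms: "measure lborel {x \<in> cube (2 * R). u (x, s) < \<omega> / 2} \<le> (1 - \<nu> / 2) * m"
    using good_time_slice[OF cu2 ab R2 \<nu> hyp'] unfolding m_def by blast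
  define r where "r = (2 - \<sigma>) * R"
  define d where "d = \<sigma> * R / 2"
  have rd: "0 < r" "0 < d" "r + d < 2 * R" using \<sigma> \<omega> by (auto simp: r_def d_def algebra_simps)
  define L where "L = 4 * real CARD('n) / d"
  have L: "L = L0 / R" using \<sigma> \<omega> by (simp add: L_def d_def L0_def n_def field_simps)
  define X :: "(real ^ 'n) set" where "X = ccube (r + d)"
  define l where "l = \<omega> / 2"
  define c where "c = l * exp (- \<Lambda>)"
  have l: "0 < l" using \<omega> by (simp add: l_def)
  have "2 \<le> exp \<Lambda>" using exp_ge_add_one_self[of \<Lambda>] \<Lambda>32 by linarith
  then have c: "0 < c" "2 * c \<le> l" using l by (auto simp: c_def exp_minus field_simps)
  have lc: "ln (l / c) = \<Lambda>" using l by (simp add: c_def ln_div ln_mult)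
  have st: "t0 < s" "s < \<tau>" using s \<tau> by auto
  have X2: "X \<subseteq> cube (2 * R)" unfolding X_def using rd by (intro ccube_subset(1)) simp
  have mX: "measure lborel X \<le> m" "0 \<le> measure lborel X"
    unfolding m_def using X2 cube_finite[of "2 * R", where 'n = 'n] open_cube[of "2 * R", where 'n = 'n]
    by (auto intro!: measure_mono_fmeasurable simp: fmeasurable_def X_def ccube_def)
  have m1: "measure lborel {x \<in> X. u (x, s) < l} \<le> (1 - \<nu> / 2) * m"
  proof -
    have cs: "continuous_on (cube (2 * R)) (\<lambda>x. u (x, s))"
      by (rule continuous_on_compose2[OF cu]) (use s \<tau> in \<open>auto intro!: continuous_intros\<close>)
    have o: "open {x \<in> cube (2 * R). u (x, s) < \<omega> / 2}"
      using continuous_open_preimage[OF cs open_cube open_lessThan[of "\<omega>/2"]] by (simp add: vimage_def Int_def)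
    have Xc: "compact X" unfolding X_def by (rule ccube_convex_compact)
    have "measure lborel {x \<in> X. u (x, s) < l} \<le> measure lborel {x \<in> cube (2 * R). u (x, s) < \<omega> / 2}"
    proof (rule measure_mono_fmeasurable)
      show "{x \<in> X. u (x, s) < l} \<subseteq> {x \<in> cube (2 * R). u (x, s) < \<omega> / 2}" using X2 by (auto simp: l_def)
      show "{x \<in> X. u (x, s) < l} \<in> sets lborel"
        using sublevel_borel(2)[OF continuous_on_subset[OF cs X2] Xc] by simp
      have "emeasure lborel {x \<in> cube (2 * R). u (x, s) < \<omega> / 2} \<le> emeasure lborel (cube (2 * R) :: (real ^ 'n) set)"
        using open_cube[of "2 * R", where 'n = 'n] by (intro emeasure_mono) auto
      then show "{x \<in> cube (2 * R). u (x, s) < \<omega> / 2} \<in> fmeasurable lborel"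
        using o cube_finite[of "2 * R", where 'n = 'n] by (auto simp: fmeasurable_def intro: le_less_trans)
    qed
    with ms show ?thesis by linarith
  qed
  have Gl: "C0 / 2 * inverse \<epsilon> ^ Q * (G (l * L) / l\<^sup>2) * (2 * (\<tau> - s)) \<le> B"
  proof -
    have "G (l * L) = G (L0 * (\<omega> / (2 * R)))" by (simp add: l_def L mult.commute)
    also have "\<dots> \<le> L0 ^ Q * G (\<omega> / (2 * R))" using L0 \<omega> by (intro G_scale_le) auto
    finally have "G (l * L) / l\<^sup>2 \<le> L0 ^ Q * G (\<omega> / (2 * R)) / l\<^sup>2" by (intro divide_right_mono) auto
    \<comment> \<open>This is the definition of \<Delta>; the 4 stems from
      \<open>l = \<omega> / 2\<close>.\<close>
    also have "\<dots> = 4 * L0 ^ Q / \<Delta>" using \<omega> G0 by (simp add: \<Delta> l_def field_simps power2_eq_square)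
    finally have 1: "G (l * L) / l\<^sup>2 \<le> 4 * L0 ^ Q / \<Delta>" .
    have 2: "2 * (\<tau> - s) \<le> 2 * \<Delta>" using s by simp
    have "G (l * L) / l\<^sup>2 * (2 * (\<tau> - s)) \<le> 4 * L0 ^ Q / \<Delta> * (2 * \<Delta>)"
      using 1 2 s L0 \<Delta>0 by (intro mult_mono) auto
    also have "\<dots> = 8 * L0 ^ Q" using \<Delta>0 by simp
    finally have "C0 / 2 * inverse \<epsilon> ^ Q * (G (l * L) / l\<^sup>2 * (2 * (\<tau> - s))) \<le> C0 / 2 * inverse \<epsilon> ^ Q * (8 * L0 ^ Q)"
      using C \<epsilon> by (intro mult_left_mono) auto
    also have "\<dots> = B" by (simp add: B_def)
    finally show ?thesis by (simp add: mult.assoc)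
  qed
  define m2 where "m2 = measure lborel {x \<in> ccube r. u (x, \<tau>) < c / 2}"
  have "(\<Lambda> - 5/2) * m2 \<le> \<Lambda> * measure lborel {x \<in> X. u (x, s) < l}
      + (C0 / 2 * inverse \<epsilon> ^ Q * (G (l * L) / l\<^sup>2) * (2 * (\<tau> - s)) + 1) * measure lborel X"
    using positivity_propagation[OF struct C ws nn rd st \<tau>(2) c \<epsilon>] unfolding lc m2_def X_def L_def by simp
  also have "\<dots> \<le> \<Lambda> * ((1 - \<nu> / 2) * m) + (B + 1) * m"
    using m1 Gl mX B \<Lambda>32 by (intro add_mono mult_mono) auto
  also have "\<dots> = (\<Lambda> - \<Lambda> * \<nu> / 2 + B + 1) * m" by (simp add: algebra_simps)
  also have "\<dots> \<le> ((1 - 3 * \<nu> / 8) * (\<Lambda> - 5/2)) * m"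
  proof (rule mult_right_mono)
    \<comment> \<open>The choice of \<Lambda> is made for this comparison: the surplus
      \<open>\<Lambda> * \<nu> / 8 = B + 4\<close> pays for \<open>B + 1\<close> and for
      \<open>5/2\<close>.\<close>
    have e: "(1 - 3 * \<nu> / 8) * (\<Lambda> - 5/2) = \<Lambda> - 3 * (\<Lambda> * \<nu>) / 8 - 5/2 + 15 * \<nu> / 16" by (simp add: field_simps)
    show "\<Lambda> - \<Lambda> * \<nu> / 2 + B + 1 \<le> (1 - 3 * \<nu> / 8) * (\<Lambda> - 5/2)" unfolding e \<Lambda>\<nu> using \<nu> by (simp add: field_simps)
  qed (use m0 in simp)
  finally have "(\<Lambda> - 5/2) * m2 \<le> (\<Lambda> - 5/2) * ((1 - 3 * \<nu> / 8) * m)" by (simp add: mult_ac)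
  then have m2: "m2 \<le> (1 - 3 * \<nu> / 8) * m" using \<Lambda>32 by simp
  have mr: "(1 - \<nu> / 4) * m \<le> measure lborel (ccube r :: (real ^ 'n) set)"
  proof -
    have "1 + n * (- \<sigma> / 2) \<le> (1 + - \<sigma> / 2) ^ CARD('n)"
      unfolding n_def using \<sigma> by (intro Bernoulli_inequality) auto
    then have "1 - \<nu> / 4 \<le> (1 - \<sigma> / 2) ^ CARD('n)" using n\<sigma> by simp
    then have "(1 - \<nu> / 4) * m \<le> (1 - \<sigma> / 2) ^ CARD('n) * m" using m0 by (intro mult_right_mono) auto
    also have "\<dots> = ((1 - \<sigma> / 2) * (4 * R)) ^ CARD('n)" by (simp only: m power_mult_distrib)
    also have "(1 - \<sigma> / 2) * (4 * R) = 2 * r" by (simp add: r_def algebra_simps)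
    finally show ?thesis using measure_ccube[of r, where 'n = 'n] rd by simp
  qed
  have Kc: "compact (ccube r :: (real ^ 'n) set)" by (rule ccube_convex_compact)
  have rc: "ccube r \<subseteq> (cube (2 * R) :: (real ^ 'n) set)" using rd by (intro ccube_subset(1)) simp
  have ct: "continuous_on (ccube r) (\<lambda>x. u (x, \<tau>))"
    by (rule continuous_on_compose2[OF cu]) (use \<tau> \<Delta>0 rc in \<open>auto intro!: continuous_intros\<close>)
  have c2: "c / 2 = \<omega> / 4 * exp (- \<Lambda>)" by (simp add: c_def l_def)
  have "measure lborel {x \<in> ccube r. c / 2 \<le> u (x, \<tau>)} = measure lborel ((ccube r :: (real ^ 'n) set) - {x \<in> ccube r. u (x, \<tau>) < c / 2})"
    by (intro arg_cong[where f = "measure lborel"]) auto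
  also have "\<dots> = measure lborel (ccube r :: (real ^ 'n) set) - m2"
    unfolding m2_def
  proof (rule measure_Diff)
    show "emeasure lborel (ccube r :: (real ^ 'n) set) \<noteq> \<infinity>"
      using emeasure_bounded_finite[OF compact_imp_bounded[OF Kc]] by simp
    show "{x \<in> ccube r. u (x, \<tau>) < c / 2} \<in> sets lborel"
      unfolding sets_lborel by (rule sublevel_borel(2)[OF ct Kc])
  qed (auto simp: ccube_def)
  finally have "measure lborel {x \<in> ccube r. c / 2 \<le> u (x, \<tau>)} = measure lborel (ccube r :: (real ^ 'n) set) - m2" .
  \<comment> \<open>Of the whole cube the smaller one keeps the fraction
    \<open>1 - \<nu> / 4\<close>, and the bad set takes at most
    \<open>1 - 3 * \<nu> / 8\<close>.\<close>
  moreover have "\<nu> / 8 * m = (1 - \<nu> / 4) * m - (1 - 3 * \<nu> / 8) * m" by (simp add: algebra_simps)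
  ultimately show ?thesis using m2 mr unfolding m_def[symmetric] r_def[symmetric] c2 by linarith
qed

end

theorem lemma2p3:
  fixes g\<^sub>0 g\<^sub>1 C\<^sub>0 C\<^sub>1 \<nu>\<^sub>0 :: real
  assumes "1 < g\<^sub>0" "g\<^sub>0 \<le> g\<^sub>1" "0 < C\<^sub>0" "0 < C\<^sub>1"
    and "2 \<le> g\<^sub>0"
    and "0 < \<nu>\<^sub>0" "\<nu>\<^sub>0 < 1" "property_P TYPE('n::finite) g\<^sub>0 g\<^sub>1 C\<^sub>0 C\<^sub>1 \<nu>\<^sub>0"
  shows "\<exists>\<theta>\<^sub>0 \<delta>\<^sub>2. 1 < \<theta>\<^sub>0 \<and> 0 < \<delta>\<^sub>2 \<and> \<delta>\<^sub>2 < 1 \<and>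
    (\<forall>g (A :: 'n vector_field) \<omega> R \<Delta> u.
       growth_function g\<^sub>0 g\<^sub>1 g \<longrightarrow> structure_conditions C\<^sub>0 C\<^sub>1 g A \<longrightarrow>
       0 < \<omega> \<longrightarrow> 0 < R \<longrightarrow> \<Delta> = \<omega>\<^sup>2 * inverse (G_of g (\<omega> / (2 * R))) \<longrightarrow>
       weak_supersolution g A (cube (2 * R) \<times> {- \<theta>\<^sub>0 * \<Delta><..<0}) u \<longrightarrow>
       (\<forall>z \<in> cube (2 * R) \<times> {- \<theta>\<^sub>0 * \<Delta><..<0}. 0 \<le> u z) \<longrightarrow>
       (\<forall>T\<^sub>0 \<in> {- \<theta>\<^sub>0 * \<Delta>..- \<Delta>}.
          measure lebesgue ((cube (2 * R) \<times> {T\<^sub>0<..<T\<^sub>0 + \<Delta>}) \<inter> {z. u z < \<omega> / 2})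
            \<le> (1 - \<nu>\<^sub>0) * measure lebesgue (cube (2 * R) :: (real ^ 'n) set) * \<Delta>) \<longrightarrow>
       ess_inf_on (Q_cyl g (\<omega> / 2) (R / 2) (1 / 2)) u \<ge> ereal (\<delta>\<^sub>2 * \<omega>))"
proof -
  note C = assms(3,4) and \<nu> = assms(6,7)

  \<comment> \<open>Constants determined by the data\<close>
  define Q where "Q = nat \<lceil>g\<^sub>1\<rceil>"
  have Q: "g\<^sub>1 \<le> real Q" "0 < real Q" using assms(1,2) unfolding Q_def by linarith+
  define \<epsilon> where "\<epsilon> = min 1 (C\<^sub>0 / (2 * Q * C\<^sub>1 * Q))"
  have \<epsilon>: "0 < \<epsilon>" "\<epsilon> \<le> 1" "2 * Q * C\<^sub>1 * \<epsilon> * Q \<le> C\<^sub>0"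
  proof -
    define q where "q = 2 * real Q * C\<^sub>1 * Q"
    have q: "0 < q" using Q C by (simp add: q_def)
    show "0 < \<epsilon>" "\<epsilon> \<le> 1" using C q by (auto simp: \<epsilon>_def q_def)
    have "\<epsilon> * q \<le> C\<^sub>0 / q * q" using q by (intro mult_right_mono) (auto simp: \<epsilon>_def q_def)
    also have "\<dots> = C\<^sub>0" using q by simp
    finally show "2 * Q * C\<^sub>1 * \<epsilon> * Q \<le> C\<^sub>0" by (simp add: q_def mult_ac)
  qed
  define n where "n = real CARD('n)"
  have n: "1 \<le> n" by (simp add: n_def Suc_leI)
  define \<sigma> where "\<sigma> = \<nu>\<^sub>0 / (2 * real CARD('n))"
  have \<sigma>: "0 < \<sigma>" "\<sigma> \<le> 1/2" using \<nu> n by (auto simp: \<sigma>_def n_def[symmetric] field_simps)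
  define L0 where "L0 = 8 * real CARD('n) / \<sigma>"
  have L0: "1 \<le> L0" using n \<sigma> by (simp add: L0_def n_def[symmetric] field_simps)
  define \<Lambda> where "\<Lambda> = 8 * (4 * C\<^sub>0 * inverse \<epsilon> ^ Q * (8 * real CARD('n) / \<sigma>) ^ Q + 4) / \<nu>\<^sub>0"
  have \<Lambda>0: "0 \<le> \<Lambda>" using C \<epsilon> L0 \<nu> unfolding \<Lambda>_def L0_def[symmetric] by simp
  define E where "E = C\<^sub>0 * inverse \<epsilon> ^ Q + 1"
  have E: "0 \<le> E" using C \<epsilon> by (simp add: E_def)
  \<comment> \<open>With \<open>\<mu> = 1 / y\<close> the bracket in
    \<open>sublevel_mass_small\<close> will be at most \<open>B * y\<close>.\<close>
  define B where "B = 2 / C\<^sub>0 * (1 + E) + 2"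
  have B: "0 \<le> B" using C E by (simp add: B_def)
  \<comment> \<open>Makes \<open>D / y\<close> the bound for the density of the sublevel set. The 64
    collects 8 from the fraction \<open>\<nu>\<^sub>0 / 8\<close>, 2 from replacing
    \<open>y\<^sup>2 - 5/2\<close> by \<open>y\<^sup>2 / 2\<close>, and 4 from the diameter of the
    cube times \<open>L\<close>.\<close>
  define D where "D = 2 ^ CARD('n) * 64 * n * L0 * B / \<nu>\<^sub>0"
  have D: "0 \<le> D" using n L0 B \<nu> by (simp add: D_def)
  \<comment> \<open>The square of \<open>y\<close> will be \<open>ln (l / c)\<close>. The first
    summand makes \<open>2 ^ CARD('n) * D / y\<close> at most \<open>\<nu>\<^sub>0 / 2\<close>, the
    power of 2 accounting for the passage from \<open>cube (2 * R)\<close> to \<open>cube R\<close>.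
    The 3 gives \<open>y\<^sup>2 \<ge> 9\<close>, hence
    \<open>y\<^sup>2 - 5/2 \<ge> y\<^sup>2 / 2\<close>.\<close>
  define y where "y = 2 ^ CARD('n) * 2 * D / \<nu>\<^sub>0 + 3"
  have y: "3 \<le> y" using D \<nu> by (simp add: y_def)
  \<comment> \<open>The level from \<open>measure_positivity\<close>, relative to \<omega>, lowered
    once more by \<open>exp (- (y\<^sup>2))\<close>.\<close>
  define \<delta> where "\<delta> = exp (- \<Lambda>) * exp (- (y\<^sup>2)) / 4"
  have \<delta>: "0 < \<delta>" "2 * \<delta> \<le> 1"
  proof -
    have "exp (- \<Lambda>) * exp (- (y\<^sup>2)) \<le> 1 * 1" using \<Lambda>0 by (intro mult_mono) auto
    then show "0 < \<delta>" "2 * \<delta> \<le> 1" by (auto simp: \<delta>_def)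
  qed
  \<comment> \<open>Bounds the ratio of the intrinsic time at level
    \<open>\<delta> * \<omega>\<close> to \<Delta>, by scaling \<open>G\<close> with the factor
    \<open>1 / (2 * \<delta>)\<close>.\<close>
  define \<rho> where "\<rho> = \<delta>\<^sup>2 * (1 / (2 * \<delta>)) ^ Q"
  have \<rho>: "0 < \<rho>" using \<delta> by (simp add: \<rho>_def)
  \<comment> \<open>Room for the start \<open>- 2 * T\<close> of the time cut-off, and for a window
    of length \<Delta> before every time from \<open>- T\<close> on.\<close>
  define \<theta> where "\<theta> = 2 * \<rho> + 2"
  show ?thesis
  proof (rule exI[of _ \<theta>], rule exI[of _ "\<delta> / 2"], intro conjI allI impI)
    show "1 < \<theta>" using \<rho> by (simp add: \<theta>_def)
    show "0 < \<delta> / 2" "\<delta> / 2 < 1" using \<delta> by auto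
    fix g and A :: "'n vector_field" and \<omega> R \<Delta> :: real and u :: "(real ^ 'n) \<times> real \<Rightarrow> real"
    assume gf: "growth_function g\<^sub>0 g\<^sub>1 g" and struct: "structure_conditions C\<^sub>0 C\<^sub>1 g A"
      and \<omega>: "0 < \<omega>" "0 < R" and \<Delta>: "\<Delta> = \<omega>\<^sup>2 * inverse (G_of g (\<omega> / (2 * R)))"
      and ws: "weak_supersolution g A (cube (2 * R) \<times> {- \<theta> * \<Delta><..<0}) u"
      and nn: "\<forall>z\<in>cube (2 * R) \<times> {- \<theta> * \<Delta><..<0}. 0 \<le> u z"
      and hyp: "\<forall>T\<^sub>0\<in>{- \<theta> * \<Delta>..- \<Delta>}.
          measure lebesgue ((cube (2 * R) \<times> {T\<^sub>0<..<T\<^sub>0 + \<Delta>}) \<inter> {z. u z < \<omega> / 2})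
            \<le> (1 - \<nu>\<^sub>0) * measure lebesgue (cube (2 * R) :: (real ^ 'n) set) * \<Delta>"

    \<comment> \<open>Levels, radii and times for a given solution\<close>
    interpret growth g g\<^sub>0 g\<^sub>1 Q by unfold_locales (use gf assms(5) Q in auto)
    have nn': "\<And>z. z \<in> cube (2 * R) \<times> {- \<theta> * \<Delta><..<0} \<Longrightarrow> 0 \<le> u z" using nn by blast
    have G0: "0 < G (\<omega> / (2 * R))" using \<omega> by (intro G_pos) simp
    have \<Delta>0: "0 < \<Delta>" using G0 \<omega> by (simp add: \<Delta>)
    define r where "r = (2 - \<sigma>) * R"
    define d where "d = \<sigma> * R / 2"
    have rd: "0 < r" "0 < d" "r + d < 2 * R" "R \<le> r" "r \<le> 2 * R"
      using \<sigma> \<omega> by (auto simp: r_def d_def algebra_simps)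
    define L where "L = 4 * real CARD('n) / d"
    have L: "L = L0 / R" using \<sigma> \<omega> by (simp add: L_def d_def L0_def field_simps)
    define l where "l = \<omega> / 4 * exp (- \<Lambda>)"
    define c where "c = \<delta> * \<omega>"
    have l: "0 < l" using \<omega> by (simp add: l_def)
    have cl: "c = l * exp (- (y\<^sup>2))" by (simp add: c_def l_def \<delta>_def)
    have y2: "9 \<le> y\<^sup>2" using power_mono[OF y, of 2] by simp
    have "3 \<le> exp (y\<^sup>2)" using exp_ge_add_one_self[of "y\<^sup>2"] y2 by linarith
    then have c: "0 < c" "3 * c \<le> l" using l by (auto simp: cl exp_minus field_simps)
    have lc: "ln (l / c) = y\<^sup>2" using l by (simp add: cl ln_div ln_mult)
    define T where "T = c\<^sup>2 * inverse (G (c / R))"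
    have Gc: "0 < G (c / R)" using c \<omega> by (intro G_pos) simp
    have T: "0 < T" using c Gc by (simp add: T_def)
    have T\<Delta>: "T \<le> \<rho> * \<Delta>"
    proof -
      have eq: "1 / (2 * \<delta>) * (c / R) = \<omega> / (2 * R)" using \<delta> \<omega> by (simp add: c_def field_simps)
      have "G (\<omega> / (2 * R)) \<le> (1 / (2 * \<delta>)) ^ Q * G (c / R)"
        unfolding eq[symmetric] using \<delta> c \<omega> by (intro G_scale_le) auto
      moreover have "inverse b \<le> K * inverse a" if "a \<le> K * b" "0 < a" "0 < b" for a b K :: real
        using that by (simp add: field_simps)
      ultimately have "inverse (G (c / R)) \<le> (1 / (2 * \<delta>)) ^ Q * inverse (G (\<omega> / (2 * R)))"
        using G0 Gc by blast
      then have "c\<^sup>2 * inverse (G (c / R)) \<le> c\<^sup>2 * ((1 / (2 * \<delta>)) ^ Q * inverse (G (\<omega> / (2 * R))))"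
        by (intro mult_left_mono) auto
      also have "\<dots> = \<rho> * \<Delta>" by (simp add: c_def \<rho>_def \<Delta> power_mult_distrib mult_ac)
      finally show ?thesis by (simp add: T_def)
    qed
    \<comment> \<open>The slab \<open>{- 2 * h2..0}\<close> left out of the estimate fills the share
      \<open>\<nu>\<^sub>0 / 4\<close> of the cylinder. Together with the share
      \<open>\<nu>\<^sub>0 / 2\<close> of \<open>V\<close> this stays strictly below
      \<open>\<nu>\<^sub>0\<close>.\<close>
    define h2 where "h2 = \<nu>\<^sub>0 * T / 8"
    have "\<nu>\<^sub>0 * T < 1 * T" using \<nu> T by (intro mult_strict_right_mono)
    then have h2: "0 < h2" "2 * h2 < T" using \<nu> T by (auto simp: h2_def)
    have \<theta>\<Delta>: "\<theta> * \<Delta> = 2 * (\<rho> * \<Delta>) + 2 * \<Delta>" by (simp add: \<theta>_def algebra_simps)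
    have t0: "- \<theta> * \<Delta> < - 2 * T" using T\<Delta> \<Delta>0 \<theta>\<Delta> by simp
    define m where "m = measure lborel (cube (2 * R) :: (real ^ 'n) set)"
    define X :: "(real ^ 'n) set" where "X = ccube (r + d)"
    have X2: "X \<subseteq> cube (2 * R)" unfolding X_def using rd by (intro ccube_subset(1)) simp
    have mX: "measure lborel X \<le> m"
      unfolding m_def using X2 cube_finite[of "2 * R", where 'n = 'n] open_cube[of "2 * R", where 'n = 'n]
      by (auto intro!: measure_mono_fmeasurable simp: fmeasurable_def X_def ccube_def)

    \<comment> \<open>Positivity on a fixed fraction of every slice\<close>
    have pos: "\<nu>\<^sub>0 / 8 * measure lborel X \<le> measure lborel {x \<in> ccube r. l \<le> u (x, t)}" if t: "t \<in> {- T..- 2 * h2}" for t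
    proof -
      have t1: "- \<theta> * \<Delta> \<le> t - \<Delta>" "t < 0" using t T\<Delta> \<Delta>0 \<theta>\<Delta> h2 T by auto
      have "t - \<Delta> \<in> {- \<theta> * \<Delta>..- \<Delta>}" using t1 by simp
      then have "measure lebesgue ((cube (2 * R) \<times> {t - \<Delta><..<t - \<Delta> + \<Delta>}) \<inter> {z. u z < \<omega> / 2})
            \<le> (1 - \<nu>\<^sub>0) * measure lebesgue (cube (2 * R) :: (real ^ 'n) set) * \<Delta>" using hyp by blast
      then have h: "measure lebesgue ((cube (2 * R) \<times> {t - \<Delta><..<t}) \<inter> {z. u z < \<omega> / 2})
            \<le> (1 - \<nu>\<^sub>0) * measure lebesgue (cube (2 * R) :: (real ^ 'n) set) * \<Delta>" by simp
      have "\<nu>\<^sub>0 / 8 * m \<le> measure lborel {x \<in> ccube r. l \<le> u (x, t)}"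
        using measure_positivity[OF struct C ws nn' \<nu> \<epsilon> \<omega> \<Delta> t1 h]
        unfolding m_def r_def l_def \<Lambda>_def \<sigma>_def .
      moreover have "\<nu>\<^sub>0 / 8 * measure lborel X \<le> \<nu>\<^sub>0 / 8 * m" using mX \<nu> by (intro mult_left_mono) auto
      ultimately show ?thesis by linarith
    qed
    have Tc: "c\<^sup>2 / G (c * L) \<le> T"
    proof -
      have "c / R \<le> c * L" using c L0 \<omega> unfolding L by (simp add: divide_right_mono mult_le_cancel_left1)
      then have "G (c / R) \<le> G (c * L)" using c \<omega> by (intro G_mono) auto
      then show ?thesis using Gc c by (simp add: T_def divide_inverse mult_left_mono)
    qed

    \<comment> \<open>Density of the sublevel set\<close>
    define V where "V = {z \<in> ccube r \<times> {- T..- 2 * h2}. u z < c}"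
    have y0: "0 < 1 / y" "0 < \<nu>\<^sub>0 / 8" using y \<nu> by auto
    have mV: "measure lborel V \<le> D / y * (T * m)"
    proof -
      have "\<nu>\<^sub>0 / 8 * ((y\<^sup>2 - 5/2) * measure lborel V)
        \<le> 2 ^ CARD('n) * (2 * n * r) * L * (1 / y * (2 / C\<^sub>0 * (y\<^sup>2 + C\<^sub>0 * inverse \<epsilon> ^ Q + 1)) + 1 / y + 1 / (1 / y)) * T * measure lborel X"
        using sublevel_mass_small[OF struct C ws nn' rd(1-3) t0 h2 c \<epsilon> y0 Tc[unfolded L_def] pos[unfolded X_def]]
        unfolding lc V_def X_def L_def n_def by blast
      also have "\<dots> \<le> 2 ^ CARD('n) * (4 * n * L0) * (B * y) * T * m"
      proof -
        have 1: "2 ^ CARD('n) * (2 * n * r) * L \<le> 2 ^ CARD('n) * (4 * n * L0)"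
        proof -
          have "2 * n * r * L \<le> 2 * n * (2 * R) * L"
            using rd n L0 \<omega> unfolding L by (intro mult_right_mono mult_left_mono) auto
          also have "\<dots> = 4 * n * L0" using \<omega> by (simp add: L)
          finally have "2 * n * r * L \<le> 4 * n * L0" .
          then show ?thesis by (simp add: mult.assoc)
        qed
        \<comment> \<open>The choice \<open>\<mu> = 1 / y\<close> balances
          \<open>\<mu> * y\<^sup>2\<close> against \<open>1 / \<mu>\<close>; this is where the
          square root of the logarithm arises.\<close>
        have 2: "1 / y * (2 / C\<^sub>0 * (y\<^sup>2 + C\<^sub>0 * inverse \<epsilon> ^ Q + 1)) + 1 / y + 1 / (1 / y) \<le> B * y"
        proof -
          have iy: "1 / y \<le> y"
          proof -
            have "1 / y \<le> 1" using y by simp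
            then show ?thesis using y by linarith
          qed
          have "1 / y * (y\<^sup>2 + E) = y + E * (1 / y)" using y by (simp add: field_simps power2_eq_square)
          also have "\<dots> \<le> y + E * y" using iy E by (intro add_left_mono mult_left_mono)
          finally have "2 / C\<^sub>0 * (1 / y * (y\<^sup>2 + E)) \<le> 2 / C\<^sub>0 * (y + E * y)" using C by (intro mult_left_mono) auto
          then have "1 / y * (2 / C\<^sub>0 * (y\<^sup>2 + E)) \<le> 2 / C\<^sub>0 * (1 + E) * y" by (simp add: algebra_simps)
          moreover have "B * y = 2 / C\<^sub>0 * (1 + E) * y + 2 * y" by (simp add: B_def algebra_simps)
          moreover have "1 / (1 / y) = y" by simp
          ultimately show ?thesis using iy unfolding E_def by (simp add: add.assoc)
        qed
        have p: "0 \<le> 1 / y * (2 / C\<^sub>0 * (y\<^sup>2 + C\<^sub>0 * inverse \<epsilon> ^ Q + 1)) + 1 / y + 1 / (1 / y)" using y C \<epsilon> by simp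
        have "a * b * T * x \<le> a' * b' * T * m"
          if "a \<le> a'" "b \<le> b'" "0 \<le> a'" "0 \<le> b" "0 \<le> x" "x \<le> m" for a a' b b' x
          using that T by (intro mult_mono mult_nonneg_nonneg) auto
        from this[OF 1 2 _ p _ mX] show ?thesis using n L0 by simp
      qed
      also have "\<dots> = \<nu>\<^sub>0 / 8 * (D / 2 * y * (T * m))" using \<nu> by (simp add: D_def)
      finally have "(y\<^sup>2 - 5/2) * measure lborel V \<le> D / 2 * y * (T * m)" using y0(2) by (simp only: mult_le_cancel_left_pos)
      moreover have "y\<^sup>2 / 2 * measure lborel V \<le> (y\<^sup>2 - 5/2) * measure lborel V" using y2 by (intro mult_right_mono) auto
      ultimately have "y\<^sup>2 / 2 * measure lborel V \<le> D / 2 * y * (T * m)" by linarith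
      then show ?thesis using y by (simp add: field_simps power2_eq_square)
    qed

    \<comment> \<open>Application of property (P)\<close>
    define mR where "mR = measure lborel (cube R :: (real ^ 'n) set)"
    have mR: "m = 2 ^ CARD('n) * mR" "0 < mR"
    proof -
      have 1: "m = (2 * (2 * R)) ^ CARD('n)" unfolding m_def by (rule measure_cube) (use \<omega> in simp)
      have 2: "mR = (2 * R) ^ CARD('n)" unfolding mR_def by (rule measure_cube) (use \<omega> in simp)
      show "m = 2 ^ CARD('n) * mR" unfolding 1 2 by (rule power_mult_distrib)
      show "0 < mR" unfolding 2 using \<omega> by simp
    qed
    have mV2: "measure lborel V \<le> \<nu>\<^sub>0 / 2 * (T * mR)"
    proof -
      have "D * 2 ^ CARD('n) \<le> \<nu>\<^sub>0 / 2 * y" using \<nu> by (simp add: y_def field_simps)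
      then have "D / y * 2 ^ CARD('n) \<le> \<nu>\<^sub>0 / 2" using y by (simp add: field_simps)
      then have "(D / y * 2 ^ CARD('n)) * (T * mR) \<le> \<nu>\<^sub>0 / 2 * (T * mR)" using T mR by (intro mult_right_mono) auto
      moreover have "D / y * (T * m) = (D / y * 2 ^ CARD('n)) * (T * mR)" unfolding mR(1) by (simp only: mult_ac)
      ultimately show ?thesis using mV by linarith
    qed
    \<comment> \<open>Property (P) is used at level \<open>c\<close> and radius
      \<open>R / 2\<close>; the doubled radius is \<open>R\<close>, for which \<open>T\<close> was
      defined.\<close>
    have TQ: "T_len g c (2 * (R / 2)) 1 = T" by (simp add: T_len_def T_def)
    have Qc: "Q_cyl g c (2 * (R / 2)) 1 = (cube R :: (real ^ 'n) set) \<times> {- T..0}" unfolding Q_cyl_def TQ by simp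
    have intQ: "interior (Q_cyl g c (2 * (R / 2)) 1) = (cube R :: (real ^ 'n) set) \<times> {- T<..<0}"
      unfolding Qc interior_Times interior_atLeastAtMost_real interior_open[OF open_cube] ..
    have cR: "cube R \<subseteq> (cube (2 * R) :: (real ^ 'n) set)" "cube R \<subseteq> (ccube r :: (real ^ 'n) set)"
    proof -
      show 1: "cube R \<subseteq> (ccube r :: (real ^ 'n) set)" using ccube_subset(3) ccube_subset(2)[OF rd(4)] by blast
      have "ccube r \<subseteq> (cube (2 * R) :: (real ^ 'n) set)" using rd by (intro ccube_subset(1)) simp
      with 1 show "cube R \<subseteq> (cube (2 * R) :: (real ^ 'n) set)" by blast
    qed
    have subQ: "(cube R :: (real ^ 'n) set) \<times> {- T<..<0} \<subseteq> cube (2 * R) \<times> {- \<theta> * \<Delta><..<0}"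
      using cR(1) t0 T by (intro Sigma_mono) auto
    have ws': "weak_supersolution g A (interior (Q_cyl g c (2 * (R / 2)) 1)) u"
      unfolding intQ by (rule weak_supersolution_subset[OF ws subQ]) (intro open_Times open_cube open_greaterThanLessThan)
    have nnQ: "\<forall>z\<in>interior (Q_cyl g c (2 * (R / 2)) 1). 0 \<le> u z" unfolding intQ using nn subQ by blast
    have cyl: "emeasure lborel ((cube R :: (real ^ 'n) set) \<times> {a..b}) = ennreal (mR * (b - a))" if "a \<le> b" for a b
    proof -
      have cm: "(cube R :: (real ^ 'n) set) \<in> sets lborel" using open_cube[of R, where 'n = 'n] by (simp add: borel_open)
      have "emeasure (lborel \<Otimes>\<^sub>M lborel) ((cube R :: (real ^ 'n) set) \<times> {a..b}) = emeasure lborel (cube R :: (real ^ 'n) set) * emeasure lborel {a..b}"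
        by (rule lborel.emeasure_pair_measure_Times[OF cm]) simp
      moreover have "emeasure lborel (cube R :: (real ^ 'n) set) = ennreal mR"
        unfolding mR_def using cube_finite[of R, where 'n = 'n] by (intro emeasure_eq_ennreal_measure) auto
      ultimately show ?thesis using that mR by (simp add: lborel_prod ennreal_mult)
    qed
    have cylm: "(cube \<rho> :: (real ^ 'n) set) \<times> {a..b} \<in> sets lborel" for \<rho> a b :: real
      using open_cube[of \<rho>, where 'n = 'n] by (simp only: sets_lborel borel_prod[symmetric]) (intro pair_measureI; simp add: borel_open)
    have small: "measure lebesgue {z \<in> Q_cyl g c (2 * (R / 2)) 1. u z < c} < \<nu>\<^sub>0 * measure lebesgue (Q_cyl g c (2 * (R / 2)) 1 :: ((real ^ 'n) \<times> real) set)"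
    proof -
      have mQ: "measure lebesgue (Q_cyl g c (2 * (R / 2)) 1 :: ((real ^ 'n) \<times> real) set) = T * mR"
        unfolding Qc using cyl[of "- T" 0] T mR cylm[of R "- T" 0] by (simp add: measure_def mult.commute)
      let ?S = "{z \<in> Q_cyl g c (2 * (R / 2)) 1. u z < c} :: ((real ^ 'n) \<times> real) set"
      have "measure lebesgue ?S \<le> \<nu>\<^sub>0 / 2 * (T * mR) + \<nu>\<^sub>0 / 4 * (T * mR)"
      \<comment> \<open>A set outside the \<sigma>-algebra has \<open>measure\<close> 0 by
        convention, so its measurability need not be settled, although \<open>?S\<close> involves
        values of \<open>u\<close> at time 0.\<close>
      proof (cases "?S \<in> sets lebesgue")
        case False
        then have "measure lebesgue ?S = 0" by (simp add: measure_notin_sets)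
        then show ?thesis using \<nu> T mR by simp
      next
        case True
        have cu: "continuous_on (ccube r \<times> {- T..- 2 * h2}) u"
        proof (rule continuous_on_subset)
          show "continuous_on (cube (2 * R) \<times> {- \<theta> * \<Delta><..<0}) u" using ws by (simp add: weak_supersolution_def)
          show "ccube r \<times> {- T..- 2 * h2} \<subseteq> cube (2 * R) \<times> {- \<theta> * \<Delta><..<0}"
            using rd t0 T h2 by (intro Sigma_mono ccube_subset(1)) auto
        qed
        have VK: "compact (ccube r \<times> {- T..- 2 * h2} :: ((real ^ 'n) \<times> real) set)"
          by (intro compact_Times ccube_convex_compact compact_Icc)
        have Vb: "V \<in> sets lborel" unfolding V_def sets_lborel by (rule sublevel_borel(2)[OF cu VK])
        have Vf: "emeasure lborel V < \<infinity>"
          by (rule emeasure_bounded_finite[OF bounded_subset[OF compact_imp_bounded[OF VK]]]) (auto simp: V_def)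
        let ?N = "(cube R :: (real ^ 'n) set) \<times> {- 2 * h2..0}"
        have N: "?N \<in> sets lborel" "emeasure lborel ?N = ennreal (mR * (2 * h2))"
          using cylm cyl[of "- 2 * h2" 0] h2 by auto
        have sub: "?S \<subseteq> V \<union> ?N"
          unfolding Qc V_def using cR(2) by auto
        have Vl: "V \<in> lmeasurable" "?N \<in> lmeasurable"
          using Vb Vf N by (auto simp: fmeasurable_def)
        have "measure lebesgue ?S \<le> measure lebesgue (V \<union> ?N)"
          using sub True Vl by (intro measure_mono_fmeasurable) auto
        also have "\<dots> \<le> measure lebesgue V + measure lebesgue ?N"
          using Vl by (intro measure_Un_le) (auto simp: fmeasurable_def)
        also have "measure lebesgue V = measure lborel V" using Vb by simp
        also have "measure lebesgue ?N = mR * (2 * h2)" using N mR h2 by (simp add: measure_def)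
        also have "mR * (2 * h2) = \<nu>\<^sub>0 / 4 * (T * mR)" by (simp add: h2_def)
        finally show ?thesis using mV2 by linarith
      qed
      also have "\<dots> = 3 / 4 * (\<nu>\<^sub>0 * (T * mR))" by simp
      also have "\<dots> < \<nu>\<^sub>0 * (T * mR)" using \<nu> T mR by simp
      finally show ?thesis unfolding mQ .
    qed
    have R2: "0 < R / 2" using \<omega> by simp
    have P: "ereal (c / 2) \<le> ess_inf_on (Q_cyl g c (R / 2) 1) u"
      using assms(8) gf struct c(1) R2 ws' nnQ small unfolding property_P_def by blast
    \<comment> \<open>By quadratic growth \<open>k\<^sup>2 / G (k / (R / 2))\<close> does not
      increase with \<open>k\<close>, so the cylinder at the lower level \<open>c\<close> is at
      least as long as the one at level \<open>\<omega> / 2\<close>.\<close>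
    have sub: "Q_cyl g (\<omega> / 2) (R / 2) (1 / 2) \<subseteq> (Q_cyl g c (R / 2) 1 :: ((real ^ 'n) \<times> real) set)"
    proof -
      have co: "c \<le> \<omega> / 2"
      proof -
        have "2 * \<delta> * \<omega> \<le> 1 * \<omega>" using \<delta> \<omega> by (intro mult_right_mono) auto
        then show ?thesis by (simp add: c_def)
      qed
      define a b where "a = c / (R / 2)" and "b = \<omega> / 2 / (R / 2)"
      have ab: "0 < a" "a \<le> b" using co c \<omega> by (auto simp: a_def b_def divide_right_mono)
      have Gab: "0 < G a" "0 < G b" using ab by (auto intro!: G_pos)
      have "G a / a\<^sup>2 \<le> G b / b\<^sup>2" using ab by (intro G_ratio2) auto
      then have "b\<^sup>2 * inverse (G b) \<le> a\<^sup>2 * inverse (G a)" using ab Gab by (simp add: field_simps)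
      then have "(R / 2)\<^sup>2 * (b\<^sup>2 * inverse (G b)) \<le> (R / 2)\<^sup>2 * (a\<^sup>2 * inverse (G a))" by (intro mult_left_mono) auto
      then have "(\<omega> / 2)\<^sup>2 * inverse (G b) \<le> c\<^sup>2 * inverse (G a)"
        using \<omega> by (simp add: a_def b_def power_divide field_simps)
      moreover have "0 \<le> (\<omega> / 2)\<^sup>2 * inverse (G b)" using Gab by simp
      ultimately have "T_len g (\<omega> / 2) (R / 2) (1 / 2) \<le> T_len g c (R / 2) 1"
        unfolding T_len_def a_def[symmetric] b_def[symmetric] by linarith
      then show ?thesis unfolding Q_cyl_def by (intro Sigma_mono) auto
    qed
    have Qm: "(Q_cyl g k (R / 2) \<theta>' :: ((real ^ 'n) \<times> real) set) \<in> sets lebesgue" for k \<theta>'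
      unfolding Q_cyl_def by (rule sets_completionI_sets[OF cylm])
    show "ereal (\<delta> / 2 * \<omega>) \<le> ess_inf_on (Q_cyl g (\<omega> / 2) (R / 2) (1 / 2)) u"
      using ess_inf_on_mono[OF sub _ _ P] Qm by (simp add: c_def)
  qed
qed

end
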